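(* Let $B$ be the set of critical densities of proper minor-closed classes of graphs, let $B'$ be the set of accumulation points of $B$, let $1+B=\{1+\beta:\beta\in B\}$, and let $B_2$ be the set of critical densities $\beta_{\mathcal{A}}$ of proper minor-closed classes $\mathcal{A}$ such that every excluded minor of $\mathcal{A}$ is $2$-connected. Then $1+B \subsetneq B_2 \subseteq B'$; $B_2\cap[0,1) = B'\cap[0,1)=\emptyset$; and $$(1+B)\cap[1,2] = B_2\cap[1,2] = B'\cap[1,2] = \left\{2-\frac1k : k\geq 1\right\}\cup\{2\}.$$
   Context: All graphs are finite and simple; $\rho(G)=e(G)/v(G)$. A class of graphs (closed under isomorphism) is proper if non-empty and not containing all graphs, and minor-closed if it contains all minors of its members. For a class $\mathcal{A}$, $\beta_{\mathcal{A}}=\sup_{G\in\mathcal{A}}\rho(G)$ is its critical density. An excluded minor for a minor-closed class $\mathcal{A}$ is a graph not in $\mathcal{A}$ all of whose proper minors are in $\mathcal{A}$. *)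

theory Defs
  imports "HOL-Analysis.Analysis"
begin

type_synonym 'a graph = "'a set \<times> 'a set set"

abbreviation verts :: "'a graph \<Rightarrow> 'a set" where
  "verts \<equiv> fst"

abbreviation edges :: "'a graph \<Rightarrow> 'a set set" where
  "edges \<equiv> snd"

(* The null graph is not a graph here, so that the density e/v is always meaningful. *)
definition simple_graph :: "'a graph \<Rightarrow> bool" where
  "simple_graph G \<longleftrightarrow> finite (verts G) \<and> verts G \<noteq> {} \<and>
     (\<forall>e\<in>edges G. e \<subseteq> verts G \<and> card e = 2)"

definition density :: "'a graph \<Rightarrow> real" where
  "density G = real (card (edges G)) / real (card (verts G))"

definition graph_iso :: "'a graph \<Rightarrow> 'b graph \<Rightarrow> bool" where
  "graph_iso G H \<longleftrightarrow> (\<exists>f. bij_betw f (verts G) (verts H) \<and> edges H = (\<lambda>e. f ` e) ` edges G)"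

definition delete_verts :: "'a graph \<Rightarrow> 'a set \<Rightarrow> 'a graph" where
  "delete_verts G X = (verts G - X, {e \<in> edges G. e \<inter> X = {}})"

definition delete_edge :: "'a graph \<Rightarrow> 'a set \<Rightarrow> 'a graph" where
  "delete_edge G e = (verts G, edges G - {e})"

(* Contraction of the edge uv: v is merged into u. The resulting loop is dropped by the
   cardinality condition; parallel edges coincide because edges form a set. *)
definition contract_edge :: "'a graph \<Rightarrow> 'a \<Rightarrow> 'a \<Rightarrow> 'a graph" where
  "contract_edge G u v =
     (verts G - {v}, {e \<in> (\<lambda>e. (\<lambda>x. if x = v then u else x) ` e) ` edges G. card e = 2})"

inductive minor_step :: "'a graph \<Rightarrow> 'a graph \<Rightarrow> bool" where
  del_vert: "v \<in> verts G \<Longrightarrow> verts G \<noteq> {v} \<Longrightarrow> minor_step G (delete_verts G {v})"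
| del_edge: "e \<in> edges G \<Longrightarrow> minor_step G (delete_edge G e)"
| contract: "{u, v} \<in> edges G \<Longrightarrow> u \<noteq> v \<Longrightarrow> minor_step G (contract_edge G u v)"

definition is_minor :: "'b graph \<Rightarrow> 'a graph \<Rightarrow> bool" where
  "is_minor H G \<longleftrightarrow> (\<exists>K. minor_step\<^sup>*\<^sup>* G K \<and> graph_iso K H)"

definition is_proper_minor :: "'b graph \<Rightarrow> 'a graph \<Rightarrow> bool" where
  "is_proper_minor H G \<longleftrightarrow> is_minor H G \<and> \<not> graph_iso H G"

definition adjacent :: "'a graph \<Rightarrow> 'a \<Rightarrow> 'a \<Rightarrow> bool" where
  "adjacent G u v \<longleftrightarrow> {u, v} \<in> edges G"

definition connected_graph :: "'a graph \<Rightarrow> bool" where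
  "connected_graph G \<longleftrightarrow> verts G \<noteq> {} \<and> (\<forall>u\<in>verts G. \<forall>v\<in>verts G. (adjacent G)\<^sup>*\<^sup>* u v)"

(* At least three vertices: in particular the single edge is not 2-connected. *)
definition two_connected :: "'a graph \<Rightarrow> bool" where
  "two_connected G \<longleftrightarrow> card (verts G) > 2 \<and>
     (\<forall>X. X \<subseteq> verts G \<and> card X < 2 \<longrightarrow> connected_graph (delete_verts G X))"

(* Every finite graph is isomorphic to one whose vertices are natural numbers, so an
   isomorphism-closed class of finite graphs is given by its members with vertices in nat. *)
definition graph_class :: "nat graph set \<Rightarrow> bool" where
  "graph_class \<A> \<longleftrightarrow> (\<forall>G\<in>\<A>. simple_graph G) \<and>
     (\<forall>G\<in>\<A>. \<forall>H :: nat graph. graph_iso G H \<longrightarrow> H \<in> \<A>)"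

definition proper_class :: "nat graph set \<Rightarrow> bool" where
  "proper_class \<A> \<longleftrightarrow> graph_class \<A> \<and> \<A> \<noteq> {} \<and> \<A> \<noteq> {G. simple_graph G}"

definition minor_closed :: "nat graph set \<Rightarrow> bool" where
  "minor_closed \<A> \<longleftrightarrow> graph_class \<A> \<and> (\<forall>G\<in>\<A>. \<forall>H :: nat graph. is_minor H G \<longrightarrow> H \<in> \<A>)"

(* A supremum in the reals: by Mader's theorem the densities of the members of a proper
   minor-closed class are bounded. *)
definition critical_density :: "nat graph set \<Rightarrow> real" where
  "critical_density \<A> = (SUP G\<in>\<A>. density G)"

definition excluded_minor :: "nat graph set \<Rightarrow> nat graph \<Rightarrow> bool" where
  "excluded_minor \<A> G \<longleftrightarrow> simple_graph G \<and> G \<notin> \<A> \<and>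
     (\<forall>H :: nat graph. is_proper_minor H G \<longrightarrow> H \<in> \<A>)"

definition critical_densities :: "real set" where
  "critical_densities =
     {critical_density \<A> | \<A>. proper_class \<A> \<and> minor_closed \<A>}"

definition critical_densities' :: "real set" where
  "critical_densities' = {x. x islimpt critical_densities}"

definition critical_densities2 :: "real set" where
  "critical_densities2 =
     {critical_density \<A> | \<A>. proper_class \<A> \<and> minor_closed \<A> \<and>
        (\<forall>G. excluded_minor \<A> G \<longrightarrow> two_connected G)}"

end

theory Submission
  imports Defs
begin

text \<open>
  Write $B'$ for the accumulation points of $B$. If all excluded minors of a class are 2-connected, then the
  class is closed under disjoint unions and 1-sums. Gluing copies of $G$ at a vertex then shows
  that the critical density $\beta$ is the supremum of $e/(v-1)$ and is not attained, while the critical densities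
  of the classes of minors of single members are smaller than $\beta$ and converge to it. Hence $B_2 \subseteq B'$.
  The sum closure of the class of apex graphs over a class with critical density $\beta$ has critical density
  $1 + \beta$, so $1 + B \subseteq B_2$. The inclusion is strict because of $23/10$: it belongs to $B_2$ by gluing
  four copies of $K_4$ along the edges of a triangle (11 vertices, 23 edges), but $13/10 \notin B$, since a
  connected graph with $e \geq v + 3$ contracts to one, still with $e \geq v + 3$, in which every edge lies in a
  triangle, and such a graph has density at least $4/3$.

  It remains to see that $B$ does not accumulate in the open interval from $2 - 1/k$ to $2 - 1/(k+1)$. Call a
  connected graph rich if it has a minor with $e \geq (2 - 1/(k+1)) (v - 1)$, $v > 1$; a connected graph that is not
  rich has $e \leq (2 - 1/k) (v - 1)$. A class whose critical density lies strictly inside the interval cannot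
  contain many rich graphs glued in a tree-like way. Therefore a vertex-minimal graph of density above a given
  $c > 2 - 1/k$ has bounded degree, and cutting it into connected parts of bounded size, few of which are rich,
  bounds its order. So only finitely many densities occur.
\<close>

section \<open>Connected sets, quotients and minors\<close>

text \<open>The scale 2 - 1/k is the ratio (2 v - 3) / (v - 1) at v = k + 1: gluing graphs with 2 v
  - 3 edges at single vertices realises it in the limit, and v - 1, unlike v, is additive under such
  gluing. This is why richness is measured by e / (v - 1) and not by density. The obstacle inside
  the intervals is that a graph of density slightly above c might be arbitrarily large, glued from
  many pieces or branching at a vertex of high degree. Two amalgamations prevent this: m rich pieces
  yield a quotient with more than m vertices and e \<ge> (2 - 1/(k + 1)) (v - 1), whose density
  exceeds the critical density once m is large; and a connected set with n attachment vertices
  towards another connected set yields 2 n - 1 edges on n + 1 vertices, a density close to 2. Both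
  bounds depend on the interval only, not on c, so c can be chosen as the largest density of a graph
  of bounded order below a hypothetical value. Connectedness is stated by cuts instead of paths,
  since cuts are easily pulled back along contractions.\<close>

definition conn :: "'a set set \<Rightarrow> 'a set \<Rightarrow> bool" where
  "conn E S \<longleftrightarrow> S \<noteq> {} \<and>
     (\<forall>X. X \<noteq> {} \<and> X \<subset> S \<longrightarrow> (\<exists>x\<in>X. \<exists>y\<in>S - X. {x, y} \<in> E))"

definition ind :: "'a set set \<Rightarrow> 'a set \<Rightarrow> 'a set set" where
  "ind E S = {e \<in> E. e \<subseteq> S}"

text \<open>The edge set of the simple quotient along \<phi>: collapsed edges become singletons and
  are dropped, parallel ones coincide. Contraction of one edge is the case of
  \<open>collapse\<close>.\<close>

definition qedges :: "'a set set \<Rightarrow> ('a \<Rightarrow> 'b) \<Rightarrow> 'b set set" where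
  "qedges E \<phi> = {e \<in> (\<lambda>e. \<phi> ` e) ` E. card e = 2}"

definition collapse :: "'a \<Rightarrow> 'a \<Rightarrow> 'a \<Rightarrow> 'a" where
  "collapse u v x = (if x = v then u else x)"

lemma contract_edge_eq: "contract_edge G u v = (verts G - {v}, qedges (edges G) (collapse u v))"
  by (simp add: contract_edge_def qedges_def collapse_def[abs_def])

lemma conn_ex: "conn E S \<Longrightarrow> X \<noteq> {} \<Longrightarrow> X \<subset> S \<Longrightarrow> \<exists>x\<in>X. \<exists>y\<in>S - X. {x, y} \<in> E"
  by (simp add: conn_def)

lemma conn_nonempty: "conn E S \<Longrightarrow> S \<noteq> {}"
  by (simp add: conn_def)

lemma conn_sing [simp]: "conn E {x}"
  unfolding conn_def by auto

lemma conn_ind: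
  assumes "T \<subseteq> S" shows "conn (ind E S) T \<longleftrightarrow> conn E T"
proof -
  have "{x, y} \<in> ind E S \<longleftrightarrow> {x, y} \<in> E" if "x \<in> T" "y \<in> T" for x y
    using that assms by (auto simp: ind_def)
  then show ?thesis
    unfolding conn_def
    by (intro conj_cong refl all_cong1 imp_cong bex_cong) (auto simp: psubset_eq subset_iff)
qed

lemma ind_subset: "ind E S \<subseteq> E"
  by (auto simp: ind_def)

lemma ind_mono: "S \<subseteq> T \<Longrightarrow> ind E S \<subseteq> ind E T"
  by (auto simp: ind_def)

text \<open>A cut of the union either splits one of the two sets or separates them, and in the last
  case the edge xy crosses it. Allowing x = y treats overlapping and adjacent sets alike.\<close>

lemma conn_Un_edge:
  assumes S: "conn E S" and T: "conn E T" and xy: "x \<in> S" "y \<in> T" "x = y \<or> {x, y} \<in> E"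
  shows "conn E (S \<union> T)"
  unfolding conn_def
proof (intro conjI allI impI)
  show "S \<union> T \<noteq> {}" using S by (auto simp: conn_def)
  fix X assume X: "X \<noteq> {} \<and> X \<subset> S \<union> T"
  show "\<exists>x\<in>X. \<exists>y\<in>S \<union> T - X. {x, y} \<in> E"
  proof (cases "X \<inter> S \<noteq> {} \<and> X \<inter> S \<subset> S")
    case True
    then show ?thesis using conn_ex[OF S, of "X \<inter> S"] by blast
  next
    case nS: False
    show ?thesis
    proof (cases "X \<inter> T \<noteq> {} \<and> X \<inter> T \<subset> T")
      case True
      then show ?thesis using conn_ex[OF T, of "X \<inter> T"] by blast
    next
      case False
      with nS have *: "X \<inter> S = {} \<or> S \<subseteq> X" "X \<inter> T = {} \<or> T \<subseteq> X" by blast+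
      have ne: "\<not> (S \<subseteq> X \<and> T \<subseteq> X)" "\<not> (X \<inter> S = {} \<and> X \<inter> T = {})" using X by auto
      then consider "X \<inter> S = {}" "T \<subseteq> X" | "S \<subseteq> X" "X \<inter> T = {}" using * by auto
      then show ?thesis
      proof cases
        case 1
        then have "x \<notin> X" "y \<in> X" "x \<noteq> y" using xy by auto
        then have "y \<in> X" "x \<in> S \<union> T - X" "{y, x} \<in> E" using xy by (auto simp: insert_commute)
        then show ?thesis by blast
      next
        case 2
        then have "x \<in> X" "y \<notin> X" "x \<noteq> y" using xy by auto
        then have "x \<in> X" "y \<in> S \<union> T - X" "{x, y} \<in> E" using xy by auto
        then show ?thesis by blast
      qed
    qed
  qed
qed

lemma conn_insert_edge: "conn E S \<Longrightarrow> x \<in> S \<Longrightarrow> {x, y} \<in> E \<Longrightarrow> conn E (insert y S)"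
  using conn_Un_edge[of E S "{y}" x y] by simp

text \<open>The preimage of a cut is a cut of F; an edge crossing it has two distinct image ends,
  hence is not dropped.\<close>

lemma conn_image:
  assumes F: "conn E F"
  shows "conn (qedges E f) (f ` F)"
  unfolding conn_def
proof (intro conjI allI impI)
  show "f ` F \<noteq> {}" using F by (auto simp: conn_def)
  fix X assume X: "X \<noteq> {} \<and> X \<subset> f ` F"
  obtain x y where xy: "x \<in> F" "f x \<in> X" "y \<in> F" "f y \<notin> X" "{x, y} \<in> E"
  proof -
    have "{x \<in> F. f x \<in> X} \<noteq> {}" "{x \<in> F. f x \<in> X} \<subset> F" using X by auto
    from conn_ex[OF F this] that show ?thesis by blast
  qed
  then have "f x \<noteq> f y" by auto
  then have "card {f x, f y} = 2" by simp
  moreover have "{f x, f y} = f ` {x, y}" by auto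
  ultimately have "{f x, f y} \<in> qedges E f" unfolding qedges_def using xy(5) by blast
  then show "\<exists>x\<in>X. \<exists>y\<in>f ` F - X. {x, y} \<in> qedges E f" using xy by blast
qed

text \<open>S hangs on the rest of A at the vertex a only. Of the two sides of a cut of A - S, the
  one avoiding a sends no edge into S, so the edge that leaves it in A stays within A - S.\<close>

lemma conn_diff_closed:
  assumes A: "conn E A" and a: "a \<in> A" "a \<notin> S" and S: "S \<subseteq> A"
    and cl: "\<And>x y. x \<in> S \<Longrightarrow> y \<in> A - S - {a} \<Longrightarrow> {x, y} \<notin> E"
  shows "conn E (A - S)"
  unfolding conn_def
proof (intro conjI allI impI)
  show "A - S \<noteq> {}" using a by auto
  fix X assume X: "X \<noteq> {} \<and> X \<subset> A - S"
  define Y where "Y = (if a \<in> X then A - S - X else X)"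
  have Y: "Y \<noteq> {}" "Y \<subset> A" "a \<notin> Y" "Y \<subseteq> A - S" using X a by (auto simp: Y_def)
  obtain x y where xy: "x \<in> Y" "y \<in> A - Y" "{x, y} \<in> E" using conn_ex[OF A Y(1,2)] by blast
  have "y \<notin> S" using cl[of y x] xy Y by (auto simp: insert_commute)
  then have "y \<in> A - S - Y" using xy by auto
  then show "\<exists>x\<in>X. \<exists>y\<in>A - S - X. {x, y} \<in> E"
  proof (cases "a \<in> X")
    case True
    then have "y \<in> X" "x \<in> A - S - X" "{y, x} \<in> E" using xy X \<open>y \<in> A - S - Y\<close> by (auto simp: Y_def insert_commute)
    then show ?thesis by blast
  next
    case False
    then have "x \<in> X" "y \<in> A - S - X" using xy \<open>y \<in> A - S - Y\<close> by (auto simp: Y_def)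
    then show ?thesis using xy by blast
  qed
qed

text \<open>The branches at a outside S are removed: they, too, are attached only at a.\<close>

lemma conn_insert_closed:
  assumes A: "conn E A" and a: "a \<in> A" "a \<notin> S" and S: "S \<subseteq> A"
    and cl: "\<And>x y. x \<in> S \<Longrightarrow> y \<in> A - S - {a} \<Longrightarrow> {x, y} \<notin> E"
  shows "conn E (insert a S)"
proof -
  have "conn E (A - (A - S - {a}))"
  proof (rule conn_diff_closed[OF A a(1)])
    fix x y assume "x \<in> A - S - {a}" "y \<in> A - (A - S - {a}) - {a}"
    then show "{x, y} \<notin> E" using cl[of y x] by (auto simp: insert_commute)
  qed auto
  moreover have "A - (A - S - {a}) = insert a S" using a S by auto
  ultimately show ?thesis by simp
qed

text \<open>B is a maximal connected set through b that avoids a. By maximality only a can be a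
  neighbour of B outside B, so the rest stays connected.\<close>

lemma conn_split:
  assumes fin: "finite S" and S: "conn E S" and ab: "a \<in> S" "b \<in> S" "a \<noteq> b"
  obtains A B where "conn E A" "conn E B" "a \<in> A" "b \<in> B" "A \<inter> B = {}" "A \<union> B = S"
proof -
  define \<C> where "\<C> = {B. conn E B \<and> b \<in> B \<and> B \<subseteq> S - {a}}"
  have "finite \<C>" unfolding \<C>_def using fin by (auto intro: finite_subset[of _ "Pow S"])
  moreover have "{b} \<in> \<C>" using ab by (auto simp: \<C>_def)
  ultimately obtain B where B: "B \<in> \<C>" and mx: "\<And>C. C \<in> \<C> \<Longrightarrow> B \<subseteq> C \<Longrightarrow> C = B"
    using finite_has_maximal[of \<C>] by (metis empty_iff)
  have "conn E (S - B)"
  proof (rule conn_diff_closed[OF S ab(1)])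
    show "a \<notin> B" "B \<subseteq> S" using B by (auto simp: \<C>_def)
    fix x y assume xy: "x \<in> B" "y \<in> S - B - {a}"
    show "{x, y} \<notin> E"
    proof
      assume "{x, y} \<in> E"
      then have "insert y B \<in> \<C>" using conn_insert_edge[of E B x y] B xy by (auto simp: \<C>_def)
      from mx[OF this] xy show False by blast
    qed
  qed
  then show ?thesis using B ab that[of "S - B" B] by (auto simp: \<C>_def)
qed

lemma qedges_cong: "(\<And>x. x \<in> \<Union>E \<Longrightarrow> f x = g x) \<Longrightarrow> qedges E f = qedges E g"
  unfolding qedges_def by (intro Collect_cong conj_cong refl arg_cong2[of _ _ _ _ "(\<in>)"] image_cong) auto

text \<open>If the ends of an edge stay distinct under the composition, they are already distinct
  after f, so the intermediate quotient has not dropped the edge; this is where edges must have two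
  elements.\<close>

lemma qedges_qedges:
  assumes "\<And>e. e \<in> E \<Longrightarrow> card e = 2"
  shows "qedges (qedges E f) g = qedges E (g \<circ> f)"
proof -
  have "card (f ` e) = 2" if "e \<in> E" "card (g ` f ` e) = 2" for e
  proof -
    have "finite e" using assms[OF that(1)] card.infinite by fastforce
    then have "card (f ` e) \<le> 2" "card (g ` f ` e) \<le> card (f ` e)"
      using assms[OF that(1)] card_image_le[of e f] card_image_le[of "f ` e" g] by auto
    then show ?thesis using that by simp
  qed
  then show ?thesis
    unfolding qedges_def image_comp[symmetric]
    by (auto simp: image_image image_iff)
qed

lemma qedges_mono: "E \<subseteq> F \<Longrightarrow> qedges E f \<subseteq> qedges F f"
  by (auto simp: qedges_def)

lemma qedges_Un: "qedges (E \<union> F) f = qedges E f \<union> qedges F f"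
  by (auto simp: qedges_def)

lemma qedgesI: "{x, y} \<in> E \<Longrightarrow> f x \<noteq> f y \<Longrightarrow> {f x, f y} \<in> qedges E f"
  unfolding qedges_def by (auto intro!: image_eqI[of _ _ "{x, y}"])

lemma qedgesE:
  assumes "e \<in> qedges E f" "\<And>e. e \<in> E \<Longrightarrow> card e = 2"
  obtains x y where "{x, y} \<in> E" "e = {f x, f y}" "f x \<noteq> f y"
proof -
  obtain e' where e': "e' \<in> E" "e = f ` e'" "card e = 2" using assms(1) by (auto simp: qedges_def)
  obtain x y where "e' = {x, y}" using assms(2)[OF e'(1)] by (auto simp: card_2_iff)
  then show ?thesis using e' that[of x y] by (auto simp: card_insert_if split: if_splits)
qed

lemma card_qedges: "e \<in> qedges E f \<Longrightarrow> card e = 2"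
  by (simp add: qedges_def)

lemma finite_qedges: "finite E \<Longrightarrow> finite (qedges E f)"
  by (simp add: qedges_def)

lemma finite_ind: "finite S \<Longrightarrow> finite (ind E S)"
  by (rule finite_subset[of _ "Pow S"]) (auto simp: ind_def)

section \<open>Simple graphs, isomorphism and minor-closed classes\<close>

lemma simple_finite_edges: "simple_graph G \<Longrightarrow> finite (edges G)"
  by (rule finite_subset[of _ "Pow (verts G)"]) (auto simp: simple_graph_def)

lemma simple_card_edge: "simple_graph G \<Longrightarrow> e \<in> edges G \<Longrightarrow> card e = 2"
  by (auto simp: simple_graph_def)

lemma simple_edge_sub: "simple_graph G \<Longrightarrow> e \<in> edges G \<Longrightarrow> e \<subseteq> verts G"
  by (auto simp: simple_graph_def)

lemma simple_card_verts: "simple_graph G \<Longrightarrow> card (verts G) > 0"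
  by (auto simp: simple_graph_def card_gt_0_iff)

lemma qedges_sub: "(\<And>e. e \<in> E \<Longrightarrow> e \<subseteq> S) \<Longrightarrow> e \<in> qedges E f \<Longrightarrow> e \<subseteq> f ` S"
  unfolding qedges_def by blast

lemma simple_quotient:
  assumes "simple_graph G" shows "simple_graph (f ` verts G, qedges (edges G) f)"
  using assms qedges_sub[of "edges G" "verts G" _ f]
  by (auto simp: simple_graph_def card_qedges)

lemma collapse_verts: "u \<in> V \<Longrightarrow> u \<noteq> v \<Longrightarrow> collapse u v ` V = V - {v}"
  by (auto simp: collapse_def)

lemma contract_edge_eq':
  assumes "simple_graph G" "{u, v} \<in> edges G" "u \<noteq> v"
  shows "contract_edge G u v = (collapse u v ` verts G, qedges (edges G) (collapse u v))"
proof -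
  have "u \<in> verts G" using simple_edge_sub[OF assms(1,2)] by simp
  then show ?thesis using assms(3) by (simp add: contract_edge_eq collapse_verts)
qed

lemma minor_step_simple:
  assumes "minor_step G H" "simple_graph G"
  shows "simple_graph H"
  using assms
proof cases
  case (contract u v)
  then show ?thesis using simple_quotient[OF assms(2)] contract_edge_eq'[OF assms(2)] by simp
qed (auto simp: simple_graph_def delete_verts_def delete_edge_def)

lemma graph_iso_refl: "graph_iso G G"
  unfolding graph_iso_def by (rule exI[of _ id]) auto

lemma graph_iso_image:
  assumes "inj_on f (verts G)"
  shows "graph_iso G (f ` verts G, (\<lambda>e. f ` e) ` edges G)"
  unfolding graph_iso_def using assms by (auto simp: bij_betw_def)

lemma graph_isoE:
  assumes "graph_iso G H"
  obtains f where "inj_on f (verts G)" "H = (f ` verts G, (\<lambda>e. f ` e) ` edges G)"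
  using assms unfolding graph_iso_def bij_betw_def by (metis prod.collapse)

lemma graph_iso_simple:
  assumes "graph_iso G H" "simple_graph G" shows "simple_graph H"
proof -
  obtain f where f: "inj_on f (verts G)" "H = (f ` verts G, (\<lambda>e. f ` e) ` edges G)"
    using graph_isoE[OF assms(1)] by blast
  have "card (f ` e) = 2" if "e \<in> edges G" for e
    using that assms(2) f(1) by (metis card_image inj_on_subset simple_card_edge simple_edge_sub)
  then show ?thesis using f assms(2) by (auto simp: simple_graph_def)
qed

lemma inj_image_edges:
  assumes "simple_graph G" "inj_on f (verts G)"
  shows "inj_on (\<lambda>e. f ` e) (edges G)"
  by (rule inj_on_subset[OF inj_on_image_Pow[OF assms(2)]]) (use assms(1) in \<open>auto simp: simple_graph_def\<close>)

lemma graph_iso_cards: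
  assumes "graph_iso G H" "simple_graph G"
  shows "card (verts H) = card (verts G)" "card (edges H) = card (edges G)"
proof -
  obtain f where f: "inj_on f (verts G)" "H = (f ` verts G, (\<lambda>e. f ` e) ` edges G)"
    using graph_isoE[OF assms(1)] by blast
  show "card (verts H) = card (verts G)" using f by (simp add: card_image)
  show "card (edges H) = card (edges G)" using f inj_image_edges[OF assms(2) f(1)] by (simp add: card_image)
qed

lemma minor_closed_class: "minor_closed \<A> \<Longrightarrow> graph_class \<A>"
  by (simp add: minor_closed_def)

lemma class_simple: "graph_class \<A> \<Longrightarrow> G \<in> \<A> \<Longrightarrow> simple_graph G"
  by (simp add: graph_class_def)

lemma class_iso: "graph_class \<A> \<Longrightarrow> G \<in> \<A> \<Longrightarrow> graph_iso G H \<Longrightarrow> H \<in> \<A>"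
  unfolding graph_class_def by blast

lemma minor_closed_step: "minor_closed \<A> \<Longrightarrow> G \<in> \<A> \<Longrightarrow> minor_step G H \<Longrightarrow> H \<in> \<A>"
  unfolding minor_closed_def is_minor_def using graph_iso_refl by blast

lemma minor_closedI:
  assumes "graph_class \<A>" "\<And>G H. G \<in> \<A> \<Longrightarrow> minor_step G H \<Longrightarrow> H \<in> \<A>"
  shows "minor_closed \<A>"
  unfolding minor_closed_def is_minor_def
proof (intro conjI ballI allI impI assms(1))
  fix G H :: "nat graph" assume G: "G \<in> \<A>" and "\<exists>K. minor_step\<^sup>*\<^sup>* G K \<and> graph_iso K H"
  then obtain K where K: "minor_step\<^sup>*\<^sup>* G K" "graph_iso K H" by blast
  from K(1) G have "K \<in> \<A>" by (induction rule: rtranclp_induct) (use assms(2) in auto)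
  then show "H \<in> \<A>" using class_iso[OF assms(1) _ K(2)] by blast
qed

definition iso_step :: "nat graph \<Rightarrow> nat graph \<Rightarrow> bool" where
  "iso_step G H \<longleftrightarrow> minor_step G H \<or> graph_iso G H"

lemma minor_closed_iso_step:
  assumes "minor_closed \<A>" "iso_step\<^sup>*\<^sup>* G H" "G \<in> \<A>" shows "H \<in> \<A>"
  using assms(2,3)
proof (induction rule: rtranclp_induct)
  case (step y z)
  then consider "minor_step y z" | "graph_iso y z" by (auto simp: iso_step_def)
  then show ?case
    by cases (use step minor_closed_step[OF assms(1), of y z]
        class_iso[OF minor_closed_class[OF assms(1)], of y z] in simp_all)
qed

lemma steps_subgraph:
  assumes "finite (verts G)" "finite (edges G)" "S \<subseteq> verts G" "S \<noteq> {}" "F \<subseteq> ind (edges G) S"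
  shows "minor_step\<^sup>*\<^sup>* G (S, F)"
  using assms
proof (induction "card (verts G) + card (edges G)" arbitrary: G rule: less_induct)
  case less
  show ?case
  proof (cases "S = verts G")
    case True
    show ?thesis
    proof (cases "F = edges G")
      case True
      then show ?thesis using \<open>S = verts G\<close> by simp
    next
      case False
      then obtain e where e: "e \<in> edges G" "e \<notin> F" using less.prems ind_subset by blast
      let ?H = "delete_edge G e"
      have "minor_step\<^sup>*\<^sup>* ?H (S, F)"
      proof (rule less.hyps)
        have "card (edges G - {e}) < card (edges G)" using e less.prems by (intro card_Diff1_less)
        then show "card (verts ?H) + card (edges ?H) < card (verts G) + card (edges G)"
          by (simp add: delete_edge_def)
      qed (use less.prems e in \<open>auto simp: delete_edge_def ind_def\<close>)
      then show ?thesis using del_edge[OF e(1)] by (meson converse_rtranclp_into_rtranclp)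
    qed
  next
    case False
    then obtain v where v: "v \<in> verts G" "v \<notin> S" using less.prems by blast
    let ?H = "delete_verts G {v}"
    have "minor_step\<^sup>*\<^sup>* ?H (S, F)"
    proof (rule less.hyps)
      have "card (verts G - {v}) < card (verts G)" using v less.prems by (intro card_Diff1_less)
      moreover have "card {e \<in> edges G. e \<inter> {v} = {}} \<le> card (edges G)"
        using less.prems by (intro card_mono) auto
      ultimately show "card (verts ?H) + card (edges ?H) < card (verts G) + card (edges G)"
        by (simp add: delete_verts_def)
    qed (use less.prems v in \<open>auto simp: delete_verts_def ind_def\<close>)
    moreover have "verts G \<noteq> {v}" using v less.prems(3,4) by auto
    ultimately show ?thesis using del_vert[OF v(1)] by (meson converse_rtranclp_into_rtranclp)
  qed
qed

lemma subgraph_minor: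
  assumes "simple_graph G" "S \<subseteq> verts G" "S \<noteq> {}" "F \<subseteq> ind (edges G) S"
  shows "is_minor (S, F) G"
  unfolding is_minor_def
proof (intro exI conjI)
  show "minor_step\<^sup>*\<^sup>* G (S, F)"
    using assms simple_finite_edges[OF assms(1)] by (intro steps_subgraph) (auto simp: simple_graph_def)
qed (rule graph_iso_refl)

lemma minor_closed_subgraph:
  assumes "minor_closed \<A>" "G \<in> \<A>" "S \<subseteq> verts G" "S \<noteq> {}" "F \<subseteq> ind (edges G) S"
  shows "(S, F) \<in> \<A>"
  using subgraph_minor[OF class_simple[OF minor_closed_class[OF assms(1)] assms(2)] assms(3-5)] assms(1,2)
  unfolding minor_closed_def by blast

text \<open>Quotients with connected fibres are minors: while some fibre has two vertices,
  connectivity gives an edge av inside it, and \<phi> factors through its contraction.\<close>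

lemma minor_closed_quotient:
  assumes A: "minor_closed \<A>" and "G \<in> \<A>"
    and "\<And>x. x \<in> verts G \<Longrightarrow> conn (edges G) {y \<in> verts G. \<phi> y = \<phi> x}"
  shows "(\<phi> ` verts G, qedges (edges G) \<phi>) \<in> \<A>"
  using assms(2,3)
proof (induction "card (verts G)" arbitrary: G rule: less_induct)
  case less
  have sG: "simple_graph G" using A less.prems by (auto dest: minor_closed_class class_simple)
  show ?case
  proof (cases "inj_on \<phi> (verts G)")
    case True
    have "card (\<phi> ` e) = 2" if "e \<in> edges G" for e
      using that sG True by (metis card_image inj_on_subset simple_card_edge simple_edge_sub)
    then have "qedges (edges G) \<phi> = (\<lambda>e. \<phi> ` e) ` edges G" by (auto simp: qedges_def)
    then show ?thesis using graph_iso_image[OF True] class_iso[OF minor_closed_class[OF A] less.prems(1)] by simp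
  next
    case False
    then obtain a b where ab: "a \<in> verts G" "b \<in> verts G" "a \<noteq> b" "\<phi> a = \<phi> b" by (auto simp: inj_on_def)
    let ?F = "{y \<in> verts G. \<phi> y = \<phi> a}"
    obtain v where v: "v \<in> ?F" "v \<noteq> a" "{a, v} \<in> edges G"
    proof -
      have "{a} \<subset> ?F" using ab by auto
      then show ?thesis using conn_ex[OF less.prems(2)[OF ab(1)], of "{a}"] that by blast
    qed
    let ?m = "collapse a v"
    let ?H = "contract_edge G a v"
    have H: "?H = (?m ` verts G, qedges (edges G) ?m)" using contract_edge_eq'[OF sG v(3)] v by auto
    have phim: "\<phi> (?m x) = \<phi> x" for x using v by (auto simp: collapse_def)
    have "(\<phi> ` verts ?H, qedges (edges ?H) \<phi>) \<in> \<A>"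
    proof (rule less.hyps)
      show "card (verts ?H) < card (verts G)"
        using v sG card_Diff1_less[of "verts G" v] by (simp add: contract_edge_def simple_graph_def)
      show "?H \<in> \<A>" using minor_closed_step[OF A less.prems(1) contract[OF v(3)]] v by auto
      fix x assume "x \<in> verts ?H"
      then obtain x' where x': "x' \<in> verts G" "x = ?m x'" using H by auto
      have "conn (edges ?H) (?m ` {y \<in> verts G. \<phi> y = \<phi> x'})"
        unfolding H snd_conv by (rule conn_image) (rule less.prems(2)[OF x'(1)])
      moreover have "?m ` {y \<in> verts G. \<phi> y = \<phi> x'} = {y \<in> verts ?H. \<phi> y = \<phi> x}"
        unfolding H fst_conv x' using phim by auto
      ultimately show "conn (edges ?H) {y \<in> verts ?H. \<phi> y = \<phi> x}" by simp
    qed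
    moreover have "\<phi> ` verts ?H = \<phi> ` verts G" using H phim by (auto simp: image_image)
    moreover have "qedges (edges ?H) \<phi> = qedges (edges G) \<phi>"
      using H qedges_qedges[of "edges G" ?m \<phi>] sG phim by (simp add: simple_card_edge comp_def)
    ultimately show ?thesis by simp
  qed
qed

text \<open>Partitions of \<open>S\<close> into connected parts are encoded by maps sending each vertex to a representative
  of its part.\<close>

definition qmap :: "'a set set \<Rightarrow> 'a set \<Rightarrow> ('a \<Rightarrow> 'a) \<Rightarrow> bool" where
  "qmap E S \<phi> \<longleftrightarrow> (\<forall>x\<in>S. \<phi> x \<in> S \<and> \<phi> (\<phi> x) = \<phi> x \<and> conn E {y \<in> S. \<phi> y = \<phi> x})"

abbreviation qe :: "'a set set \<Rightarrow> 'a set \<Rightarrow> ('a \<Rightarrow> 'b) \<Rightarrow> 'b set set" where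
  "qe E S \<phi> \<equiv> qedges (ind E S) \<phi>"

lemma minor_closed_qmap:
  assumes A: "minor_closed \<A>" and G: "(V, E) \<in> \<A>" and S: "S \<subseteq> V" "S \<noteq> {}" and \<phi>: "qmap E S \<phi>"
  shows "(\<phi> ` S, qe E S \<phi>) \<in> \<A>"
proof -
  have "(S, ind E S) \<in> \<A>" using minor_closed_subgraph[OF A G] S by simp
  from minor_closed_quotient[OF A this, of \<phi>] show ?thesis
    using \<phi> by (auto simp: qmap_def conn_ind)
qed

text \<open>The vertices of T - S are absorbed one at a time into the part of a neighbour.
  Representatives stay in S, so the set of quotient vertices does not change.\<close>

lemma qmap_extend:
  assumes "finite T" "conn E T" "S \<subseteq> T" "S \<noteq> {}" "qmap E S \<phi>"
  obtains \<psi> where "qmap E T \<psi>" "\<And>x. x \<in> S \<Longrightarrow> \<psi> x = \<phi> x" "\<psi> ` T = \<phi> ` S"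
proof -
  have "\<exists>\<psi>. qmap E T \<psi> \<and> (\<forall>x\<in>S. \<psi> x = \<phi> x) \<and> \<psi> ` T = \<phi> ` S"
    using assms(3-5)
  proof (induction "card (T - S)" arbitrary: S \<phi> rule: less_induct)
    case less
    show ?case
    proof (cases "S = T")
      case True
      then show ?thesis using less.prems by blast
    next
      case False
      then obtain x y where xy: "x \<in> S" "y \<in> T - S" "{x, y} \<in> E"
        using conn_ex[OF assms(2), of S] less.prems by blast
      define \<phi>' where "\<phi>' = \<phi>(y := \<phi> x)"
      have eq: "\<phi>' z = \<phi> z" if "z \<in> S" for z using that xy by (auto simp: \<phi>'_def)
      have im: "\<phi>' ` insert y S = \<phi> ` S" using xy by (auto simp: \<phi>'_def)
      have "qmap E (insert y S) \<phi>'"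
        unfolding qmap_def
      proof
        fix z assume z: "z \<in> insert y S"
        define w where "w = (if z = y then x else z)"
        have w: "w \<in> S" "\<phi>' z = \<phi> w" using z xy eq by (auto simp: w_def \<phi>'_def)
        have W: "\<phi> w \<in> S" "\<phi> (\<phi> w) = \<phi> w" "conn E {y \<in> S. \<phi> y = \<phi> w}"
          using less.prems(3) w by (auto simp: qmap_def)
        have "conn E {u \<in> insert y S. \<phi>' u = \<phi>' z}"
        proof (cases "\<phi> w = \<phi> x")
          case True
          have "conn E (insert y {y \<in> S. \<phi> y = \<phi> w})"
            by (rule conn_insert_edge[OF W(3), of x]) (use xy True in auto)
          moreover have "insert y {y \<in> S. \<phi> y = \<phi> w} = {u \<in> insert y S. \<phi>' u = \<phi>' z}"
            using w True xy by (auto simp: \<phi>'_def)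
          ultimately show ?thesis by simp
        next
          case False
          then have "{y \<in> S. \<phi> y = \<phi> w} = {u \<in> insert y S. \<phi>' u = \<phi>' z}"
            using w xy by (auto simp: \<phi>'_def)
          then show ?thesis using W by simp
        qed
        then show "\<phi>' z \<in> insert y S \<and> \<phi>' (\<phi>' z) = \<phi>' z \<and> conn E {u \<in> insert y S. \<phi>' u = \<phi>' z}"
          using w W eq by simp
      qed
      moreover have "card (T - insert y S) < card (T - S)"
        using xy assms(1) by (intro psubset_card_mono) auto
      ultimately obtain \<psi> where "qmap E T \<psi>" "\<forall>x\<in>insert y S. \<psi> x = \<phi>' x" "\<psi> ` T = \<phi>' ` insert y S"
        using less.hyps[of "insert y S" \<phi>'] less.prems xy by auto
      then show ?thesis using eq im by (intro exI[of _ \<psi>]) auto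
    qed
  qed
  then show ?thesis using that by blast
qed

lemma qe_mono:
  assumes "S \<subseteq> T" "\<And>x. x \<in> S \<Longrightarrow> \<psi> x = \<phi> x"
  shows "qe E S \<phi> \<subseteq> qe E T \<psi>"
proof -
  have "qe E S \<phi> = qe E S \<psi>" by (rule qedges_cong) (use assms in \<open>auto simp: ind_def\<close>)
  then show ?thesis using qedges_mono[OF ind_mono[OF assms(1)]] by blast
qed

text \<open>The spanning tree bound. A maximal subset satisfying it must be S, since an edge leaving
  it brings in one more vertex and at least one more edge.\<close>

lemma conn_card_edges:
  assumes fin: "finite S" and S: "conn E S"
  shows "card S \<le> card (ind E S) + 1"
proof -
  define \<C> where "\<C> = {T. T \<subseteq> S \<and> T \<noteq> {} \<and> card T \<le> card (ind E T) + 1}"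
  have fC: "finite \<C>" unfolding \<C>_def using fin by (auto intro: finite_subset[of _ "Pow S"])
  obtain a where "a \<in> S" using conn_nonempty[OF S] by blast
  then have "{a} \<in> \<C>" by (auto simp: \<C>_def)
  with fC obtain T where T: "T \<in> \<C>" and mx: "\<And>C. C \<in> \<C> \<Longrightarrow> T \<subseteq> C \<Longrightarrow> C = T"
    using finite_has_maximal[of \<C>] by (metis empty_iff)
  have "T = S"
  proof (rule ccontr)
    assume "T \<noteq> S"
    then obtain x y where xy: "x \<in> T" "y \<in> S - T" "{x, y} \<in> E"
      using conn_ex[OF S, of T] T by (auto simp: \<C>_def)
    have fT: "finite T" using T fin by (auto simp: \<C>_def intro: finite_subset)
    have "insert {x, y} (ind E T) \<subseteq> ind E (insert y T)" using xy by (auto simp: ind_def)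
    then have "card (insert {x, y} (ind E T)) \<le> card (ind E (insert y T))"
      using fT by (intro card_mono finite_ind) auto
    moreover have "{x, y} \<notin> ind E T" using xy by (auto simp: ind_def)
    ultimately have "card (ind E T) + 1 \<le> card (ind E (insert y T))"
      using finite_ind[OF fT, of E] by simp
    then have "insert y T \<in> \<C>" using T xy fT by (auto simp: \<C>_def)
    from mx[OF this] xy show False by blast
  qed
  then show ?thesis using T by (auto simp: \<C>_def)
qed

lemma ind_verts: "simple_graph G \<Longrightarrow> ind (edges G) (verts G) = edges G"
  by (auto simp: ind_def simple_graph_def)

text \<open>When a cut of S is crossed by no edge, vertices and edges are split between its sides,
  so one side has ratio above c as well.\<close>

lemma conn_component_density:
  assumes fin: "finite S" "S \<noteq> {}" and d: "real (card (ind E S)) > c * real (card S)"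
    and E: "\<And>e. e \<in> E \<Longrightarrow> card e = 2"
  obtains T where "T \<subseteq> S" "conn E T" "real (card (ind E T)) > c * real (card T)"
proof -
  have "\<exists>T\<subseteq>S. conn E T \<and> real (card (ind E T)) > c * real (card T)"
    using fin d
  proof (induction "card S" arbitrary: S rule: less_induct)
    case less
    show ?case
    proof (cases "conn E S")
      case True
      then show ?thesis using less.prems by blast
    next
      case False
      then obtain X where X: "X \<noteq> {}" "X \<subset> S" "\<And>x y. x \<in> X \<Longrightarrow> y \<in> S - X \<Longrightarrow> {x, y} \<notin> E"
        using less.prems unfolding conn_def by blast
      have fX: "finite X" "finite (S - X)" using X less.prems by (auto intro: finite_subset)
      have "ind E S \<subseteq> ind E X \<union> ind E (S - X)"
      proof
        fix e assume e: "e \<in> ind E S"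
        then obtain x y where "e = {x, y}" using E[of e] by (auto simp: ind_def card_2_iff)
        then show "e \<in> ind E X \<union> ind E (S - X)"
          using e X(3)[of x y] X(3)[of y x] by (auto simp: ind_def insert_commute)
      qed
      then have "card (ind E S) \<le> card (ind E X) + card (ind E (S - X))"
        by (meson card_Un_le card_mono fX finite_UnI finite_ind le_trans)
      moreover have "card S = card X + card (S - X)"
        using X fX less.prems by (simp add: card_Diff_subset card_mono psubset_imp_subset)
      ultimately have "c * card X + c * card (S - X) < real (card (ind E X)) + real (card (ind E (S - X)))"
        using less.prems(3) by (simp add: algebra_simps)
      then consider "c * card X < real (card (ind E X))" | "c * card (S - X) < real (card (ind E (S - X)))"
        by linarith
      then show ?thesis
      proof cases
        case 1
        then show ?thesis using less.hyps[of X] X fX less.prems by (meson psubset_card_mono psubset_imp_subset subset_trans)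
      next
        case 2
        have "S - X \<noteq> {}" "card (S - X) < card S"
          using X fX less.prems by (auto intro!: psubset_card_mono)
        with 2 obtain T where "T \<subseteq> S - X" "conn E T" "real (card (ind E T)) > c * real (card T)"
          using less.hyps[of "S - X"] fX by blast
        then show ?thesis by blast
      qed
    qed
  qed
  then show ?thesis using that by blast
qed

section \<open>Bounded density\<close>

text \<open>Contracting uv loses uv itself and, for each common neighbour x, one of the edges ux and
  vx; all other edges keep distinct images.\<close>

lemma contract_edge_card:
  assumes G: "simple_graph (V, E)" and uv: "{u, v} \<in> E" "u \<noteq> v"
  shows "card E \<le> card (qedges E (collapse u v)) + 1 + card {x. {u, x} \<in> E \<and> {v, x} \<in> E}"
proof -
  let ?m = "collapse u v"
  let ?T = "{x. {u, x} \<in> E \<and> {v, x} \<in> E}"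
  let ?B = "insert {u, v} ((\<lambda>x. {v, x}) ` ?T)"
  have fE: "finite E" using simple_finite_edges[OF G] by simp
  have c2: "card e = 2" if "e \<in> E" for e using simple_card_edge[OF G] that by simp
  have fT: "finite ?T"
    by (rule finite_subset[of _ V]) (use G in \<open>auto simp: simple_graph_def\<close>)
  have img: "(v \<notin> e \<and> ?m ` e = e) \<or> (\<exists>x. x \<noteq> u \<and> x \<noteq> v \<and> e = {v, x} \<and> ?m ` e = {u, x})"
    if "e \<in> E - ?B" for e
  proof (cases "v \<in> e")
    case False
    then show ?thesis by (auto simp: collapse_def)
  next
    case True
    then obtain x where x: "e = {v, x}" "x \<noteq> v"
    proof -
      obtain p q where "e = {p, q}" "p \<noteq> q" using c2[of e] \<open>e \<in> E - ?B\<close> by (auto simp: card_2_iff)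
      then show ?thesis using True that[of p] that[of q] by (auto simp: insert_commute)
    qed
    then have "x \<noteq> u" using that by (auto simp: insert_commute)
    then show ?thesis using x by (auto simp: collapse_def)
  qed
  have "inj_on (\<lambda>e. ?m ` e) (E - ?B)"
  proof (rule inj_onI)
    fix e f assume ef: "e \<in> E - ?B" "f \<in> E - ?B" "?m ` e = ?m ` f"
    have *: False if "e \<in> E - ?B" "f \<in> E - ?B" "e = {v, x}" "f = {u, x}" for e f x
      using that by auto
    show "e = f"
    proof (cases "v \<in> e")
      case True
      then obtain x where x: "e = {v, x}" "?m ` e = {u, x}" using img[OF ef(1)] by blast
      show ?thesis
      proof (cases "v \<in> f")
        case True
        then obtain y where y: "f = {v, y}" "?m ` f = {u, y}" using img[OF ef(2)] by blast
        then have "x = y" using x ef(3) by (metis doubleton_eq_iff)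
        then show ?thesis using x y by simp
      next
        case False
        then have "f = {u, x}" using img[OF ef(2)] x ef(3) by auto
        then show ?thesis using *[OF ef(1,2) x(1)] by simp
      qed
    next
      case False
      then have e: "?m ` e = e" using img[OF ef(1)] by auto
      show ?thesis
      proof (cases "v \<in> f")
        case True
        then obtain y where y: "f = {v, y}" "?m ` f = {u, y}" using img[OF ef(2)] by blast
        then show ?thesis using *[OF ef(2,1) y(1)] e ef(3) by simp
      next
        case False
        then have "?m ` f = f" using img[OF ef(2)] by auto
        then show ?thesis using e ef(3) by simp
      qed
    qed
  qed
  moreover have "(\<lambda>e. ?m ` e) ` (E - ?B) \<subseteq> qedges E ?m"
  proof
    fix e assume "e \<in> (\<lambda>e. ?m ` e) ` (E - ?B)"
    then obtain f where f: "f \<in> E - ?B" "e = ?m ` f" by blast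
    have "card e = 2" using img[OF f(1)]
    proof
      assume "v \<notin> f \<and> ?m ` f = f"
      then show ?thesis using f c2[of f] by simp
    next
      assume "\<exists>x. x \<noteq> u \<and> x \<noteq> v \<and> f = {v, x} \<and> ?m ` f = {u, x}"
      then show ?thesis using f(2) by (metis card_2_iff)
    qed
    then show "e \<in> qedges E ?m" using f by (auto simp: qedges_def)
  qed
  ultimately have 1: "card (E - ?B) \<le> card (qedges E ?m)"
    by (rule card_inj_on_le[OF _ _ finite_qedges[OF fE]])
  have "card ?B \<le> Suc (card ((\<lambda>x. {v, x}) ` ?T))"
    by (rule card_insert_le_m1) auto
  then have "card ?B \<le> Suc (card ?T)" using card_image_le[OF fT, of "\<lambda>x. {v, x}"] by linarith
  moreover have "card E \<le> card (E - ?B) + card ?B"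
  proof -
    have "card E \<le> card ((E - ?B) \<union> ?B)" using fE fT by (intro card_mono) auto
    then show ?thesis using card_Un_le[of "E - ?B" ?B] by (rule le_trans)
  qed
  ultimately show ?thesis using 1 by linarith
qed

lemma sum_degrees:
  assumes "finite N" "finite F" "\<And>e. e \<in> F \<Longrightarrow> card e = 2 \<and> e \<subseteq> N"
  shows "(\<Sum>y\<in>N. card {e \<in> F. y \<in> e}) = 2 * card F"
proof -
  have "(\<Sum>y\<in>N. card {e \<in> F. y \<in> e}) = (\<Sum>e\<in>F. card {y \<in> N. y \<in> e})"
    using sum.swap_restrict[OF assms(1,2), of "\<lambda>_ _. 1::nat" "\<lambda>y e. y \<in> e"] by simp
  also have "\<dots> = (\<Sum>e\<in>F. 2)"
  proof (rule sum.cong)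
    fix e assume "e \<in> F"
    moreover from this have "{y \<in> N. y \<in> e} = e" using assms(3) by blast
    ultimately show "card {y \<in> N. y \<in> e} = 2" using assms(3) by simp
  qed simp
  finally show ?thesis by simp
qed

section \<open>Cones, links and a linear bound on the number of edges\<close>

definition cone_graph :: "'a \<Rightarrow> 'a graph \<Rightarrow> 'a graph" where
  "cone_graph a G = (insert a (verts G), edges G \<union> (\<lambda>v. {a, v}) ` verts G)"

lemma cone_simple: "simple_graph G \<Longrightarrow> a \<notin> verts G \<Longrightarrow> simple_graph (cone_graph a G)"
  by (auto simp: simple_graph_def cone_graph_def card_insert_if)

lemma cone_card_edges:
  assumes "simple_graph G" "a \<notin> verts G"
  shows "card (edges (cone_graph a G)) = card (edges G) + card (verts G)"
proof -
  have "inj_on (\<lambda>v. {a, v}) (verts G)" by (auto simp: inj_on_def doubleton_eq_iff)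
  moreover have "edges G \<inter> (\<lambda>v. {a, v}) ` verts G = {}"
    using assms by (auto simp: simple_graph_def)
  ultimately show ?thesis
    using assms simple_finite_edges[OF assms(1)]
    by (simp add: cone_graph_def card_Un_disjoint card_image simple_graph_def)
qed

lemma cone_iso:
  assumes "graph_iso G H" "simple_graph G" "a \<notin> verts G" "b \<notin> verts H"
  shows "graph_iso (cone_graph a G) (cone_graph b H)"
proof -
  obtain f where f: "inj_on f (verts G)" "H = (f ` verts G, (\<lambda>e. f ` e) ` edges G)"
    using graph_isoE[OF assms(1)] by blast
  define g where "g = f(a := b)"
  have gf: "g x = f x" if "x \<in> verts G" for x using that assms(3) by (auto simp: g_def)
  have ga: "g a = b" by (simp add: g_def)
  have gv: "g ` verts G = f ` verts G" using gf by auto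
  have ge: "g ` e = f ` e" if "e \<in> edges G" for e
    by (rule image_cong[OF refl gf]) (use simple_edge_sub[OF assms(2) that] in auto)
  have "inj_on g (verts G)" using f(1) gf by (simp add: inj_on_def)
  then have "inj_on g (insert a (verts G))" using gv ga assms(4) f(2) by auto
  moreover have "(\<lambda>e. g ` e) ` edges G = (\<lambda>e. f ` e) ` edges G" using ge by auto
  moreover have "(\<lambda>e. g ` e) ` (\<lambda>v. {a, v}) ` verts G = (\<lambda>v. {b, v}) ` f ` verts G"
    using gf ga by (auto simp: image_image)
  ultimately show ?thesis
    using graph_iso_image[of g "cone_graph a G"] gv ga f(2) by (simp add: cone_graph_def image_Un)
qed

lemma graph_iso_sym:
  assumes "graph_iso G H" "simple_graph G" shows "graph_iso H G"
proof -
  obtain f where f: "inj_on f (verts G)" "H = (f ` verts G, (\<lambda>e. f ` e) ` edges G)"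
    using graph_isoE[OF assms(1)] by blast
  let ?g = "inv_into (verts G) f"
  have "?g ` f ` e = e" if "e \<in> edges G" for e
    using simple_edge_sub[OF assms(2) that] f(1) by (auto simp: image_image image_iff subset_iff inv_into_f_f)
  then have "(\<lambda>e. ?g ` e) ` edges H = edges G" using f by (simp add: image_image)
  moreover have "?g ` verts H = verts G" using f by (auto simp: image_image)
  ultimately show ?thesis
    using graph_iso_image[of ?g H] f by (metis fst_conv inj_on_inv_into prod.collapse subset_refl)
qed

text \<open>A step on G can be performed in the cone, where the apex stays adjacent to all remaining
  vertices; this makes link classes minor-closed.\<close>

lemma cone_step:
  assumes "minor_step G H" "simple_graph G" "a \<notin> verts G"
  shows "minor_step (cone_graph a G) (cone_graph a H) \<and> a \<notin> verts H"
  using assms(1)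
proof cases
  case (del_vert v)
  have "delete_verts (cone_graph a G) {v} = cone_graph a H"
    using del_vert assms(3) by (auto simp: delete_verts_def cone_graph_def)
  moreover have "v \<in> verts (cone_graph a G)" "verts (cone_graph a G) \<noteq> {v}"
    using del_vert assms(3) by (auto simp: cone_graph_def)
  ultimately show ?thesis
    using minor_step.del_vert[of v "cone_graph a G"] del_vert assms(3) by (simp add: delete_verts_def)
next
  case (del_edge e)
  have "e \<notin> (\<lambda>v. {a, v}) ` verts G"
    using simple_edge_sub[OF assms(2) del_edge(2)] assms(3) by auto
  then have "delete_edge (cone_graph a G) e = cone_graph a H"
    using del_edge by (auto simp: delete_edge_def cone_graph_def)
  moreover have "e \<in> edges (cone_graph a G)" using del_edge by (simp add: cone_graph_def)
  ultimately show ?thesis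
    using minor_step.del_edge[of e "cone_graph a G"] del_edge assms(3) by (simp add: delete_edge_def)
next
  case (contract u v)
  have uv: "u \<in> verts G" "v \<in> verts G" using simple_edge_sub[OF assms(2) contract(2)] by auto
  let ?m = "collapse u v"
  have m: "?m a = a" using uv assms(3) by (auto simp: collapse_def)
  have "qedges ((\<lambda>x. {a, x}) ` verts G) ?m = (\<lambda>x. {a, x}) ` ?m ` verts G"
  proof -
    have "card {a, ?m x} = 2" if "x \<in> verts G" for x
      using that assms(3) uv by (auto simp: collapse_def card_insert_if)
    then show ?thesis using m by (auto simp: qedges_def image_image)
  qed
  moreover have "?m ` verts G = verts G - {v}" using collapse_verts uv contract by metis
  moreover have "contract_edge (cone_graph a G) u v = (insert a (verts G) - {v}, qedges (edges (cone_graph a G)) ?m)"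
    by (simp add: contract_edge_eq cone_graph_def)
  moreover have "insert a (verts G) - {v} = insert a (verts G - {v})" using uv assms(3) by auto
  ultimately have "contract_edge (cone_graph a G) u v = cone_graph a H"
    using contract by (simp add: contract_edge_eq cone_graph_def qedges_Un)
  moreover have "{u, v} \<in> edges (cone_graph a G)" using contract by (simp add: cone_graph_def)
  ultimately show ?thesis
    using minor_step.contract[of u v "cone_graph a G"] contract assms(3) by (simp add: contract_edge_def)
qed

text \<open>If a class omits the complete graph on n + 1 vertices, its link class omits the one on n
  vertices. The induction for the linear edge bound descends along this.\<close>

definition link_class :: "nat graph set \<Rightarrow> nat graph set" where
  "link_class \<A> = {G. simple_graph G \<and> (\<exists>a. a \<notin> verts G \<and> cone_graph a G \<in> \<A>)}"

lemma link_class_minor_closed: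
  assumes "minor_closed \<A>" shows "minor_closed (link_class \<A>)"
proof (rule minor_closedI)
  show "graph_class (link_class \<A>)"
    unfolding graph_class_def
  proof (intro conjI ballI allI impI)
    fix G H :: "nat graph" assume G: "G \<in> link_class \<A>" and iso: "graph_iso G H"
    then obtain a where a: "a \<notin> verts G" "cone_graph a G \<in> \<A>" and sG: "simple_graph G"
      by (auto simp: link_class_def)
    have sH: "simple_graph H" using graph_iso_simple[OF iso sG] .
    then obtain b where b: "b \<notin> verts H" using ex_new_if_finite[of "verts H"] by (auto simp: simple_graph_def)
    have "cone_graph b H \<in> \<A>"
      using class_iso[OF minor_closed_class[OF assms] a(2) cone_iso[OF iso sG a(1) b]] .
    then show "H \<in> link_class \<A>" using b sH by (auto simp: link_class_def)
  qed (simp add: link_class_def)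
next
  fix G H assume G: "G \<in> link_class \<A>" and st: "minor_step G H"
  then obtain a where a: "a \<notin> verts G" "cone_graph a G \<in> \<A>" and sG: "simple_graph G"
    by (auto simp: link_class_def)
  show "H \<in> link_class \<A>"
    using cone_step[OF st sG a(1)] minor_closed_step[OF assms a(2), of "cone_graph a H"]
      minor_step_simple[OF st sG] unfolding link_class_def by blast
qed

definition complete_graph :: "nat \<Rightarrow> nat graph" where
  "complete_graph n = ({..<n}, {e. e \<subseteq> {..<n} \<and> card e = 2})"

lemma complete_simple: "n > 0 \<Longrightarrow> simple_graph (complete_graph n)"
  by (auto simp: simple_graph_def complete_graph_def)

lemma cone_complete: "cone_graph n (complete_graph n) = complete_graph (Suc n)"
proof -
  have "e \<in> (\<lambda>v. {n, v}) ` {..<n}" if e: "e \<subseteq> {..<Suc n}" "card e = 2" "\<not> e \<subseteq> {..<n}" for e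
  proof -
    have "n \<in> e" using e by (auto simp: subset_iff less_Suc_eq)
    then obtain x where "e = {n, x}" "x \<noteq> n" using e(2) by (auto simp: card_2_iff)
    then show ?thesis using e by auto
  qed
  then show ?thesis by (auto simp: cone_graph_def complete_graph_def lessThan_Suc card_insert_if)
qed

text \<open>Mader's theorem with a crude constant: in a vertex-minimal dense graph every edge lies in
  many triangles, so the neighbourhood of a vertex is dense, while it omits a smaller clique.\<close>

lemma minor_closed_omitting_complete_sparse:
  assumes "minor_closed \<A>" "complete_graph (Suc n) \<notin> \<A>"
  shows "\<exists>c\<ge>0. \<forall>G\<in>\<A>. real (card (edges G)) \<le> c * real (card (verts G))"
  using assms
proof (induction n arbitrary: \<A>)
  case 0
  have "\<A> = {}"
  proof (rule ccontr)
    assume "\<A> \<noteq> {}"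
    then obtain G where G: "G \<in> \<A>" by blast
    then have sG: "simple_graph G" using 0 minor_closed_class class_simple by blast
    then obtain v where v: "v \<in> verts G" by (auto simp: simple_graph_def)
    have "({v}, {}) \<in> \<A>" using minor_closed_subgraph[OF 0(1) G, of "{v}" "{}"] v by auto
    moreover have "graph_iso ({v}, {}) (complete_graph (Suc 0))"
    proof -
      have "complete_graph (Suc 0) = ({0}, {})"
        by (auto simp: complete_graph_def lessThan_Suc subset_singleton_iff)
      then show ?thesis
        using graph_iso_image[of "\<lambda>_. 0::nat" "({v}, {})"] by simp
    qed
    ultimately show False using 0 class_iso[OF minor_closed_class[OF 0(1)]] by blast
  qed
  then show ?case by (intro exI[of _ 0]) auto
next
  case (Suc n)
  have "complete_graph (Suc n) \<notin> link_class \<A>"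
  proof
    assume "complete_graph (Suc n) \<in> link_class \<A>"
    then obtain a where a: "a \<notin> verts (complete_graph (Suc n))" "cone_graph a (complete_graph (Suc n)) \<in> \<A>"
      by (auto simp: link_class_def)
    have "graph_iso (cone_graph a (complete_graph (Suc n))) (cone_graph (Suc n) (complete_graph (Suc n)))"
      by (rule cone_iso[OF graph_iso_refl complete_simple a(1)]) (auto simp: complete_graph_def)
    then show False
      using class_iso[OF minor_closed_class[OF Suc.prems(1)] a(2)] Suc.prems(2) by (simp add: cone_complete)
  qed
  then obtain c0 where c0: "c0 \<ge> 0"
    "\<And>G. G \<in> link_class \<A> \<Longrightarrow> real (card (edges G)) \<le> c0 * real (card (verts G))"
    using Suc.IH[OF link_class_minor_closed[OF Suc.prems(1)]] by blast
  \<comment> \<open>Contracting an edge with t common neighbours loses t + 1 edges and lowers the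
    allowance by c, so t exceeds c - 1 = 2 c0. The neighbourhood of a vertex then has minimum degree
    above 2 c0, hence more than c0 edges per vertex, which the link class forbids.\<close>
  define c where "c = 2 * c0 + 1"
  have "real (card (edges G)) \<le> c * real (card (verts G))" if "G \<in> \<A>" for G
    using that
  proof (induction "card (verts G)" arbitrary: G rule: less_induct)
    case less
    obtain V E where GVE: "G = (V, E)" by (cases G)
    have sG: "simple_graph (V, E)"
      using less.prems GVE class_simple[OF minor_closed_class[OF Suc.prems(1)]] by blast
    have finV: "finite V" using sG by (simp add: simple_graph_def)
    show ?case
    proof (rule ccontr)
      assume "\<not> real (card (edges G)) \<le> c * real (card (verts G))"
      then have dense: "real (card E) > c * card V" by (simp add: GVE)
      have tri: "real (card {x. {u, x} \<in> E \<and> {v, x} \<in> E}) > 2 * c0" if uv: "{u, v} \<in> E" "u \<noteq> v" for u v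
      proof -
        have v: "v \<in> V" using sG uv by (auto simp: simple_graph_def)
        have H: "contract_edge G u v = (V - {v}, qedges E (collapse u v))" by (simp add: contract_edge_eq GVE)
        have "contract_edge G u v \<in> \<A>"
          using minor_closed_step[OF Suc.prems(1) less.prems contract[of u v G]] uv GVE by simp
        then have "real (card (qedges E (collapse u v))) \<le> c * card (V - {v})"
          using less.hyps[of "contract_edge G u v"] v finV card_Diff1_less[of V v]
          by (simp add: H) (simp add: GVE)
        moreover have "real (card (V - {v})) = real (card V) - 1"
          using v finV card_gt_0_iff[of V] by (auto simp: of_nat_diff)
        ultimately have "real (card (qedges E (collapse u v))) \<le> c * card V - c"
          by (simp add: right_diff_distrib)
        then show ?thesis using contract_edge_card[OF sG uv] dense by (simp add: c_def)
      qed
      have "c * card V \<ge> 0" using c0(1) by (simp add: c_def)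
      then have "E \<noteq> {}" using dense by auto
      then obtain a b where ab: "{a, b} \<in> E" "a \<noteq> b"
        using simple_card_edge[OF sG] by (auto simp: card_2_iff) (metis card_2_iff ex_in_conv)
      define N where "N = {y. {a, y} \<in> E}"
      have NV: "N \<subseteq> V" "a \<in> V" "a \<notin> N" using sG ab by (auto simp: N_def simple_graph_def)
      have fN: "finite N" "N \<noteq> {}" using NV finV ab by (auto simp: N_def intro: finite_subset)
      have sN: "simple_graph (N, ind E N)" using sG fN by (auto simp: simple_graph_def ind_def)
      have "cone_graph a (N, ind E N) \<in> \<A>"
        unfolding cone_graph_def using NV
        by (intro minor_closed_subgraph[OF Suc.prems(1) less.prems]) (auto simp: GVE ind_def N_def)
      then have le: "real (card (ind E N)) \<le> c0 * card N"
        using c0(2)[of "(N, ind E N)"] sN NV by (auto simp: link_class_def)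
      have "2 * c0 * card N < real (\<Sum>y\<in>N. card {e \<in> ind E N. y \<in> e})"
      proof -
        have "2 * c0 < real (card {e \<in> ind E N. y \<in> e})" if y: "y \<in> N" for y
        proof -
          have "inj_on (\<lambda>z. {y, z}) {x. {a, x} \<in> E \<and> {y, x} \<in> E}"
            by (auto simp: inj_on_def doubleton_eq_iff)
          moreover have "(\<lambda>z. {y, z}) ` {x. {a, x} \<in> E \<and> {y, x} \<in> E} \<subseteq> {e \<in> ind E N. y \<in> e}"
            using y by (auto simp: ind_def N_def)
          ultimately have "card {x. {a, x} \<in> E \<and> {y, x} \<in> E} \<le> card {e \<in> ind E N. y \<in> e}"
            using finite_ind[OF fN(1)] by (intro card_inj_on_le) auto
          moreover have "a \<noteq> y" using NV y by auto
          ultimately show ?thesis using tri[of a y] y by (simp add: N_def)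
        qed
        then have "(\<Sum>y\<in>N. 2 * c0) < (\<Sum>y\<in>N. real (card {e \<in> ind E N. y \<in> e}))"
          using fN by (intro sum_strict_mono) auto
        then show ?thesis by (simp add: mult.commute)
      qed
      also have "\<dots> = 2 * real (card (ind E N))"
        using sum_degrees[OF fN(1) finite_ind[OF fN(1)], of E] sG by (simp add: ind_def simple_graph_def)
      finally show False using le by simp
    qed
  qed
  moreover have "c \<ge> 0" using c0 by (simp add: c_def)
  ultimately show ?case by blast
qed

text \<open>A graph outside the class is, after relabelling, a subgraph of the complete graph of its
  order; so that complete graph is omitted as well.\<close>

lemma proper_minor_closed_sparse:
  assumes "minor_closed \<A>" "proper_class \<A>"
  shows "\<exists>c\<ge>0. \<forall>G\<in>\<A>. real (card (edges G)) \<le> c * real (card (verts G))"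
proof -
  have gc: "graph_class \<A>" by (rule minor_closed_class[OF assms(1)])
  obtain G where G: "simple_graph G" "G \<notin> \<A>"
    using assms(2) class_simple[OF gc] by (auto simp: proper_class_def)
  obtain f where f: "bij_betw f (verts G) {..<card (verts G)}"
    using ex_bij_betw_finite_nat[of "verts G"] G by (auto simp: simple_graph_def atLeast0LessThan)
  let ?H = "(f ` verts G, (\<lambda>e. f ` e) ` edges G)"
  have inj: "inj_on f (verts G)" using f by (simp add: bij_betw_def)
  have iso: "graph_iso G ?H" by (rule graph_iso_image[OF inj])
  have sH: "simple_graph ?H" using graph_iso_simple[OF iso G(1)] .
  have H: "?H \<notin> \<A>"
    using class_iso[OF gc _ graph_iso_sym[OF iso G(1)]] G by blast
  have "complete_graph (card (verts G)) \<notin> \<A>"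
  proof
    assume "complete_graph (card (verts G)) \<in> \<A>"
    then have "?H \<in> \<A>"
      using f sH by (intro minor_closed_subgraph[OF assms(1)])
        (auto simp: complete_graph_def bij_betw_def ind_def simple_graph_def)
    then show False using H by blast
  qed
  moreover obtain n where "card (verts G) = Suc n"
    using simple_card_verts[OF G(1)] gr0_conv_Suc by blast
  ultimately show ?thesis using minor_closed_omitting_complete_sparse[OF assms(1)] by metis
qed

section \<open>Critical densities as suprema\<close>

lemma density_le_iff:
  assumes "simple_graph G"
  shows "density G \<le> c \<longleftrightarrow> real (card (edges G)) \<le> c * real (card (verts G))"
  using simple_card_verts[OF assms] by (simp add: density_def divide_le_eq)

lemma density_nonneg: "density G \<ge> 0"
  by (simp add: density_def)

lemma bdd_above_density:
  assumes "minor_closed \<A>" "proper_class \<A>" shows "bdd_above (density ` \<A>)"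
proof -
  obtain c where c: "\<forall>G\<in>\<A>. real (card (edges G)) \<le> c * real (card (verts G))"
    using proper_minor_closed_sparse[OF assms] by blast
  have "density G \<le> c" if "G \<in> \<A>" for G
    using c that class_simple[OF minor_closed_class[OF assms(1)] that] by (simp add: density_le_iff)
  then show ?thesis by (intro bdd_aboveI2)
qed

lemma critical_density_upper:
  assumes "minor_closed \<A>" "proper_class \<A>" "G \<in> \<A>"
  shows "density G \<le> critical_density \<A>"
  unfolding critical_density_def by (rule cSUP_upper[OF assms(3) bdd_above_density[OF assms(1,2)]])

lemma critical_density_edges:
  assumes "minor_closed \<A>" "proper_class \<A>" "G \<in> \<A>"
  shows "real (card (edges G)) \<le> critical_density \<A> * real (card (verts G))"
  using critical_density_upper[OF assms] density_le_iff class_simple[OF minor_closed_class[OF assms(1)] assms(3)]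
  by blast

lemma critical_density_less:
  assumes "minor_closed \<A>" "proper_class \<A>" "x < critical_density \<A>"
  obtains G where "G \<in> \<A>" "x < density G"
  using less_cSUP_iff[OF _ bdd_above_density[OF assms(1,2)], of x] assms
  unfolding critical_density_def proper_class_def by blast

lemma critical_density_le:
  assumes "proper_class \<A>" "\<And>G. G \<in> \<A> \<Longrightarrow> density G \<le> c"
  shows "critical_density \<A> \<le> c"
  unfolding critical_density_def
  by (rule cSUP_least) (use assms in \<open>auto simp: proper_class_def\<close>)

text \<open>Numerator and denominator are bounded; 2^n is a crude bound on the number of
  edges.\<close>

lemma finite_densities:
  "finite (density ` {G :: nat graph. simple_graph G \<and> card (verts G) \<le> n})"
proof (rule finite_subset)
  show "finite ((\<lambda>(e, v). real e / real v) ` ({..2 ^ n} \<times> {..n}))" by simp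
  show "density ` {G :: nat graph. simple_graph G \<and> card (verts G) \<le> n}
      \<subseteq> (\<lambda>(e, v). real e / real v) ` ({..2 ^ n} \<times> {..n})"
  proof clarify
    fix V :: "nat set" and E assume G: "simple_graph (V, E)" "card (verts (V, E)) \<le> n"
    have "finite (Pow V)" "E \<subseteq> Pow V" using G by (auto simp: simple_graph_def)
    then have "card E \<le> 2 ^ card V" using card_mono[of "Pow V" E] G by (simp add: card_Pow)
    also have "\<dots> \<le> 2 ^ n" using G by (simp add: power_increasing)
    finally show "density (V, E) \<in> (\<lambda>(e, v). real e / real v) ` ({..2 ^ n} \<times> {..n})"
      using G by (auto simp: density_def intro!: image_eqI[of _ _ "(card E, card V)"])
  qed
qed

lemma minor_step_smaller:
  assumes "minor_step G H" "simple_graph G"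
  shows "card (verts H) + card (edges H) < card (verts G) + card (edges G)"
    and "card (verts H) \<le> card (verts G)"
proof -
  have fV: "finite (verts G)" and fE: "finite (edges G)"
    using assms(2) simple_finite_edges[OF assms(2)] by (simp_all add: simple_graph_def)
  have "card (verts H) + card (edges H) < card (verts G) + card (edges G) \<and> card (verts H) \<le> card (verts G)"
    using assms(1)
  proof cases
    case (del_vert v)
    have "card (verts G - {v}) < card (verts G)" using del_vert fV by (intro card_Diff1_less)
    moreover have "card {e \<in> edges G. e \<inter> {v} = {}} \<le> card (edges G)" using fE by (intro card_mono) auto
    ultimately show ?thesis using del_vert by (simp add: delete_verts_def)
  next
    case (del_edge e)
    have "card (edges G - {e}) < card (edges G)" using del_edge fE by (intro card_Diff1_less)
    then show ?thesis using del_edge by (simp add: delete_edge_def)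
  next
    case (contract u v)
    have "v \<in> verts G" using simple_edge_sub[OF assms(2) contract(2)] by simp
    then have "card (verts G - {v}) < card (verts G)" using fV by (intro card_Diff1_less)
    moreover have "card (qedges (edges G) (collapse u v)) \<le> card ((\<lambda>e. collapse u v ` e) ` edges G)"
      unfolding qedges_def using fE by (intro card_mono) auto
    moreover have "\<dots> \<le> card (edges G)" by (rule card_image_le[OF fE])
    ultimately show ?thesis using contract by (simp add: contract_edge_eq)
  qed
  then show "card (verts H) + card (edges H) < card (verts G) + card (edges G)"
    and "card (verts H) \<le> card (verts G)" by auto
qed

lemma iso_steps_simple:
  assumes "iso_step\<^sup>*\<^sup>* G H" "simple_graph G"
  shows "simple_graph H \<and> card (verts H) \<le> card (verts G)"
  using assms
proof (induction rule: rtranclp_induct)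
  case (step y z)
  then consider "minor_step y z" | "graph_iso y z" by (auto simp: iso_step_def)
  then show ?case
  proof cases
    case 1
    then show ?thesis using step minor_step_simple minor_step_smaller(2) by (meson le_trans)
  next
    case 2
    then show ?thesis using step graph_iso_simple graph_iso_cards(1) by metis
  qed
qed simp

text \<open>Minors have at most as many vertices as G, so only finitely many densities occur and the
  supremum is attained; a larger complete graph shows properness. Classes of this kind supply the
  critical densities that approximate a given one.\<close>

lemma minors_class:
  assumes "simple_graph G"
  defines "\<A> \<equiv> {H. iso_step\<^sup>*\<^sup>* G H}"
  shows "minor_closed \<A>" "proper_class \<A>" "\<exists>H\<in>\<A>. critical_density \<A> = density H"
proof -
  have simple: "simple_graph H" "card (verts H) \<le> card (verts G)" if "H \<in> \<A>" for H
    using iso_steps_simple[of G H] assms(1) that by (auto simp: \<A>_def)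
  have gc: "graph_class \<A>"
    unfolding graph_class_def using simple
    by (auto simp: \<A>_def) (meson iso_step_def rtranclp.rtrancl_into_rtrancl)
  show mc: "minor_closed \<A>"
    by (rule minor_closedI[OF gc]) (auto simp: \<A>_def iso_step_def intro: rtranclp.rtrancl_into_rtrancl)
  have GA: "G \<in> \<A>" by (simp add: \<A>_def)
  have "complete_graph (Suc (card (verts G))) \<notin> \<A>"
    using simple(2)[of "complete_graph (Suc (card (verts G)))"] by (auto simp: complete_graph_def)
  then show pc: "proper_class \<A>"
    using GA gc complete_simple[of "Suc (card (verts G))"] by (auto simp: proper_class_def)
  have "finite (density ` \<A>)"
    by (rule finite_subset[OF _ finite_densities[of "card (verts G)"]]) (use simple in auto)
  then have "Sup (density ` \<A>) \<in> density ` \<A>"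
    using GA cSup_eq_Max[of "density ` \<A>"] Max_in[of "density ` \<A>"]
    by (metis empty_iff image_is_empty)
  then show "\<exists>H\<in>\<A>. critical_density \<A> = density H"
    by (auto simp: critical_density_def)
qed

section \<open>Classes with 2-connected excluded minors\<close>

text \<open>Translates between paths and cuts: the set of vertices reached from u by paths is left
  by no edge, and a path out of a set crosses its boundary.\<close>

lemma connected_graph_conn:
  assumes "\<And>e. e \<in> edges G \<Longrightarrow> e \<subseteq> verts G"
  shows "connected_graph G \<longleftrightarrow> conn (edges G) (verts G)"
proof
  assume G: "connected_graph G"
  show "conn (edges G) (verts G)"
    unfolding conn_def
  proof (intro conjI allI impI)
    show "verts G \<noteq> {}" using G by (simp add: connected_graph_def)
    fix X assume X: "X \<noteq> {} \<and> X \<subset> verts G"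
    then obtain x y where xy: "x \<in> X" "y \<in> verts G - X" by blast
    then have "(adjacent G)\<^sup>*\<^sup>* x y" using G X by (auto simp: connected_graph_def)
    then have "y \<in> X \<or> (\<exists>a\<in>X. \<exists>b\<in>verts G - X. {a, b} \<in> edges G)"
    proof (induction rule: rtranclp_induct)
      case (step y z)
      then show ?case using assms[of "{y, z}"] by (auto simp: adjacent_def)
    qed (use xy in simp)
    then show "\<exists>a\<in>X. \<exists>b\<in>verts G - X. {a, b} \<in> edges G" using xy by blast
  qed
next
  assume G: "conn (edges G) (verts G)"
  show "connected_graph G"
    unfolding connected_graph_def
  proof (intro conjI ballI)
    show "verts G \<noteq> {}" using conn_nonempty[OF G] .
    fix u v assume uv: "u \<in> verts G" "v \<in> verts G"
    let ?X = "{w \<in> verts G. (adjacent G)\<^sup>*\<^sup>* u w}"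
    have "?X = verts G"
    proof (rule ccontr)
      assume "?X \<noteq> verts G"
      then have "?X \<noteq> {}" "?X \<subset> verts G" using uv by auto
      from conn_ex[OF G this] obtain x y where xy: "(adjacent G)\<^sup>*\<^sup>* u x" "y \<in> verts G - ?X" "{x, y} \<in> edges G"
        by blast
      have "(adjacent G)\<^sup>*\<^sup>* u y"
        by (rule rtranclp.rtrancl_into_rtrancl[OF xy(1)]) (use xy(3) in \<open>simp add: adjacent_def\<close>)
      then show False using xy(2) by simp
    qed
    then show "(adjacent G)\<^sup>*\<^sup>* u v" using uv by blast
  qed
qed

lemma edgeless_singleton:
  assumes "simple_graph G" "verts G \<subseteq> {x}" shows "edges G = {}"
proof (rule ccontr)
  assume "edges G \<noteq> {}"
  then obtain e where "e \<subseteq> {x}" "card e = 2"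
    using simple_edge_sub[OF assms(1)] simple_card_edge[OF assms(1)] assms(2) by blast
  then show False using card_mono[of "{x}" e] by simp
qed

section \<open>Unions of graphs meeting in at most one vertex\<close>

definition graph_union :: "'a graph \<Rightarrow> 'a graph \<Rightarrow> 'a graph" where
  "graph_union G H = (verts G \<union> verts H, edges G \<union> edges H)"

lemma graph_union_commute: "graph_union G H = graph_union H G"
  by (simp add: graph_union_def Un_commute)

lemma graph_union_simple: "simple_graph G \<Longrightarrow> simple_graph H \<Longrightarrow> simple_graph (graph_union G H)"
  by (auto simp: simple_graph_def graph_union_def)

text \<open>Meeting in at most one vertex covers disjoint unions and 1-sums together.\<close>

definition sum_closed :: "'a graph set \<Rightarrow> bool" where
  "sum_closed \<A> \<longleftrightarrow>
     (\<forall>G\<in>\<A>. \<forall>H\<in>\<A>. \<forall>x. verts G \<inter> verts H \<subseteq> {x} \<longrightarrow> graph_union G H \<in> \<A>)"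

lemma iso_stepsI: "minor_step G H \<Longrightarrow> iso_step\<^sup>*\<^sup>* G H"
  by (simp add: iso_step_def r_into_rtranclp)

lemma delete_vert_union:
  fixes G H :: "nat graph"
  assumes G: "simple_graph G" and H: "simple_graph H" and K: "K = delete_verts (graph_union G H) {w}"
    and ne: "verts (graph_union G H) \<noteq> {w}" and x: "verts G \<inter> verts H \<subseteq> {x}"
  shows "iso_step\<^sup>*\<^sup>* G K \<or> iso_step\<^sup>*\<^sup>* H K \<or>
    (\<exists>G' H' y. iso_step\<^sup>*\<^sup>* G G' \<and> iso_step\<^sup>*\<^sup>* H H' \<and> verts G' \<inter> verts H' \<subseteq> {y} \<and> K = graph_union G' H')"
proof -
  have del: "iso_step\<^sup>*\<^sup>* F (delete_verts F {w})" if F: "simple_graph F" "verts F \<noteq> {w}" for F :: "nat graph"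
  proof (cases "w \<in> verts F")
    case True
    then show ?thesis using iso_stepsI[OF del_vert] F by blast
  next
    case False
    then have "\<And>e. e \<in> edges F \<Longrightarrow> w \<notin> e" using simple_edge_sub[OF F(1)] by blast
    then have "delete_verts F {w} = F" using False by (auto simp: delete_verts_def prod_eq_iff)
    then show ?thesis by simp
  qed
  have one: "iso_step\<^sup>*\<^sup>* F2 (delete_verts (graph_union F1 F2) {w})"
    if F: "simple_graph F1" "simple_graph F2" "verts F1 = {w}" "verts (graph_union F1 F2) \<noteq> {w}"
    for F1 F2 :: "nat graph"
  proof -
    have "edges F1 = {}" using edgeless_singleton[OF F(1)] F(3) by simp
    then have "delete_verts (graph_union F1 F2) {w} = delete_verts F2 {w}"
      using F(3) by (auto simp: delete_verts_def graph_union_def)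
    moreover have "verts F2 \<noteq> {w}" using F by (auto simp: graph_union_def)
    ultimately show ?thesis using del[OF F(2)] by simp
  qed
  consider "verts G = {w}" | "verts H = {w}" | "verts G \<noteq> {w}" "verts H \<noteq> {w}" by blast
  then show ?thesis
  proof cases
    case 1
    then show ?thesis using one[OF G H] ne K by blast
  next
    case 2
    then show ?thesis using one[OF H G] ne K by (simp add: graph_union_commute)
  next
    case 3
    have "K = graph_union (delete_verts G {w}) (delete_verts H {w})"
      by (auto simp: K delete_verts_def graph_union_def)
    moreover have "verts (delete_verts G {w}) \<inter> verts (delete_verts H {w}) \<subseteq> {x}"
      using x by (auto simp: delete_verts_def)
    ultimately show ?thesis using del[OF G 3(1)] del[OF H 3(2)] by blast
  qed
qed

text \<open>An edge of G is not an edge of H, as at most one vertex is shared. When the contracted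
  vertex v is the shared one, it is renamed to u in H; the renaming is injective since u and v are
  not both in H.\<close>

lemma edge_step_union:
  fixes G H :: "nat graph"
  assumes G: "simple_graph G" and H: "simple_graph H" and x: "verts G \<inter> verts H \<subseteq> {x}"
    and e: "e \<in> edges G"
    and K: "K = delete_edge (graph_union G H) e \<or>
      (\<exists>u v. e = {u, v} \<and> u \<noteq> v \<and> K = contract_edge (graph_union G H) u v)"
  shows "\<exists>G' H' y. iso_step\<^sup>*\<^sup>* G G' \<and> iso_step\<^sup>*\<^sup>* H H' \<and> verts G' \<inter> verts H' \<subseteq> {y} \<and> K = graph_union G' H'"
  using K
proof (elim disjE exE conjE)
  assume K: "K = delete_edge (graph_union G H) e"
  have "e \<notin> edges H"
  proof
    assume "e \<in> edges H"
    then have "e \<subseteq> {x}" "card e = 2" using simple_edge_sub[OF G e] simple_edge_sub[OF H] x simple_card_edge[OF G e] by blast+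
    then show False using card_mono[of "{x}" e] by simp
  qed
  then have "K = graph_union (delete_edge G e) H"
    by (auto simp: K delete_edge_def graph_union_def)
  moreover have "verts (delete_edge G e) \<inter> verts H \<subseteq> {x}" using x by (simp add: delete_edge_def)
  ultimately show ?thesis using iso_stepsI[OF del_edge[OF e]] by blast
next
  fix u v assume uv: "e = {u, v}" "u \<noteq> v" and K: "K = contract_edge (graph_union G H) u v"
  let ?m = "collapse u v"
  have uvV: "u \<in> verts G" "v \<in> verts G" using simple_edge_sub[OF G e] uv by auto
  then have nb: "\<not> (u \<in> verts H \<and> v \<in> verts H)" using x uv by blast
  have inj: "inj_on ?m (verts H)" using nb by (auto simp: inj_on_def collapse_def)
  let ?H = "(?m ` verts H, (\<lambda>e. ?m ` e) ` edges H)"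
  have iso: "graph_iso H ?H" by (rule graph_iso_image[OF inj])
  have "qedges (edges H) ?m = (\<lambda>e. ?m ` e) ` edges H"
    using graph_iso_simple[OF iso H] by (auto simp: qedges_def simple_graph_def)
  moreover have "contract_edge G u v = (?m ` verts G, qedges (edges G) ?m)"
    using contract_edge_eq'[OF G] e uv by simp
  moreover have "K = (?m ` (verts G \<union> verts H), qedges (edges G \<union> edges H) ?m)"
    using contract_edge_eq'[OF graph_union_simple[OF G H]] e uv K by (simp add: graph_union_def)
  ultimately have "K = graph_union (contract_edge G u v) ?H"
    by (simp add: graph_union_def qedges_Un image_Un)
  moreover have "verts (contract_edge G u v) \<inter> verts ?H \<subseteq> {?m x}"
    using x uvV by (auto simp: contract_edge_def collapse_def)
  moreover have "iso_step\<^sup>*\<^sup>* H ?H" using iso by (simp add: iso_step_def r_into_rtranclp)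
  moreover have "iso_step\<^sup>*\<^sup>* G (contract_edge G u v)"
    using iso_stepsI[OF contract[of u v G]] e uv by simp
  ultimately show ?thesis by blast
qed

lemma step_union:
  fixes G H :: "nat graph"
  assumes G: "simple_graph G" and H: "simple_graph H" and x: "verts G \<inter> verts H \<subseteq> {x}"
    and st: "minor_step (graph_union G H) K"
  shows "iso_step\<^sup>*\<^sup>* G K \<or> iso_step\<^sup>*\<^sup>* H K \<or>
    (\<exists>G' H' y. iso_step\<^sup>*\<^sup>* G G' \<and> iso_step\<^sup>*\<^sup>* H H' \<and> verts G' \<inter> verts H' \<subseteq> {y} \<and> K = graph_union G' H')"
proof -
  have edge: ?thesis if e: "e \<in> edges (graph_union G H)"
    and K: "K = delete_edge (graph_union G H) e \<or>
      (\<exists>u v. e = {u, v} \<and> u \<noteq> v \<and> K = contract_edge (graph_union G H) u v)" for e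
  proof (cases "e \<in> edges G")
    case True
    from edge_step_union[OF G H x this K] show ?thesis by blast
  next
    case False
    then have "e \<in> edges H" using e by (simp add: graph_union_def)
    moreover have "verts H \<inter> verts G \<subseteq> {x}" using x by blast
    moreover have "K = delete_edge (graph_union H G) e \<or>
      (\<exists>u v. e = {u, v} \<and> u \<noteq> v \<and> K = contract_edge (graph_union H G) u v)"
      using K by (simp only: graph_union_commute[of H G])
    ultimately obtain H' G' y where "iso_step\<^sup>*\<^sup>* H H'" "iso_step\<^sup>*\<^sup>* G G'" "verts H' \<inter> verts G' \<subseteq> {y}"
      "K = graph_union H' G'"
      using edge_step_union[OF H G] by blast
    then show ?thesis by (metis graph_union_commute inf_commute)
  qed
  show ?thesis
    using st
  proof cases
    case (del_vert v)
    then show ?thesis using delete_vert_union[OF G H _ _ x] by blast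
  next
    case (del_edge e)
    then show ?thesis using edge by blast
  next
    case (contract u v)
    then show ?thesis using edge[of "{u, v}"] by blast
  qed
qed

lemma iso_image_union:
  assumes "graph_iso (graph_union G H) K" "verts G \<inter> verts H \<subseteq> {x}"
  obtains G' H' y where "graph_iso G G'" "graph_iso H H'" "verts G' \<inter> verts H' \<subseteq> {y}" "K = graph_union G' H'"
proof -
  obtain f where f: "inj_on f (verts (graph_union G H))"
    "K = (f ` verts (graph_union G H), (\<lambda>e. f ` e) ` edges (graph_union G H))"
    using graph_isoE[OF assms(1)] by blast
  have inj: "inj_on f (verts G \<union> verts H)" using f(1) by (simp add: graph_union_def)
  have "f ` verts G \<inter> f ` verts H \<subseteq> {f x}"
    using inj_on_image_Int[OF inj, of "verts G" "verts H"] assms(2) by auto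
  moreover have "graph_iso G (f ` verts G, (\<lambda>e. f ` e) ` edges G)"
    by (rule graph_iso_image[OF inj_on_subset[OF inj]]) auto
  moreover have "graph_iso H (f ` verts H, (\<lambda>e. f ` e) ` edges H)"
    by (rule graph_iso_image[OF inj_on_subset[OF inj]]) auto
  ultimately show ?thesis
    by (rule_tac that) (auto simp: f(2) graph_union_def)
qed

inductive_set block_closure :: "'a graph set \<Rightarrow> 'a graph set" for \<C> where
  base: "G \<in> \<C> \<Longrightarrow> G \<in> block_closure \<C>"
| union: "G \<in> block_closure \<C> \<Longrightarrow> H \<in> block_closure \<C> \<Longrightarrow> verts G \<inter> verts H \<subseteq> {x} \<Longrightarrow>
    graph_union G H \<in> block_closure \<C>"

lemma block_closure_sum_closed: "sum_closed (block_closure \<C>)"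
  unfolding sum_closed_def by (intro ballI allI impI) (rule block_closure.union)

lemma block_closure_simple:
  assumes "graph_class \<C>" "G \<in> block_closure \<C>" shows "simple_graph G"
  using assms(2) by induction (use class_simple[OF assms(1)] graph_union_simple in blast)+

lemma block_closure_class:
  assumes "graph_class \<C>" shows "graph_class (block_closure \<C>)"
  unfolding graph_class_def
proof (intro conjI ballI allI impI)
  fix G H :: "nat graph" assume "G \<in> block_closure \<C>" "graph_iso G H"
  then show "H \<in> block_closure \<C>"
  proof (induction arbitrary: H)
    case (base G)
    then show ?case using class_iso[OF assms] block_closure.base by blast
  next
    case (union G F x)
    obtain G' F' y where "graph_iso G G'" "graph_iso F F'" "verts G' \<inter> verts F' \<subseteq> {y}" "H = graph_union G' F'"
      using iso_image_union[OF union.prems union.hyps(3)] by blast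
    then show ?case using block_closure.union[OF union.IH(1)[of G'] union.IH(2)[of F'], of y] by simp
  qed
qed (use block_closure_simple[OF assms] in blast)

text \<open>The decomposition of a step on a union reaches the new summands by chains of steps, so
  the induction carries all descendants: Q consists of the graphs whose every descendant lies in the
  closure. Adjoining unions of two members of Q gives a set that is closed under steps, hence
  contained in Q.\<close>

lemma block_closure_minor_closed:
  assumes "minor_closed \<C>" shows "minor_closed (block_closure \<C>)"
proof -
  let ?D = "block_closure \<C>"
  have gc: "graph_class \<C>" by (rule minor_closed_class[OF assms])
  define Q where "Q = {G. simple_graph G \<and> (\<forall>H. iso_step\<^sup>*\<^sup>* G H \<longrightarrow> H \<in> ?D)}"
  define Q' where "Q' = Q \<union> {graph_union G H | G H x. G \<in> Q \<and> H \<in> Q \<and> verts G \<inter> verts H \<subseteq> {x}}"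
  have QD: "G \<in> ?D" if "G \<in> Q" for G using that by (simp add: Q_def del: split_paired_All)
  have Q'D: "G \<in> ?D" if "G \<in> Q'" for G
    using that unfolding Q'_def
  proof
    assume "G \<in> {graph_union G H | G H x. G \<in> Q \<and> H \<in> Q \<and> verts G \<inter> verts H \<subseteq> {x}}"
    then obtain F H x where "G = graph_union F H" "F \<in> Q" "H \<in> Q" "verts F \<inter> verts H \<subseteq> {x}" by blast
    then show ?thesis using block_closure.union[OF QD QD] by simp
  qed (rule QD)
  have Qs: "H \<in> Q" if "G \<in> Q" "iso_step\<^sup>*\<^sup>* G H" for G H
    using that iso_steps_simple[OF that(2)] by (auto simp: Q_def dest: rtranclp_trans)
  have step: "K \<in> Q'" if "F \<in> Q'" "iso_step F K" for F K
  proof -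
    have "K \<in> Q'" if un: "G \<in> Q" "H \<in> Q" "verts G \<inter> verts H \<subseteq> {x}" and F: "F = graph_union G H" for G H x
      using \<open>iso_step F K\<close> unfolding iso_step_def
    proof
      assume "minor_step F K"
      then show ?thesis
        using step_union[of G H x K] un F Qs unfolding Q'_def Q_def mem_Collect_eq Un_iff by blast
    next
      assume "graph_iso F K"
      then obtain G' H' y where *: "graph_iso G G'" "graph_iso H H'" "verts G' \<inter> verts H' \<subseteq> {y}" "K = graph_union G' H'"
        using iso_image_union[of G H K x] un F by blast
      then have "G' \<in> Q" "H' \<in> Q"
        using Qs[OF un(1), of G'] Qs[OF un(2), of H'] by (auto simp: iso_step_def r_into_rtranclp)
      then show ?thesis using * unfolding Q'_def by blast
    qed
    moreover have "K \<in> Q'" if "F \<in> Q"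
      using Qs[OF that r_into_rtranclp[of iso_step, OF \<open>iso_step F K\<close>]] by (simp add: Q'_def)
    ultimately show ?thesis using \<open>F \<in> Q'\<close> unfolding Q'_def by blast
  qed
  have Q'Q: "G \<in> Q" if "G \<in> Q'" for G
  proof -
    have "H \<in> Q'" if "iso_step\<^sup>*\<^sup>* G H" for H
      using that \<open>G \<in> Q'\<close> by (induction rule: rtranclp_induct) (use step in auto)
    then show ?thesis using Q'D block_closure_simple[OF gc Q'D[OF that]] by (simp add: Q_def)
  qed
  have "G \<in> Q" if "G \<in> ?D" for G
    using that
  proof induction
    case (base G)
    then show ?case
      using minor_closed_iso_step[OF assms, of G] class_simple[OF gc] block_closure.base[of _ \<C>]
      unfolding Q_def by blast
  next
    case (union G H x)
    then have "graph_union G H \<in> Q'" unfolding Q'_def by blast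
    then show ?case by (rule Q'Q)
  qed
  then have "H \<in> ?D" if "G \<in> ?D" "minor_step G H" for G H
    using that iso_stepsI[OF that(2)] unfolding Q_def by blast
  then show ?thesis by (intro minor_closedI block_closure_class[OF gc])
qed

text \<open>The quantity v - 1 is superadditive under these unions, since at most one vertex is
  shared; with \<gamma> \<ge> 0 the bounds add up.\<close>

lemma block_closure_edges:
  assumes "graph_class \<C>" "\<gamma> \<ge> 0" "G \<in> block_closure \<C>"
    and "\<And>G. G \<in> \<C> \<Longrightarrow> real (card (edges G)) \<le> \<gamma> * (real (card (verts G)) - 1)"
  shows "real (card (edges G)) \<le> \<gamma> * (real (card (verts G)) - 1)"
  using assms(3)
proof induction
  case (union G H x)
  have fin: "finite (verts G)" "finite (verts H)"
    using block_closure_simple[OF assms(1)] union.hyps by (auto simp: simple_graph_def)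
  have "card (verts G \<inter> verts H) \<le> 1" using card_mono[OF _ union.hyps(3)] by simp
  then have "card (verts G) + card (verts H) \<le> card (verts G \<union> verts H) + 1"
    using card_Un_Int[OF fin] by simp
  then have "(real (card (verts G)) - 1) + (real (card (verts H)) - 1) \<le> real (card (verts G \<union> verts H)) - 1"
    by linarith
  then have "\<gamma> * (real (card (verts G)) - 1) + \<gamma> * (real (card (verts H)) - 1)
      \<le> \<gamma> * (real (card (verts G \<union> verts H)) - 1)"
    using mult_left_mono[OF _ assms(2)] by (fastforce simp: distrib_left[symmetric])
  moreover have "real (card (edges G \<union> edges H)) \<le> real (card (edges G)) + real (card (edges H))"
    using card_Un_le[of "edges G" "edges H"] by linarith
  ultimately show ?case using union.IH by (simp add: graph_union_def)
qed (use assms(4) in blast)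

text \<open>Copies are attached one after another at single vertices, each contributing v - 1 new
  vertices and all its edges.\<close>

lemma sum_copies:
  fixes G :: "nat graph"
  assumes "graph_class \<A>" "sum_closed \<A>" "G \<in> \<A>"
  shows "\<exists>H\<in>\<A>. card (verts H) = Suc n * (card (verts G) - 1) + 1 \<and> card (edges H) = Suc n * card (edges G)"
proof (induction n)
  case 0
  then show ?case using assms(3) simple_card_verts[OF class_simple[OF assms(1,3)]] by auto
next
  case (Suc n)
  then obtain H where H: "H \<in> \<A>" "card (verts H) = Suc n * (card (verts G) - 1) + 1"
    "card (edges H) = Suc n * card (edges G)" by blast
  have sG: "simple_graph G" and sH: "simple_graph H" using class_simple[OF assms(1)] assms(3) H by auto
  have fV: "finite (verts G)" "finite (verts H)" using sG sH by (auto simp: simple_graph_def)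
  obtain r s where rs: "r \<in> verts G" "s \<in> verts H" using sG sH by (auto simp: simple_graph_def)
  \<comment> \<open>N exceeds every vertex of H, so shifting by N makes the copy disjoint from H
    except at the glued vertex.\<close>
  define N where "N = Suc (Max (verts H))"
  have N: "z < N" if "z \<in> verts H" for z using that fV by (simp add: N_def less_Suc_eq_le)
  define f where "f = (\<lambda>x. if x = r then s else x + N)"
  have inj: "inj_on f (verts G)" using N[OF rs(2)] by (auto simp: f_def inj_on_def)
  let ?K = "(f ` verts G, (\<lambda>e. f ` e) ` edges G)"
  have iso: "graph_iso G ?K" by (rule graph_iso_image[OF inj])
  have K: "?K \<in> \<A>" by (rule class_iso[OF assms(1,3) iso])
  have sK: "simple_graph ?K" by (rule graph_iso_simple[OF iso sG])
  have cK: "card (verts ?K) = card (verts G)" "card (edges ?K) = card (edges G)"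
    using graph_iso_cards[OF iso sG] by auto
  have int: "verts H \<inter> verts ?K = {s}"
  proof -
    have "f x \<notin> verts H" if "x \<noteq> r" for x using that N[of "f x"] by (auto simp: f_def)
    moreover have "f r = s" by (simp add: f_def)
    ultimately show ?thesis using rs by (auto simp: image_iff) metis
  qed
  have "card (verts H \<union> verts ?K) + 1 = card (verts H) + card (verts ?K)"
    using card_Un_Int[of "verts H" "verts ?K"] fV int by simp
  then have "card (verts H \<union> verts ?K) = Suc (Suc n) * (card (verts G) - 1) + 1"
    using H(2) cK simple_card_verts[OF sG] by simp
  moreover have "edges H \<inter> edges ?K = {}"
  proof -
    have "e \<subseteq> {s}" if "e \<in> edges H" "e \<in> edges ?K" for e
      using that int simple_edge_sub[OF sH] simple_edge_sub[OF sK] by blast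
    then have "card e \<le> 1" if "e \<in> edges H" "e \<in> edges ?K" for e
      using that card_mono[of "{s}" e] by simp
    then show ?thesis using simple_card_edge[OF sH] by (metis disjoint_iff numeral_le_one_iff semiring_norm(69))
  qed
  then have "card (edges H \<union> edges ?K) = Suc (Suc n) * card (edges G)"
    using card_Un_disjoint[of "edges H" "edges ?K"] simple_finite_edges[OF sH] simple_finite_edges[OF sK] H(3) cK
    by simp
  moreover have "graph_union H ?K \<in> \<A>" using assms(2) H(1) K int unfolding sum_closed_def by blast
  ultimately show ?case by (intro bexI[of _ "graph_union H ?K"]) (simp_all add: graph_union_def)
qed

lemma sum_closed_edges:
  assumes A: "minor_closed \<A>" "proper_class \<A>" "sum_closed \<A>" "G \<in> \<A>"
  shows "real (card (edges G)) \<le> critical_density \<A> * (real (card (verts G)) - 1)"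
proof (rule ccontr)
  let ?b = "critical_density \<A>" and ?v = "card (verts G)" and ?e = "card (edges G)"
  assume "\<not> ?thesis"
  then have pos: "real ?e - ?b * (real ?v - 1) > 0" by simp
  \<comment> \<open>An excess over b (v - 1) is multiplied by the number of copies, whereas the
    bound for their union leaves a surplus of only b.\<close>
  obtain n where n: "?b < real n * (real ?e - ?b * (real ?v - 1))"
    using ex_less_of_nat_mult[OF pos] by blast
  have gc: "graph_class \<A>" by (rule minor_closed_class[OF A(1)])
  obtain H where H: "H \<in> \<A>" "card (verts H) = Suc n * (?v - 1) + 1" "card (edges H) = Suc n * ?e"
    using sum_copies[OF gc A(3,4)] by blast
  have v: "real (?v - 1) = real ?v - 1" using simple_card_verts[OF class_simple[OF gc A(4)]] by (simp add: of_nat_diff)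
  have "real (card (edges H)) \<le> ?b * real (card (verts H))" by (rule critical_density_edges[OF A(1,2) H(1)])
  then have "real (Suc n) * real ?e \<le> ?b * (real (Suc n) * (real ?v - 1) + 1)"
    unfolding H(2,3) of_nat_mult of_nat_add v[symmetric] by simp
  then have "real (Suc n) * (real ?e - ?b * (real ?v - 1)) \<le> ?b" by (simp add: algebra_simps)
  moreover have "real n * (real ?e - ?b * (real ?v - 1)) \<le> real (Suc n) * (real ?e - ?b * (real ?v - 1))"
    using pos by (intro mult_right_mono) auto
  ultimately show False using n by linarith
qed

text \<open>A proper minor is not isomorphic to G, so the chain leading to it contains a first
  genuine step, and the class is closed under the remaining ones.\<close>

lemma excluded_minorI:
  assumes "graph_class \<A>" "simple_graph G" "G \<notin> \<A>" "\<And>H. minor_step G H \<Longrightarrow> H \<in> \<A>" "minor_closed \<A>"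
  shows "excluded_minor \<A> G"
  unfolding excluded_minor_def
proof (intro conjI allI impI assms(2,3))
  fix H :: "nat graph" assume "is_proper_minor H G"
  then obtain K where K: "minor_step\<^sup>*\<^sup>* G K" "graph_iso K H" "\<not> graph_iso H G"
    by (auto simp: is_proper_minor_def is_minor_def)
  have sK: "simple_graph K" using K(1) assms(2) by (induction rule: rtranclp_induct) (use minor_step_simple in auto)
  have "K \<noteq> G" using graph_iso_sym[OF K(2) sK] K(3) by blast
  then obtain G' where G': "minor_step G G'" "minor_step\<^sup>*\<^sup>* G' K"
    using K(1) by (metis converse_rtranclpE)
  have "K \<in> \<A>" using G'(2) assms(4)[OF G'(1)]
    by (induction rule: rtranclp_induct) (use minor_closed_step[OF assms(5)] in auto)
  then show "H \<in> \<A>" using class_iso[OF assms(1) _ K(2)] by blast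
qed

section \<open>Sum-closed classes and 2-connected excluded minors\<close>

locale two_connected_obstructions =
  fixes \<A> :: "nat graph set"
  assumes minor_closed: "minor_closed \<A>" and proper: "proper_class \<A>"
    and excl: "\<And>G. excluded_minor \<A> G \<Longrightarrow> two_connected G"
begin

lemma gclass: "graph_class \<A>"
  by (rule minor_closed_class[OF minor_closed])

text \<open>A smallest graph outside the class is an excluded minor, and 2-connected graphs have at
  least three vertices.\<close>

lemma small_graphs:
  assumes "simple_graph G" "card (verts G) \<le> 2" shows "G \<in> \<A>"
  using assms
proof (induction "card (verts G) + card (edges G)" arbitrary: G rule: less_induct)
  case less
  show ?case
  proof (rule ccontr)
    assume "G \<notin> \<A>"
    moreover have "H \<in> \<A>" if "minor_step G H" for H
      using less.hyps[of H] minor_step_smaller[OF that] minor_step_simple[OF that] less.prems by auto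
    ultimately have "two_connected G" by (intro excl excluded_minorI[OF gclass less.prems(1)] minor_closed)
    then show False using less.prems by (simp add: two_connected_def)
  qed
qed

text \<open>Every step on a smallest union outside the class gives a smaller union or a minor of a
  summand; hence that union is an excluded minor and 2-connected. But deleting the at most one
  common vertex disconnects it.\<close>

lemma sum_closed: "sum_closed \<A>"
proof -
  have "graph_union G H \<in> \<A>" if "G \<in> \<A>" "H \<in> \<A>" "verts G \<inter> verts H \<subseteq> {x}" for G H x
    using that
  proof (induction "card (verts (graph_union G H)) + card (edges (graph_union G H))"
      arbitrary: G H x rule: less_induct)
    case less
    let ?F = "graph_union G H"
    have sG: "simple_graph G" and sH: "simple_graph H" using class_simple[OF gclass] less.prems by auto
    have sF: "simple_graph ?F" by (rule graph_union_simple[OF sG sH])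
    show ?case
    proof (rule ccontr)
      assume F: "?F \<notin> \<A>"
      have "K \<in> \<A>" if "minor_step ?F K" for K
        using step_union[OF sG sH less.prems(3) that]
      proof (elim disjE exE conjE)
        fix G' H' y assume *: "iso_step\<^sup>*\<^sup>* G G'" "iso_step\<^sup>*\<^sup>* H H'" "verts G' \<inter> verts H' \<subseteq> {y}" "K = graph_union G' H'"
        show "K \<in> \<A>"
          unfolding *(4)
        proof (rule less.hyps)
          show "G' \<in> \<A>" "H' \<in> \<A>" using minor_closed_iso_step[OF minor_closed] * less.prems by blast+
        qed (use minor_step_smaller[OF that sF] * in auto)
      qed (use minor_closed_iso_step[OF minor_closed] less.prems in blast)+
      then have tc: "two_connected ?F" by (intro excl excluded_minorI[OF gclass sF F] minor_closed)
      \<comment> \<open>Both sides of the separation must be non-empty: a summand whose vertices all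
        lie in the other has at most one vertex and no edge, so the union would be the other
        summand.\<close>
      have nsub: "\<not> verts G' \<subseteq> verts H'"
        if GH: "G' \<in> \<A>" "H' \<in> \<A>" "verts G' \<inter> verts H' \<subseteq> {x}" "graph_union G' H' \<notin> \<A>" for G' H'
      proof
        assume "verts G' \<subseteq> verts H'"
        then have "verts G' \<subseteq> {x}" using GH by blast
        then have "edges G' = {}" using edgeless_singleton[OF class_simple[OF gclass GH(1)]] by simp
        then have "graph_union G' H' = H'" using \<open>verts G' \<subseteq> verts H'\<close> by (auto simp: graph_union_def prod_eq_iff)
        then show False using GH by simp
      qed
      obtain a b where ab: "a \<in> verts G - verts H" "b \<in> verts H - verts G"
        using nsub[of G H] nsub[of H G] less.prems F by (auto simp: graph_union_commute inf_commute)
      define X where "X = verts G \<inter> verts H"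
      have "card X < 2" using card_mono[of "{x}" X] less.prems(3) by (simp add: X_def)
      moreover have "X \<subseteq> verts ?F" by (auto simp: X_def graph_union_def)
      ultimately have "connected_graph (delete_verts ?F X)" using tc by (auto simp: two_connected_def)
      then have c: "conn (edges (delete_verts ?F X)) (verts (delete_verts ?F X))"
        using sF by (subst (asm) connected_graph_conn) (auto simp: delete_verts_def simple_graph_def)
      have "verts G - X \<noteq> {}" "verts G - X \<subset> verts (delete_verts ?F X)"
        using ab by (auto simp: X_def delete_verts_def graph_union_def)
      from conn_ex[OF c this] obtain p q where "p \<in> verts G - X" "q \<in> verts (delete_verts ?F X) - (verts G - X)"
        "{p, q} \<in> edges (delete_verts ?F X)"
        by blast
      then show False
        using simple_edge_sub[OF sG, of "{p, q}"] simple_edge_sub[OF sH, of "{p, q}"]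
        by (auto simp: X_def delete_verts_def graph_union_def)
    qed
  qed
  then show ?thesis unfolding sum_closed_def by blast
qed

lemma critical_density_ge_1: "critical_density \<A> \<ge> 1"
proof -
  have "({0, 1}, {{0, 1}}) \<in> \<A>" by (rule small_graphs) (auto simp: simple_graph_def)
  from sum_closed_edges[OF minor_closed proper sum_closed this] show ?thesis by simp
qed

lemma density_less: "G \<in> \<A> \<Longrightarrow> density G < critical_density \<A>"
proof -
  assume G: "G \<in> \<A>"
  let ?b = "critical_density \<A>"
  have "real (card (edges G)) < ?b * real (card (verts G))"
    using sum_closed_edges[OF minor_closed proper sum_closed G] critical_density_ge_1
    by (simp add: algebra_simps)
  then show ?thesis
    using simple_card_verts[OF class_simple[OF gclass G]] by (simp add: density_def divide_less_eq)
qed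

lemma islimpt_critical_density: "critical_density \<A> islimpt critical_densities"
  unfolding islimpt_approachable
proof (intro allI impI)
  fix \<epsilon> :: real assume "\<epsilon> > 0"
  then obtain G where G: "G \<in> \<A>" "critical_density \<A> - \<epsilon> < density G"
    using critical_density_less[OF minor_closed proper, of "critical_density \<A> - \<epsilon>"] by auto
  define \<B> where "\<B> = {H. iso_step\<^sup>*\<^sup>* G H}"
  note \<B> = minors_class[OF class_simple[OF gclass G(1)], folded \<B>_def]
  obtain H where H: "H \<in> \<B>" "critical_density \<B> = density H" using \<B>(3) by blast
  have "H \<in> \<A>" using H(1) minor_closed_iso_step[OF minor_closed _ G(1)] by (simp add: \<B>_def)
  then have "critical_density \<B> < critical_density \<A>" using density_less H by simp
  moreover have "density G \<le> critical_density \<B>"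
    by (rule critical_density_upper[OF \<B>(1,2)]) (simp add: \<B>_def)
  moreover have "critical_density \<B> \<in> critical_densities"
    using \<B>(1,2) by (auto simp: critical_densities_def)
  ultimately show "\<exists>x'\<in>critical_densities. x' \<noteq> critical_density \<A> \<and> dist x' (critical_density \<A>) < \<epsilon>"
    using G(2) by (intro bexI[of _ "critical_density \<B>"]) (auto simp: dist_real_def)
qed

end

lemma not_two_connectedE:
  assumes G: "simple_graph G" "card (verts G) > 2" "\<not> two_connected G"
  obtains X P Q where "X \<subseteq> verts G" "card X < 2" "P \<noteq> {}" "Q \<noteq> {}" "P \<inter> Q = {}" "X \<inter> (P \<union> Q) = {}"
    "verts G = P \<union> Q \<union> X" "edges G = ind (edges G) (P \<union> X) \<union> ind (edges G) (Q \<union> X)"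
proof -
  obtain X where X: "X \<subseteq> verts G" "card X < 2" "\<not> connected_graph (delete_verts G X)"
    using G(2,3) by (auto simp: two_connected_def)
  have "\<not> conn (edges (delete_verts G X)) (verts (delete_verts G X))"
    using X(3) G(1) by (subst (asm) connected_graph_conn) (auto simp: delete_verts_def simple_graph_def)
  moreover have "verts (delete_verts G X) \<noteq> {}"
  proof
    assume "verts (delete_verts G X) = {}"
    then have "verts G = X" using X by (auto simp: delete_verts_def)
    then show False using X G by simp
  qed
  ultimately obtain P where P: "P \<noteq> {}" "P \<subset> verts G - X"
    "\<And>x y. x \<in> P \<Longrightarrow> y \<in> verts G - X - P \<Longrightarrow> {x, y} \<notin> edges (delete_verts G X)"
    unfolding conn_def by (auto simp: delete_verts_def)
  define Q where "Q = verts G - X - P"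
  have "e \<in> ind (edges G) (P \<union> X) \<union> ind (edges G) (Q \<union> X)" if e: "e \<in> edges G" for e
  proof -
    obtain x y where xy: "e = {x, y}" using simple_card_edge[OF G(1) e] by (auto simp: card_2_iff)
    have "\<not> (x \<in> P \<and> y \<in> Q)" "\<not> (y \<in> P \<and> x \<in> Q)"
      using P(3)[of x y] P(3)[of y x] P(2) e xy by (auto simp: Q_def delete_verts_def insert_commute)
    then show ?thesis using simple_edge_sub[OF G(1) e] e xy by (auto simp: Q_def ind_def)
  qed
  then have "edges G = ind (edges G) (P \<union> X) \<union> ind (edges G) (Q \<union> X)" using ind_subset by blast
  then show ?thesis using X P by (intro that[of X P Q]) (auto simp: Q_def)
qed

text \<open>A separation by at most one vertex presents an excluded minor as the union of two proper
  induced subgraphs. These lie in the class by minimality, and then so does the union. Graphs with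
  at most two vertices never count as 2-connected and are covered by \<open>small\<close>.\<close>

lemma two_connected_obstructionsI:
  assumes A: "minor_closed \<A>" "sum_closed \<A>"
    and small: "\<And>G. simple_graph G \<Longrightarrow> card (verts G) \<le> 2 \<Longrightarrow> G \<in> \<A>"
    and G: "excluded_minor \<A> G"
  shows "two_connected G"
proof (rule ccontr)
  assume n: "\<not> two_connected G"
  have sG: "simple_graph G" and GA: "G \<notin> \<A>" using G by (auto simp: excluded_minor_def)
  have "card (verts G) > 2" using small[OF sG] GA by linarith
  from not_two_connectedE[OF sG this n] obtain X P Q where X: "X \<subseteq> verts G" "card X < 2" "P \<noteq> {}" "Q \<noteq> {}"
    "P \<inter> Q = {}" "X \<inter> (P \<union> Q) = {}" "verts G = P \<union> Q \<union> X"
    "edges G = ind (edges G) (P \<union> X) \<union> ind (edges G) (Q \<union> X)" by blast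
  have fV: "finite (verts G)" using sG by (simp add: simple_graph_def)
  have part: "(S, ind (edges G) S) \<in> \<A>" if S: "S \<noteq> {}" "S \<subset> verts G" for S
  proof -
    have "is_minor (S, ind (edges G) S) G" using S by (intro subgraph_minor[OF sG]) auto
    moreover have "\<not> graph_iso (S, ind (edges G) S) G"
    proof
      have "simple_graph (S, ind (edges G) S)"
        using sG S finite_subset[OF _ fV, of S] by (auto simp: simple_graph_def ind_def)
      moreover assume "graph_iso (S, ind (edges G) S) G"
      ultimately have "card (verts G) = card S" using graph_iso_cards(1) by fastforce
      then show False using psubset_card_mono[OF fV S(2)] by simp
    qed
    ultimately show ?thesis using G by (auto simp: excluded_minor_def is_proper_minor_def)
  qed
  obtain x where x: "X \<subseteq> {x}"
    using X(2) finite_subset[OF X(1) fV] by (metis card_le_Suc0_iff_eq less_2_cases_iff subset_singletonD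
        card_0_eq card_1_singletonE empty_subsetI One_nat_def order_refl)
  have "(P \<union> X, ind (edges G) (P \<union> X)) \<in> \<A>" "(Q \<union> X, ind (edges G) (Q \<union> X)) \<in> \<A>"
    using X by (intro part; auto)+
  moreover have "verts (P \<union> X, ind (edges G) (P \<union> X)) \<inter> verts (Q \<union> X, ind (edges G) (Q \<union> X)) \<subseteq> {x}"
    using X x by auto
  ultimately have "graph_union (P \<union> X, ind (edges G) (P \<union> X)) (Q \<union> X, ind (edges G) (Q \<union> X)) \<in> \<A>"
    using A(2) unfolding sum_closed_def by blast
  moreover have "graph_union (P \<union> X, ind (edges G) (P \<union> X)) (Q \<union> X, ind (edges G) (Q \<union> X)) = G"
    using X(7,8) by (auto simp: graph_union_def prod_eq_iff)
  ultimately show False using GA by simp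
qed

section \<open>A criterion for membership in \<open>critical_densities2\<close>, and apex
  classes\<close>

lemma card_complete_edges: "card (edges (complete_graph n)) = n choose 2"
  using n_subsets[of "{..<n}" 2] by (simp add: complete_graph_def)

lemma complete_dense: "\<exists>n>0. density (complete_graph n) > c"
proof -
  obtain n :: nat where n: "real n > \<bar>c\<bar>" using reals_Archimedean2 by blast
  have "2 * n + 2 choose 2 = (n + 1) * (2 * n + 1)" by (simp add: choose_two)
  then have "density (complete_graph (2 * n + 2)) = (2 * real n + 1) / 2"
    using card_complete_edges[of "2 * n + 2"]
    by (simp add: density_def complete_graph_def field_simps add_divide_distrib[symmetric])
  moreover have "(2 * real n + 1) / 2 > c" using n by (simp add: field_simps)
  ultimately show ?thesis by (intro exI[of _ "2 * n + 2"]) simp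
qed

text \<open>Complete graphs have unbounded density, so a bound on the densities forces one of them
  to be missing.\<close>

lemma proper_classI:
  assumes "graph_class \<A>" "G \<in> \<A>" "\<And>G. G \<in> \<A> \<Longrightarrow> density G \<le> c"
  shows "proper_class \<A>"
proof -
  obtain n where n: "n > 0" "density (complete_graph n) > c" using complete_dense by blast
  then have "complete_graph n \<notin> \<A>" using assms(3)[of "complete_graph n"] by auto
  then show ?thesis using assms complete_simple[OF n(1)] by (auto simp: proper_class_def)
qed

text \<open>The hypotheses make \<gamma> the supremum of e / (v - 1) over \<C>. The block closure
  has exactly this critical density: the upper bound survives gluing, and in a sum-closed class e /
  (v - 1) never exceeds the critical density.\<close>

lemma critical_densities2I:
  assumes C: "minor_closed \<C>"
    and small: "\<And>G. simple_graph G \<Longrightarrow> card (verts G) \<le> 2 \<Longrightarrow> G \<in> \<C>"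
    and \<gamma>: "\<gamma> \<ge> 0" "\<And>G. G \<in> \<C> \<Longrightarrow> real (card (edges G)) \<le> \<gamma> * (real (card (verts G)) - 1)"
    and sup: "\<And>y. y < \<gamma> \<Longrightarrow> \<exists>G\<in>\<C>. y * (real (card (verts G)) - 1) < real (card (edges G))"
  shows "\<gamma> \<in> critical_densities2"
proof -
  let ?D = "block_closure \<C>"
  have gc: "graph_class \<C>" by (rule minor_closed_class[OF C])
  have gD: "graph_class ?D" by (rule block_closure_class[OF gc])
  have mD: "minor_closed ?D" by (rule block_closure_minor_closed[OF C])
  have le: "density G \<le> \<gamma>" if "G \<in> ?D" for G
    using block_closure_edges[OF gc \<gamma>(1) that \<gamma>(2)] \<gamma>(1)
    by (simp add: density_le_iff[OF class_simple[OF gD that]] algebra_simps)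
  have "({0}, {}) \<in> ?D" by (intro block_closure.base small) (auto simp: simple_graph_def)
  then have pD: "proper_class ?D" using proper_classI[OF gD _ le] by blast
  have "critical_density ?D = \<gamma>"
  proof (rule antisym)
    show "critical_density ?D \<le> \<gamma>" by (rule critical_density_le[OF pD le])
    show "\<gamma> \<le> critical_density ?D"
    proof (rule ccontr)
      assume "\<not> \<gamma> \<le> critical_density ?D"
      then obtain G where "G \<in> \<C>" "critical_density ?D * (real (card (verts G)) - 1) < real (card (edges G))"
        using sup by force
      then show False
        using sum_closed_edges[OF mD pD block_closure_sum_closed block_closure.base, of G] by simp
    qed
  qed
  moreover have "two_connected G" if "excluded_minor ?D G" for G
    by (rule two_connected_obstructionsI[OF mD block_closure_sum_closed _ that])
      (use small block_closure.base in blast)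
  ultimately show ?thesis using mD pD unfolding critical_densities2_def by blast
qed

text \<open>The alternative \<open>verts G = {a}\<close> stands for deletion of the only vertex,
  whose result would be the null graph.\<close>

definition apex_class :: "nat graph set \<Rightarrow> nat graph set" where
  "apex_class \<A> = {G. simple_graph G \<and> (\<exists>a\<in>verts G. verts G = {a} \<or> delete_verts G {a} \<in> \<A>)}"

lemma apex_class_minor_closed:
  assumes A: "minor_closed \<A>" shows "minor_closed (apex_class \<A>)"
proof (rule minor_closedI)
  show "graph_class (apex_class \<A>)"
    unfolding graph_class_def
  proof (intro conjI ballI allI impI)
    fix G H :: "nat graph" assume G: "G \<in> apex_class \<A>" and iso: "graph_iso G H"
    then obtain a where sG: "simple_graph G" and a: "a \<in> verts G" "verts G = {a} \<or> delete_verts G {a} \<in> \<A>"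
      by (auto simp: apex_class_def)
    obtain f where f: "inj_on f (verts G)" "H = (f ` verts G, (\<lambda>e. f ` e) ` edges G)"
      using graph_isoE[OF iso] by blast
    have fa: "f a \<in> f ` e \<longleftrightarrow> a \<in> e" if "e \<in> edges G" for e
      using inj_on_image_mem_iff[OF f(1) a(1) simple_edge_sub[OF sG that]] .
    have "delete_verts H {f a} = (f ` verts (delete_verts G {a}), (\<lambda>e. f ` e) ` edges (delete_verts G {a}))"
    proof -
      have "f ` verts G - {f a} = f ` (verts G - {a})"
        using inj_on_image_set_diff[OF f(1), of "verts G" "{a}"] a by simp
      moreover have "{e \<in> (\<lambda>e. f ` e) ` edges G. e \<inter> {f a} = {}} = (\<lambda>e. f ` e) ` {e \<in> edges G. e \<inter> {a} = {}}"
        using fa by auto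
      ultimately show ?thesis by (simp add: delete_verts_def f)
    qed
    moreover have "inj_on f (verts (delete_verts G {a}))"
      using f(1) by (rule inj_on_subset) (auto simp: delete_verts_def)
    ultimately have "graph_iso (delete_verts G {a}) (delete_verts H {f a})"
      using graph_iso_image by metis
    then have "verts H = {f a} \<or> delete_verts H {f a} \<in> \<A>"
      using a(2) class_iso[OF minor_closed_class[OF A], of "delete_verts G {a}"] f(2) by fastforce
    then show "H \<in> apex_class \<A>"
      using graph_iso_simple[OF iso sG] a f by (auto simp: apex_class_def)
  qed (auto simp: apex_class_def)
next
  fix G H assume G: "G \<in> apex_class \<A>" and st: "minor_step G H"
  then obtain a where sG: "simple_graph G" and a: "a \<in> verts G" "verts G = {a} \<or> delete_verts G {a} \<in> \<A>"
    by (auto simp: apex_class_def)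
  have sH: "simple_graph H" by (rule minor_step_simple[OF st sG])
  have apexI: "H \<in> apex_class \<A>" if "b \<in> verts H" "verts H = {b} \<or> delete_verts H {b} \<in> \<A>" for b
    using that sH by (auto simp: apex_class_def)
  have sub: "(S, F) \<in> \<A>" if "S \<noteq> {}" "S \<subseteq> verts G - {a}" "F \<subseteq> ind (edges G) S" for S F
  proof -
    have D: "delete_verts G {a} \<in> \<A>" using a(2) that by auto
    show ?thesis
      by (rule minor_closed_subgraph[OF A D]) (use that in \<open>auto simp: delete_verts_def ind_def\<close>)
  qed
  \<comment> \<open>When H without b is a subgraph of G without a, b can serve as the apex; this
    settles every step except a contraction away from the apex.\<close>
  have delI: "H \<in> apex_class \<A>" if b: "b \<in> verts H" and "verts H - {b} \<subseteq> verts G - {a}"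
    "\<And>e. e \<in> edges H \<Longrightarrow> b \<notin> e \<Longrightarrow> e \<in> edges G" for b
  proof (cases "verts H = {b}")
    case True
    then show ?thesis using apexI b by blast
  next
    case False
    then have "(verts H - {b}, {e \<in> edges H. e \<inter> {b} = {}}) \<in> \<A>"
      using b that simple_edge_sub[OF sH] by (intro sub) (auto simp: ind_def)
    then show ?thesis using apexI[OF b] by (simp add: delete_verts_def)
  qed
  show "H \<in> apex_class \<A>"
    using st
  proof cases
    case (del_vert v)
    \<comment> \<open>If the apex itself is deleted, any remaining vertex takes over; otherwise the
      apex is kept.\<close>
    obtain b where b: "b \<in> verts H" "v \<noteq> a \<Longrightarrow> b = a"
      using sH a(1) del_vert by (cases "v = a") (auto simp: simple_graph_def delete_verts_def)
    show ?thesis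
      by (rule delI[OF b(1)]) (use b(2) del_vert in \<open>auto simp: delete_verts_def\<close>)
  next
    case (del_edge e)
    show ?thesis by (rule delI[of a]) (use a(1) del_edge in \<open>auto simp: delete_edge_def\<close>)
  next
    case (contract u v)
    have uv: "u \<in> verts G" "v \<in> verts G" using simple_edge_sub[OF sG contract(2)] by auto
    let ?m = "collapse u v"
    have H: "H = (verts G - {v}, qedges (edges G) ?m)" using contract by (simp add: contract_edge_eq)
    have old: "e \<in> edges G" if "e \<in> edges H" "u \<notin> e" for e
    proof -
      obtain f where f: "f \<in> edges G" "e = ?m ` f" using \<open>e \<in> edges H\<close> H by (auto simp: qedges_def)
      then have "v \<notin> f" using \<open>u \<notin> e\<close> by (auto simp: collapse_def)
      then have "?m ` f = f" by (auto simp: collapse_def)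
      then show ?thesis using f by simp
    qed
    show ?thesis
    proof (cases "a = u \<or> a = v")
      case True
      show ?thesis by (rule delI[of u]) (use True old uv contract(3) in \<open>auto simp: H\<close>)
    next
      case False
      let ?D = "delete_verts G {a}"
      have "?D \<in> \<A>" using a(2) uv False by auto
      moreover have "{u, v} \<in> edges ?D" using contract False by (simp add: delete_verts_def)
      ultimately have "contract_edge ?D u v \<in> \<A>"
        using minor_closed_step[OF A _ minor_step.contract] contract(3) by blast
      moreover have "contract_edge ?D u v = delete_verts H {a}"
      proof -
        have am: "a \<in> ?m ` f \<longleftrightarrow> a \<in> f" for f using False by (auto simp: collapse_def image_iff)
        have "{e \<in> qedges (edges G) ?m. a \<notin> e} = qedges {e \<in> edges G. a \<notin> e} ?m"
          unfolding qedges_def using am by auto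
        then show ?thesis by (auto simp: H contract_edge_eq delete_verts_def)
      qed
      ultimately show ?thesis using apexI[of a] a(1) False H by simp
    qed
  qed
qed

text \<open>The apex has at most v - 1 edges and the remainder has v - 1 vertices, which is why the
  bound involves v - 1 instead of v.\<close>

lemma apex_class_edges:
  assumes A: "minor_closed \<A>" "proper_class \<A>" and G: "G \<in> apex_class \<A>"
  shows "real (card (edges G)) \<le> (1 + critical_density \<A>) * (real (card (verts G)) - 1)"
proof -
  obtain a where sG: "simple_graph G" and a: "a \<in> verts G" "verts G = {a} \<or> delete_verts G {a} \<in> \<A>"
    using G by (auto simp: apex_class_def)
  have fV: "finite (verts G)" and fE: "finite (edges G)"
    using sG simple_finite_edges[OF sG] by (auto simp: simple_graph_def)
  show ?thesis
  proof (cases "verts G = {a}")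
    case True
    then have "edges G = {}" using edgeless_singleton[OF sG] by simp
    then show ?thesis using True by simp
  next
    case False
    let ?D = "delete_verts G {a}"
    have D: "?D \<in> \<A>" using a False by blast
    have v: "real (card (verts ?D)) = real (card (verts G)) - 1"
      using a fV card_gt_0_iff[of "verts G"] by (auto simp: delete_verts_def of_nat_diff)
    have "edges G \<subseteq> edges ?D \<union> (\<lambda>x. {a, x}) ` verts ?D"
    proof
      fix e assume e: "e \<in> edges G"
      obtain x y where xy: "e = {x, y}" "x \<noteq> y" using simple_card_edge[OF sG e] by (auto simp: card_2_iff)
      then show "e \<in> edges ?D \<union> (\<lambda>x. {a, x}) ` verts ?D"
        using e simple_edge_sub[OF sG e] by (auto simp: delete_verts_def insert_commute)
    qed
    then have "card (edges G) \<le> card (edges ?D \<union> (\<lambda>x. {a, x}) ` verts ?D)"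
      using fV fE by (intro card_mono) (auto simp: delete_verts_def)
    also have "\<dots> \<le> card (edges ?D) + card (verts ?D)"
      using card_Un_le[of "edges ?D" "(\<lambda>x. {a, x}) ` verts ?D"] card_image_le[of "verts ?D" "\<lambda>x. {a, x}"] fV
      by (simp add: delete_verts_def)
    finally have "real (card (edges G)) \<le> real (card (edges ?D)) + real (card (verts ?D))" by linarith
    also have "\<dots> \<le> critical_density \<A> * real (card (verts ?D)) + real (card (verts ?D))"
      using critical_density_edges[OF A D] by simp
    finally show ?thesis using v by (simp add: algebra_simps)
  qed
qed

lemma critical_density_nonneg:
  assumes "minor_closed \<A>" "proper_class \<A>" shows "critical_density \<A> \<ge> 0"
proof -
  obtain G where "G \<in> \<A>" using assms(2) by (auto simp: proper_class_def)
  then show ?thesis using critical_density_upper[OF assms] density_nonneg order_trans by blast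
qed

text \<open>A cone over G has v(G) + 1 vertices and e(G) + v(G) edges, so its ratio e / (v - 1) is 1
  plus the density of G: the cones make the bound for apex graphs sharp.\<close>

lemma one_plus_critical_density:
  assumes A: "minor_closed \<A>" "proper_class \<A>"
  shows "1 + critical_density \<A> \<in> critical_densities2"
proof (rule critical_densities2I[OF apex_class_minor_closed[OF A(1)] _ _ apex_class_edges[OF A]])
  have gc: "graph_class \<A>" by (rule minor_closed_class[OF A(1)])
  obtain G0 where G0: "G0 \<in> \<A>" using A(2) by (auto simp: proper_class_def)
  then obtain b where b: "b \<in> verts G0" using class_simple[OF gc G0] by (auto simp: simple_graph_def)
  have b1: "({b}, {}) \<in> \<A>" by (rule minor_closed_subgraph[OF A(1) G0]) (use b in auto)
  fix G :: "nat graph" assume sG: "simple_graph G" and c: "card (verts G) \<le> 2"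
  obtain a where a: "a \<in> verts G" using sG by (auto simp: simple_graph_def)
  have "delete_verts G {a} \<in> \<A>" if "verts G \<noteq> {a}"
  proof -
    have fV: "finite (verts G)" using sG by (simp add: simple_graph_def)
    have "card (verts G - {a}) \<le> 1" using a c fV by simp
    moreover have "verts G - {a} \<noteq> {}" using a that by auto
    ultimately have "card (verts G - {a}) = 1" using fV by (metis card_eq_0_iff finite_Diff le_neq_implies_less less_one)
    then obtain d where d: "verts G - {a} = {d}" by (auto simp: card_1_singleton_iff)
    have "verts G \<noteq> {a}" using that .
    then have "simple_graph (delete_verts G {a})"
      using minor_step_simple[OF del_vert[OF a] sG] by simp
    then have "edges (delete_verts G {a}) = {}"
      by (rule edgeless_singleton[of _ d]) (simp add: delete_verts_def d)
    then have "delete_verts G {a} = ({d}, {})" using d by (simp add: delete_verts_def)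
    moreover have "({d}, {}) \<in> \<A>"
      by (rule class_iso[OF gc b1]) (use graph_iso_image[of "\<lambda>_. d" "({b}, {})"] in simp)
    ultimately show ?thesis by simp
  qed
  then show "G \<in> apex_class \<A>" using sG a by (auto simp: apex_class_def)
next
  show "0 \<le> 1 + critical_density \<A>" using critical_density_nonneg[OF A] by simp
next
  have gc: "graph_class \<A>" by (rule minor_closed_class[OF A(1)])
  fix y assume "y < 1 + critical_density \<A>"
  then obtain G where G: "G \<in> \<A>" "y - 1 < density G"
    using critical_density_less[OF A, of "y - 1"] by auto
  have sG: "simple_graph G" by (rule class_simple[OF gc G(1)])
  obtain a where a: "a \<notin> verts G" using ex_new_if_finite[of "verts G"] sG by (auto simp: simple_graph_def)
  have "delete_verts (cone_graph a G) {a} = G"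
    using a simple_edge_sub[OF sG] by (auto simp: delete_verts_def cone_graph_def prod_eq_iff)
  then have "cone_graph a G \<in> apex_class \<A>"
    using cone_simple[OF sG a] G by (auto simp: apex_class_def cone_graph_def)
  moreover have "card (verts (cone_graph a G)) = card (verts G) + 1"
    using a sG by (simp add: cone_graph_def simple_graph_def)
  moreover have "(y - 1) * card (verts G) < card (edges G)"
    using G(2) simple_card_verts[OF sG] by (simp add: density_def less_divide_eq)
  ultimately show "\<exists>G\<in>apex_class \<A>. y * (real (card (verts G)) - 1) < real (card (edges G))"
    using cone_card_edges[OF sG a] by (intro bexI[of _ "cone_graph a G"]) (simp_all add: algebra_simps)
qed

section \<open>Small critical densities\<close>

text \<open>Forests are described by sparsity because this form passes to minors by counting,
  without any reference to cycles.\<close>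

definition forests :: "nat \<Rightarrow> nat graph set" where
  "forests n = {G. simple_graph G \<and> card (verts G) \<le> n \<and>
     (\<forall>S. S \<noteq> {} \<and> S \<subseteq> verts G \<longrightarrow> card (ind (edges G) S) < card S)}"

lemma forests_minor_closed: "minor_closed (forests n)"
proof (rule minor_closedI)
  show "graph_class (forests n)"
    unfolding graph_class_def
  proof (intro conjI ballI allI impI)
    fix G H :: "nat graph" assume G: "G \<in> forests n" and iso: "graph_iso G H"
    then have sG: "simple_graph G" by (simp add: forests_def)
    obtain f where f: "inj_on f (verts G)" "H = (f ` verts G, (\<lambda>e. f ` e) ` edges G)"
      using graph_isoE[OF iso] by blast
    have "card (ind (edges H) T) < card T" if T: "T \<noteq> {}" "T \<subseteq> verts H" for T
    proof -
      obtain S where S: "S \<subseteq> verts G" "T = f ` S" using T(2) f(2) by (metis fst_conv subset_imageE)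
      have "ind (edges H) T \<subseteq> (\<lambda>e. f ` e) ` ind (edges G) S"
      proof
        fix e assume "e \<in> ind (edges H) T"
        then obtain d where d: "d \<in> edges G" "e = f ` d" "f ` d \<subseteq> f ` S" using f S by (auto simp: ind_def)
        then have "d \<subseteq> S" using inj_on_image_subset_iff[OF f(1) simple_edge_sub[OF sG] S(1)] by blast
        then show "e \<in> (\<lambda>e. f ` e) ` ind (edges G) S" using d by (auto simp: ind_def)
      qed
      moreover have fin: "finite (ind (edges G) S)"
        using finite_subset[OF ind_subset simple_finite_edges[OF sG]] .
      ultimately have "card (ind (edges H) T) \<le> card (ind (edges G) S)"
        by (meson card_image_le card_mono finite_imageI le_trans)
      also have "\<dots> < card S" using G S T by (auto simp: forests_def)
      also have "card S = card T" using S f(1) by (simp add: card_image inj_on_subset)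
      finally show ?thesis .
    qed
    then show "H \<in> forests n"
      using G graph_iso_simple[OF iso sG] graph_iso_cards(1)[OF iso sG] by (simp add: forests_def)
  qed (simp add: forests_def)
next
  fix G H assume G: "G \<in> forests n" and st: "minor_step G H"
  then have sG: "simple_graph G" and cn: "card (verts G) \<le> n"
    and sp: "\<And>S. S \<noteq> {} \<Longrightarrow> S \<subseteq> verts G \<Longrightarrow> card (ind (edges G) S) < card S"
    by (auto simp: forests_def)
  have fi: "finite (ind (edges G) S)" for S using finite_subset[OF ind_subset simple_finite_edges[OF sG]] .
  have "card (ind (edges H) S) < card S" if S: "S \<noteq> {}" "S \<subseteq> verts H" for S
  proof -
    have sub: ?thesis if "S \<subseteq> verts G" "ind (edges H) S \<subseteq> ind (edges G) S"
      using card_mono[OF fi that(2)] sp[OF S(1) that(1)] by linarith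
    show ?thesis
      using st
    proof cases
      case (del_vert v)
      then show ?thesis using S by (intro sub) (auto simp: delete_verts_def ind_def)
    next
      case (del_edge e)
      then show ?thesis using S by (intro sub) (auto simp: delete_edge_def ind_def)
    next
      case (contract u v)
      let ?m = "collapse u v"
      have H: "H = (verts G - {v}, qedges (edges G) ?m)" using contract by (simp add: contract_edge_eq)
      have uv: "u \<in> verts G" "v \<in> verts G" using simple_edge_sub[OF sG contract(2)] by auto
      have vS: "v \<notin> S" "S \<subseteq> verts G" using S H by auto
      show ?thesis
      proof (cases "u \<in> S")
        case False
        have "ind (edges H) S \<subseteq> ind (edges G) S"
        proof
          fix e assume "e \<in> ind (edges H) S"
          then obtain d where d: "d \<in> edges G" "e = ?m ` d" "e \<subseteq> S" using H by (auto simp: ind_def qedges_def)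
          have "v \<notin> d" using d False by (auto simp: collapse_def)
          then have "e = d" using d by (auto simp: collapse_def)
          then show "e \<in> ind (edges G) S" using d by (simp add: ind_def)
        qed
        then show ?thesis using sub vS by blast
      next
        case True
        \<comment> \<open>A set S containing u is lifted to S with v added: this has one vertex
          more, and the edge uv disappears in the contraction, so the strict inequality passes
          down.\<close>
        let ?T = "insert v S"
        have "ind (edges H) S \<subseteq> (\<lambda>e. ?m ` e) ` (ind (edges G) ?T - {{u, v}})"
        proof
          fix e assume "e \<in> ind (edges H) S"
          then obtain d where d: "d \<in> edges G" "e = ?m ` d" "e \<subseteq> S" "card e = 2"
            using H by (auto simp: ind_def qedges_def)
          have "d \<subseteq> ?T"
          proof
            fix z assume "z \<in> d"
            then have "?m z \<in> S" using d by blast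
            then show "z \<in> ?T" by (auto simp: collapse_def split: if_splits)
          qed
          moreover have "d \<noteq> {u, v}"
          proof
            assume "d = {u, v}"
            then have "e = {u}" using d(2) by (auto simp: collapse_def)
            then show False using d(4) by simp
          qed
          ultimately show "e \<in> (\<lambda>e. ?m ` e) ` (ind (edges G) ?T - {{u, v}})" using d by (auto simp: ind_def)
        qed
        then have "card (ind (edges H) S) \<le> card (ind (edges G) ?T - {{u, v}})"
          using fi[of ?T] by (meson card_image_le card_mono finite_Diff finite_imageI le_trans)
        moreover have "{u, v} \<in> ind (edges G) ?T" using contract True by (simp add: ind_def)
        then have "card (ind (edges G) ?T - {{u, v}}) < card (ind (edges G) ?T)"
          using fi[of ?T] by (intro card_Diff1_less)
        moreover have "card (ind (edges G) ?T) < card ?T" using sp[of ?T] vS uv by simp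
        moreover have "card ?T = Suc (card S)"
          using vS sG by (simp add: simple_graph_def finite_subset)
        ultimately show ?thesis by linarith
      qed
    qed
  qed
  then show "H \<in> forests n"
    using minor_step_simple[OF st sG] minor_step_smaller(2)[OF st sG] cn by (simp add: forests_def)
qed

lemma one_minus_inverse_critical:
  assumes "k \<ge> 1" shows "1 - 1 / real k \<in> critical_densities"
proof -
  \<comment> \<open>The edges of the star with centre 0, a tree on k vertices.\<close>
  let ?E = "(\<lambda>i. {0, i}) ` {1..<k}"
  let ?G = "({..<k}, ?E)"
  have sG: "simple_graph ?G" using assms by (auto simp: simple_graph_def lessThan_empty_iff)
  have cE: "card ?E = k - 1"
    by (subst card_image) (auto simp: inj_on_def doubleton_eq_iff)
  have "card (ind ?E S) < card S" if S: "S \<noteq> {}" "S \<subseteq> {..<k}" for S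
  proof -
    have fS: "finite S" using S finite_subset by blast
    show ?thesis
    proof (cases "0 \<in> S")
      case True
      have "ind ?E S \<subseteq> (\<lambda>i. {0, i}) ` (S - {0})" by (auto simp: ind_def)
      then have "card (ind ?E S) \<le> card (S - {0})"
        using fS by (meson card_image_le card_mono finite_Diff finite_imageI le_trans)
      then show ?thesis using card_Diff1_less[OF fS True] by linarith
    next
      case False
      then have "ind ?E S = {}" by (auto simp: ind_def)
      then show ?thesis using S fS by (simp add: card_gt_0_iff)
    qed
  qed
  then have G: "?G \<in> forests k" using sG by (simp add: forests_def)
  have le: "density H \<le> 1 - 1 / real k" if H: "H \<in> forests k" for H
  proof -
    have sH: "simple_graph H" and cH: "card (verts H) \<le> k" using H by (auto simp: forests_def)
    have "verts H \<noteq> {}" using sH by (simp add: simple_graph_def)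
    then have "card (edges H) < card (verts H)"
      using H ind_verts[OF sH] by (auto simp: forests_def)
    then have "real (card (edges H)) \<le> real (card (verts H)) - 1" by linarith
    also have "\<dots> \<le> (1 - 1 / real k) * real (card (verts H))"
      using cH assms by (simp add: field_simps)
    finally show ?thesis using density_le_iff[OF sH] by blast
  qed
  have pc: "proper_class (forests k)"
    using proper_classI[OF minor_closed_class[OF forests_minor_closed] G le] .
  have "critical_density (forests k) = 1 - 1 / real k"
  proof (rule antisym[OF critical_density_le[OF pc le]])
    have "density ?G = 1 - 1 / real k"
      using cE assms by (simp add: density_def of_nat_diff field_simps)
    then show "1 - 1 / real k \<le> critical_density (forests k)"
      using critical_density_upper[OF forests_minor_closed pc G] by simp
  qed
  then show ?thesis using forests_minor_closed[of k] pc unfolding critical_densities_def by force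
qed

text \<open>Graphs of order at most 3 never have more edges than vertices, and the triangle has
  equality.\<close>

lemma one_critical: "1 \<in> critical_densities"
proof -
  define \<A> :: "nat graph set" where "\<A> = {G. simple_graph G \<and> card (verts G) \<le> 3}"
  have mc: "minor_closed \<A>"
  proof (rule minor_closedI)
    show "graph_class \<A>"
      unfolding graph_class_def \<A>_def using graph_iso_simple graph_iso_cards(1)
      by (metis (no_types, lifting) mem_Collect_eq)
    fix G H assume "G \<in> \<A>" "minor_step G H"
    then show "H \<in> \<A>"
      using minor_step_simple[of G H] minor_step_smaller(2)[of G H] by (auto simp: \<A>_def)
  qed
  have le: "density G \<le> 1" if "G \<in> \<A>" for G
  proof -
    have sG: "simple_graph G" and c3: "card (verts G) \<le> 3" using that by (auto simp: \<A>_def)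
    have "edges G \<subseteq> {e. e \<subseteq> verts G \<and> card e = 2}" using sG by (auto simp: simple_graph_def)
    then have "card (edges G) \<le> card (verts G) choose 2"
      using sG n_subsets[of "verts G" 2] card_mono[of "{e. e \<subseteq> verts G \<and> card e = 2}" "edges G"]
      by (simp add: simple_graph_def)
    also have "\<dots> \<le> card (verts G)"
    proof -
      have "card (verts G) \<in> {0, 1, 2, 3}" using c3 by auto
      then show ?thesis by (auto simp: choose_two)
    qed
    finally show ?thesis using density_le_iff[OF sG, of 1] by simp
  qed
  have K: "complete_graph 3 \<in> \<A>" using complete_simple[of 3] by (simp add: \<A>_def complete_graph_def)
  have pc: "proper_class \<A>" using proper_classI[OF minor_closed_class[OF mc] K le] .
  have "density (complete_graph 3) = 1"
    by (simp add: density_def card_complete_edges) (simp add: complete_graph_def choose_two)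
  then have "critical_density \<A> = 1"
    using critical_density_upper[OF mc pc K] critical_density_le[OF pc le] by force
  then show ?thesis using mc pc unfolding critical_densities_def by force
qed

section \<open>Densities of connected members: values below 1 and the gap at 13/10\<close>

lemma dense_connected_member:
  assumes A: "minor_closed \<A>" "G \<in> \<A>" and d: "density G > c"
  obtains T F where "(T, F) \<in> \<A>" "conn F T" "simple_graph (T, F)" "real (card F) > c * real (card T)"
proof -
  have gc: "graph_class \<A>" by (rule minor_closed_class[OF A(1)])
  have sG: "simple_graph G" using class_simple[OF gc A(2)] .
  have "real (card (ind (edges G) (verts G))) > c * real (card (verts G))"
    using d density_le_iff[OF sG, of c] ind_verts[OF sG] by (simp add: not_le)
  then obtain T where T: "T \<subseteq> verts G" "conn (edges G) T" "real (card (ind (edges G) T)) > c * real (card T)"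
    using conn_component_density[of "verts G" c "edges G"] sG by (auto simp: simple_graph_def)
  have "(T, ind (edges G) T) \<in> \<A>"
    by (rule minor_closed_subgraph[OF A T(1) conn_nonempty[OF T(2)]]) simp
  then show ?thesis using that[of T "ind (edges G) T"] T class_simple[OF gc] by (simp add: conn_ind)
qed

text \<open>Below density 1 connected members are trees. With b the critical density, their order is
  at most 1 / (1 - b), so a largest order k exists, and a tree on k vertices has density 1 -
  1/k.\<close>

lemma critical_density_below_1:
  assumes A: "minor_closed \<A>" "proper_class \<A>" and b: "critical_density \<A> < 1"
  shows "\<exists>k\<ge>1. critical_density \<A> = 1 - 1 / real k"
proof -
  let ?b = "critical_density \<A>"
  have gc: "graph_class \<A>" by (rule minor_closed_class[OF A(1)])
  define K where "K = {card T | T F. (T, F) \<in> \<A> \<and> conn F T}"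
  have tree: "real (card F) \<le> ?b * real (card T)" "card T \<le> card F + 1" "card F < card T" "card T \<ge> 1"
    if TF: "(T, F) \<in> \<A>" "conn F T" for T F
  proof -
    have s: "simple_graph (T, F)" using class_simple[OF gc TF(1)] .
    show 1: "real (card F) \<le> ?b * real (card T)" using critical_density_edges[OF A TF(1)] by simp
    show "card T \<le> card F + 1"
      using conn_card_edges[of T F] TF(2) s ind_verts[OF s] by (simp add: simple_graph_def)
    show 2: "card T \<ge> 1" using simple_card_verts[OF s] by simp
    have "?b * real (card T) < 1 * real (card T)" using b 2 by (intro mult_strict_right_mono) auto
    then show "card F < card T" using 1 by simp
  qed
  have "finite K"
  proof (rule finite_subset)
    show "K \<subseteq> {..nat \<lceil>1 / (1 - ?b)\<rceil>}"
    proof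
      fix n assume "n \<in> K"
      then obtain T F where TF: "(T, F) \<in> \<A>" "conn F T" "n = card T" by (auto simp: K_def)
      have "real (card T) - 1 \<le> real (card F)" using tree(2)[OF TF(1,2)] by linarith
      then have "real n - 1 \<le> ?b * n" using tree(1)[OF TF(1,2)] unfolding TF(3) by (rule order_trans)
      then have "real n * (1 - ?b) \<le> 1" by (simp add: algebra_simps)
      then have "real n \<le> 1 / (1 - ?b)" using b by (simp add: le_divide_eq)
      then show "n \<in> {..nat \<lceil>1 / (1 - ?b)\<rceil>}" by (simp add: le_nat_iff) linarith
    qed
  qed simp
  moreover have "K \<noteq> {}"
  proof -
    obtain G where G: "G \<in> \<A>" using A(2) by (auto simp: proper_class_def)
    then have "density G > -1" using density_nonneg[of G] by simp
    from dense_connected_member[OF A(1) G this] obtain T F where "(T, F) \<in> \<A>" "conn F T" .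
    then have "card T \<in> K" unfolding K_def by blast
    then show ?thesis by blast
  qed
  ultimately have mK: "Max K \<in> K" "\<And>n. n \<in> K \<Longrightarrow> n \<le> Max K" by auto
  define k where "k = Max K"
  obtain T F where TF: "(T, F) \<in> \<A>" "conn F T" "k = card T" using mK(1) by (auto simp: K_def k_def)
  have k1: "k \<ge> 1" using tree(4)[OF TF(1,2)] TF(3) by simp
  have "real (card T) - 1 \<le> real (card F)" using tree(2)[OF TF(1,2)] by linarith
  then have "real k - 1 \<le> ?b * real k" using tree(1)[OF TF(1,2)] unfolding TF(3) by (rule order_trans)
  then have "1 - 1 / real k \<le> ?b" using k1 by (simp add: field_simps)
  moreover have "?b \<le> 1 - 1 / real k"
  proof (rule ccontr)
    assume "\<not> ?thesis"
    then obtain G where "G \<in> \<A>" "1 - 1 / real k < density G"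
      using critical_density_less[OF A] by (metis not_le)
    from dense_connected_member[OF A(1) this] obtain T F where
      H: "(T, F) \<in> \<A>" "conn F T" "real (card F) > (1 - 1 / real k) * real (card T)" by blast
    have "card T \<le> k" using mK(2) H by (auto simp: K_def k_def)
    moreover have "real (card T) - 1 > (1 - 1 / real k) * real (card T)" using tree(3)[OF H(1,2)] H(3) by linarith
    then have "real (card T) > real k" using k1 by (simp add: field_simps)
    ultimately show False by simp
  qed
  ultimately show ?thesis using k1 by (intro exI[of _ k]) auto
qed

text \<open>Growth by triangles: an edge leaving T lies in a triangle, which adds one vertex with
  two edges or two vertices with three edges, so at least 3/2 edges per new vertex.\<close>

lemma conn_triangles_edges:
  assumes fin: "finite S" and S: "conn E S" and E: "\<And>e. e \<in> E \<Longrightarrow> card e = 2"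
    and tri: "\<And>x y. {x, y} \<in> E \<Longrightarrow> x \<in> S \<Longrightarrow> y \<in> S \<Longrightarrow> \<exists>z\<in>S. {x, z} \<in> E \<and> {y, z} \<in> E"
  shows "3 * card S \<le> 2 * card (ind E S) + 3"
proof -
  define \<C> where "\<C> = {T. T \<subseteq> S \<and> T \<noteq> {} \<and> 3 * card T \<le> 2 * card (ind E T) + 3}"
  have fC: "finite \<C>" unfolding \<C>_def using fin by (auto intro: finite_subset[of _ "Pow S"])
  obtain a where "a \<in> S" using conn_nonempty[OF S] by blast
  then have "{a} \<in> \<C>" by (auto simp: \<C>_def)
  with fC obtain T where T: "T \<in> \<C>" and mx: "\<And>C. C \<in> \<C> \<Longrightarrow> T \<subseteq> C \<Longrightarrow> C = T"
    using finite_has_maximal[of \<C>] by (metis empty_iff)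
  have "T = S"
  proof (rule ccontr)
    assume "T \<noteq> S"
    then obtain x y where xy: "x \<in> T" "y \<in> S - T" "{x, y} \<in> E"
      using conn_ex[OF S, of T] T by (auto simp: \<C>_def)
    have fT: "finite T" and TS: "T \<subseteq> S" using T fin by (auto simp: \<C>_def intro: finite_subset)
    have fiT: "finite (ind E T)" by (rule finite_ind[OF fT])
    obtain z where z: "z \<in> S" "{x, z} \<in> E" "{y, z} \<in> E" using tri[OF xy(3)] xy TS by blast
    have ne: "x \<noteq> y" "x \<noteq> z" "y \<noteq> z" using E[OF xy(3)] E[OF z(2)] E[OF z(3)] by auto
    have d: "{x, y} \<noteq> {x, z}" "{x, y} \<noteq> {y, z}" "{x, z} \<noteq> {y, z}" using ne by (auto simp: doubleton_eq_iff)
    have nT: "{x, y} \<notin> ind E T" "{y, z} \<notin> ind E T" using xy by (auto simp: ind_def)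
    show False
    proof (cases "z \<in> T")
      case True
      have "insert {x, y} (insert {y, z} (ind E T)) \<subseteq> ind E (insert y T)"
        using xy z True by (auto simp: ind_def)
      then have "card (insert {x, y} (insert {y, z} (ind E T))) \<le> card (ind E (insert y T))"
        using fT by (intro card_mono finite_ind) auto
      then have "card (ind E T) + 2 \<le> card (ind E (insert y T))"
        using fiT nT d by simp
      then have "insert y T \<in> \<C>" using T xy fT by (auto simp: \<C>_def)
      from mx[OF this] xy show False by blast
    next
      case False
      have nT': "{x, z} \<notin> ind E T" using False by (auto simp: ind_def)
      let ?T = "insert z (insert y T)"
      have "insert {x, y} (insert {y, z} (insert {x, z} (ind E T))) \<subseteq> ind E ?T"
        using xy z by (auto simp: ind_def)
      then have "card (insert {x, y} (insert {y, z} (insert {x, z} (ind E T)))) \<le> card (ind E ?T)"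
        using fT by (intro card_mono finite_ind) auto
      then have "card (ind E T) + 3 \<le> card (ind E ?T)"
        using fiT nT nT' d by simp
      then have "?T \<in> \<C>" using T xy z fT ne False by (auto simp: \<C>_def)
      from mx[OF this] xy show False by blast
    qed
  qed
  then show ?thesis using T by (auto simp: \<C>_def)
qed

lemma excess_three_dense:
  assumes A: "minor_closed \<A>" "(V, E) \<in> \<A>" "conn E V" "card E \<ge> card V + 3"
  shows "\<exists>G\<in>\<A>. 3 * card (edges G) \<ge> 4 * card (verts G)"
  using assms(2-4)
proof (induction "card V" arbitrary: V E rule: less_induct)
  case less
  have sG: "simple_graph (V, E)" using class_simple[OF minor_closed_class[OF A(1)] less.prems(1)] .
  have fV: "finite V" using sG by (simp add: simple_graph_def)
  show ?case
  proof (cases "\<exists>u v. {u, v} \<in> E \<and> u \<noteq> v \<and> {x. {u, x} \<in> E \<and> {v, x} \<in> E} = {}")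
    case True
    \<comment> \<open>Contracting an edge in no triangle loses one vertex and one edge, so the
      excess of e over v is kept.\<close>
    then obtain u v where uv: "{u, v} \<in> E" "u \<noteq> v" and t: "{x. {u, x} \<in> E \<and> {v, x} \<in> E} = {}" by blast
    have v: "v \<in> V" using simple_edge_sub[OF sG, of "{u, v}"] uv by simp
    let ?E = "qedges E (collapse u v)"
    have H: "contract_edge (V, E) u v = (collapse u v ` V, ?E)" "collapse u v ` V = V - {v}"
      using contract_edge_eq'[OF sG] contract_edge_eq[of "(V, E)" u v] uv by auto
    show ?thesis
    proof (rule less.hyps)
      show "card (V - {v}) < card V" using v fV by (intro card_Diff1_less)
      show "(V - {v}, ?E) \<in> \<A>"
        using minor_closed_step[OF A(1) less.prems(1) contract[of u v]] uv H by simp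
      show "conn ?E (V - {v})" using conn_image[OF less.prems(2), of "collapse u v"] H(2) by simp
      show "card ?E \<ge> card (V - {v}) + 3"
        using contract_edge_card[OF sG uv] t less.prems(3) card_Diff1_less[OF fV v] by simp
    qed
  next
    case False
    have "3 * card V \<le> 2 * card (ind E V) + 3"
    proof (rule conn_triangles_edges[OF fV less.prems(2)])
      show "card e = 2" if "e \<in> E" for e using simple_card_edge[OF sG] that by simp
      fix x y assume xy: "{x, y} \<in> E"
      have "x \<noteq> y" using simple_card_edge[OF sG, of "{x, y}"] xy by auto
      then obtain z where z: "{x, z} \<in> E" "{y, z} \<in> E" using False xy by blast
      then have "z \<in> V" using simple_edge_sub[OF sG, of "{x, z}"] by simp
      then show "\<exists>z\<in>V. {x, z} \<in> E \<and> {y, z} \<in> E" using z by blast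
    qed
    then have "3 * card V \<le> 2 * card E + 3" using ind_verts[OF sG] by simp
    \<comment> \<open>The sum of 2 e \<ge> 3 v - 3 and e \<ge> v + 3.\<close>
    then have "3 * card E \<ge> 4 * card V" using less.prems(3) by linarith
    then show ?thesis using less.prems(1) by force
  qed
qed

lemma thirteen_tenths_not_critical: "13 / 10 \<notin> critical_densities"
proof
  assume "13 / 10 \<in> critical_densities"
  then obtain \<A> where A: "minor_closed \<A>" "proper_class \<A>" and b: "critical_density \<A> = 13 / 10"
    by (auto simp: critical_densities_def)
  \<comment> \<open>With e \<le> v + 2, a density above 9/7 forces v \<le> 6, and no fraction with
    denominator at most 6 lies above 9/7 and at or below 13/10.\<close>
  obtain G where G: "G \<in> \<A>" "9 / 7 < density G" using critical_density_less[OF A, of "9 / 7"] b by auto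
  obtain T F where TF: "(T, F) \<in> \<A>" "conn F T" "simple_graph (T, F)" "real (card F) > 9 / 7 * real (card T)"
    using dense_connected_member[OF A(1) G] by blast
  have le: "10 * card (edges H) \<le> 13 * card (verts H)" if "H \<in> \<A>" for H
    using critical_density_edges[OF A that] by (simp add: b)
  have "\<not> card F \<ge> card T + 3"
  proof
    assume "card F \<ge> card T + 3"
    from excess_three_dense[OF A(1) TF(1,2) this] obtain H where H: "H \<in> \<A>" "3 * card (edges H) \<ge> 4 * card (verts H)"
      by blast
    then show False
      using le[OF H(1)] simple_card_verts[OF class_simple[OF minor_closed_class[OF A(1)] H(1)]] by linarith
  qed
  then have "card F \<le> card T + 2" by simp
  moreover have F: "9 * card T < 7 * card F" using TF(4) by linarith
  moreover have F': "10 * card F \<le> 13 * card T" using le[OF TF(1)] by simp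
  moreover have "card T > 0" using simple_card_verts[OF TF(3)] by simp
  ultimately have "card T \<in> {1, 2, 3, 4, 5, 6}" by auto
  moreover have False if "9 * t < 7 * f" "10 * f \<le> 13 * t" "t \<in> {1, 2, 3, 4, 5, 6}" for t f :: nat
    using that(3) by (elim insertE emptyE) (use that(1,2) in presburger)+
  ultimately show False using F F' by blast
qed

section \<open>The class of minors of one connected graph\<close>

lemma small_graphs_of_edge:
  assumes A: "minor_closed \<A>" "G \<in> \<A>" "edges G \<noteq> {}" and H: "simple_graph H" "card (verts H) \<le> 2"
  shows "H \<in> \<A>"
proof -
  have gc: "graph_class \<A>" by (rule minor_closed_class[OF A(1)])
  have sG: "simple_graph G" by (rule class_simple[OF gc A(2)])
  obtain e where e: "e \<in> edges G" using A(3) by blast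
  then have ce: "card e = 2" "e \<subseteq> verts G" using simple_card_edge[OF sG] simple_edge_sub[OF sG] by auto
  have fe: "finite e" using ce(1) card.infinite by fastforce
  obtain f where f: "f ` verts H \<subseteq> e" "inj_on f (verts H)"
    using card_le_inj[of "verts H" e] H ce fe by (auto simp: simple_graph_def)
  let ?K = "(f ` verts H, (\<lambda>e. f ` e) ` edges H)"
  have iso: "graph_iso H ?K" by (rule graph_iso_image[OF f(2)])
  have sK: "simple_graph ?K" by (rule graph_iso_simple[OF iso H(1)])
  have "d = e" if "d \<in> edges ?K" for d
    using simple_edge_sub[OF sK that] simple_card_edge[OF sK that] f(1) ce(1) fe
    by (intro card_subset_eq) auto
  then have "edges ?K \<subseteq> ind (edges G) (verts ?K)" using simple_edge_sub[OF sK] e by (fastforce simp: ind_def)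
  moreover have "verts ?K \<subseteq> verts G" "verts ?K \<noteq> {}" using f(1) ce(2) sK by (auto simp: simple_graph_def)
  ultimately have "(verts ?K, edges ?K) \<in> \<A>" by (intro minor_closed_subgraph[OF A(1,2)])
  then show ?thesis using class_iso[OF gc _ graph_iso_sym[OF iso H(1)]] by simp
qed

text \<open>Since \<open>(V, E)\<close> is connected, branch sets of its minors can be taken to cover \<open>V\<close>;
  the deleted vertices are absorbed by neighbouring branch sets.\<close>

definition contraction_class :: "nat set \<Rightarrow> nat set set \<Rightarrow> nat graph set" where
  "contraction_class V E = {H. simple_graph H \<and>
     (\<exists>\<phi>. \<phi> ` V = verts H \<and> (\<forall>w\<in>verts H. conn E {x \<in> V. \<phi> x = w}) \<and> edges H \<subseteq> qedges E \<phi>)}"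

lemma conn_fibres_merge:
  assumes "\<forall>w\<in>\<phi> ` V. conn E {x \<in> V. \<phi> x = w}" and xy: "x \<in> V" "y \<in> V" "{x, y} \<in> E" "\<phi> x \<noteq> \<phi> y"
  shows "\<forall>w\<in>(collapse (\<phi> x) (\<phi> y) \<circ> \<phi>) ` V. conn E {z \<in> V. (collapse (\<phi> x) (\<phi> y) \<circ> \<phi>) z = w}"
proof
  let ?m = "collapse (\<phi> x) (\<phi> y)"
  fix w assume w: "w \<in> (?m \<circ> \<phi>) ` V"
  show "conn E {z \<in> V. (?m \<circ> \<phi>) z = w}"
  proof (cases "w = \<phi> x")
    case True
    have "conn E ({z \<in> V. \<phi> z = \<phi> x} \<union> {z \<in> V. \<phi> z = \<phi> y})"
      by (rule conn_Un_edge[of E _ _ x y]) (use assms in auto)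
    moreover have "{z \<in> V. \<phi> z = \<phi> x} \<union> {z \<in> V. \<phi> z = \<phi> y} = {z \<in> V. (?m \<circ> \<phi>) z = w}"
      using True by (auto simp: collapse_def)
    ultimately show ?thesis by simp
  next
    case False
    then have "w \<in> \<phi> ` V" "w \<noteq> \<phi> y" using w xy(4) by (auto simp: collapse_def split: if_splits)
    moreover from this have "{z \<in> V. (?m \<circ> \<phi>) z = w} = {z \<in> V. \<phi> z = w}" using False by (auto simp: collapse_def)
    ultimately show ?thesis using assms(1) by metis
  qed
qed

lemma contraction_class_minor_closed:
  assumes s: "simple_graph (V, E)" and c: "conn E V"
  shows "minor_closed (contraction_class V E)"
proof (rule minor_closedI)
  have cE: "\<And>e. e \<in> E \<Longrightarrow> card e = 2" using s by (simp add: simple_graph_def)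
  show "graph_class (contraction_class V E)"
    unfolding graph_class_def
  proof (intro conjI ballI allI impI)
    fix G H :: "nat graph" assume "G \<in> contraction_class V E" and iso: "graph_iso G H"
    then obtain \<phi> where sG: "simple_graph G" and \<phi>: "\<phi> ` V = verts G"
      "\<forall>w\<in>verts G. conn E {x \<in> V. \<phi> x = w}" "edges G \<subseteq> qedges E \<phi>"
      by (auto simp: contraction_class_def)
    obtain f where f: "inj_on f (verts G)" "H = (f ` verts G, (\<lambda>e. f ` e) ` edges G)"
      using graph_isoE[OF iso] by blast
    have sH: "simple_graph H" by (rule graph_iso_simple[OF iso sG])
    have "conn E {x \<in> V. (f \<circ> \<phi>) x = w}" if "w \<in> verts H" for w
    proof -
      obtain u where u: "u \<in> verts G" "w = f u" using \<open>w \<in> verts H\<close> unfolding f(2) by auto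
      then have "{x \<in> V. (f \<circ> \<phi>) x = w} = {x \<in> V. \<phi> x = u}"
        using f(1) \<phi>(1) by (auto simp: inj_on_def)
      then show ?thesis using \<phi>(2) u by simp
    qed
    moreover have "edges H \<subseteq> qedges (qedges E \<phi>) f"
      using \<phi>(3) f(2) simple_card_edge[OF sH] unfolding qedges_def[of "qedges E \<phi>"] by auto
    then have "edges H \<subseteq> qedges E (f \<circ> \<phi>)" by (simp add: qedges_qedges[OF cE])
    moreover have "(f \<circ> \<phi>) ` V = verts H" using \<phi>(1) f(2) by (simp only: image_comp[symmetric]) simp
    ultimately show "H \<in> contraction_class V E" using sH unfolding contraction_class_def by blast
  qed (simp add: contraction_class_def)
  fix G H assume G: "G \<in> contraction_class V E" and st: "minor_step G H"
  then obtain \<phi> where sG: "simple_graph G" and \<phi>: "\<phi> ` V = verts G"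
    "\<forall>w\<in>verts G. conn E {x \<in> V. \<phi> x = w}" "edges G \<subseteq> qedges E \<phi>"
    by (auto simp: contraction_class_def)
  have sH: "simple_graph H" by (rule minor_step_simple[OF st sG])
  have mg: "H \<in> contraction_class V E"
    if xy: "x \<in> V" "y \<in> V" "{x, y} \<in> E" "\<phi> x \<noteq> \<phi> y" and V: "verts H = verts G - {\<phi> y}"
      and E: "edges H \<subseteq> qedges (qedges E \<phi>) (collapse (\<phi> x) (\<phi> y))" for x y
  proof -
    let ?\<psi> = "collapse (\<phi> x) (\<phi> y) \<circ> \<phi>"
    have "?\<psi> ` V = collapse (\<phi> x) (\<phi> y) ` verts G" by (simp only: \<phi>(1)[symmetric] image_comp)
    also have "\<dots> = verts H" unfolding V using \<phi>(1) xy by (intro collapse_verts) auto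
    finally have V': "?\<psi> ` V = verts H" .
    moreover have "\<forall>w\<in>?\<psi> ` V. conn E {z \<in> V. ?\<psi> z = w}"
      using conn_fibres_merge[OF _ xy] \<phi>(1,2) by simp
    moreover have "edges H \<subseteq> qedges E ?\<psi>" using E by (simp add: qedges_qedges[OF cE])
    ultimately show ?thesis
      unfolding contraction_class_def mem_Collect_eq by (intro conjI sH exI[of _ ?\<psi>]) (simp_all only: V')
  qed
  show "H \<in> contraction_class V E"
    using st
  proof cases
    case (del_vert v)
    obtain p where p: "p \<in> V" "\<phi> p = v" using del_vert(2) \<phi>(1) by (metis imageE)
    obtain w where w: "w \<in> verts G" "w \<noteq> v" using del_vert(2,3) by auto
    then obtain q where q: "q \<in> V" "\<phi> q \<noteq> v" using \<phi>(1) by (metis imageE)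
    have "{x \<in> V. \<phi> x = v} \<noteq> {}" "{x \<in> V. \<phi> x = v} \<subset> V" using p q by auto
    from conn_ex[OF c this] obtain x y where xy: "x \<in> V" "\<phi> x = v" "y \<in> V" "\<phi> y \<noteq> v" "{x, y} \<in> E" by blast
    show ?thesis
    proof (rule mg[of y x])
      show "edges H \<subseteq> qedges (qedges E \<phi>) (collapse (\<phi> y) (\<phi> x))"
      proof
        fix e assume "e \<in> edges H"
        then have e: "e \<in> qedges E \<phi>" "v \<notin> e" using del_vert \<phi>(3) by (auto simp: delete_verts_def)
        have "collapse (\<phi> y) (\<phi> x) ` e = e" using e xy by (auto simp: collapse_def)
        then show "e \<in> qedges (qedges E \<phi>) (collapse (\<phi> y) (\<phi> x))"
          using e card_qedges[OF e(1)] by (auto simp: qedges_def[of "qedges E \<phi>"] intro!: image_eqI[of e _ e])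
      qed
    qed (use xy del_vert in \<open>auto simp: delete_verts_def insert_commute\<close>)
  next
    case (del_edge e)
    then have "edges H \<subseteq> qedges E \<phi>" "verts H = verts G" using \<phi>(3) by (auto simp: delete_edge_def)
    then show ?thesis using sH \<phi>(1,2) unfolding contraction_class_def by auto
  next
    case (contract u v)
    then have "{u, v} \<in> qedges E \<phi>" using \<phi>(3) by blast
    then obtain p q where pq: "{p, q} \<in> E" "{u, v} = {\<phi> p, \<phi> q}" "\<phi> p \<noteq> \<phi> q" using qedgesE[OF _ cE] by blast
    then obtain x y where xy: "{x, y} \<in> E" "\<phi> x = u" "\<phi> y = v"
      by (metis doubleton_eq_iff insert_commute)
    have xyV: "x \<in> V" "y \<in> V" using s xy(1) by (auto simp: simple_graph_def)
    show ?thesis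
      by (rule mg[of x y])
        (use xy xyV contract qedges_mono[OF \<phi>(3), of "collapse u v"] in \<open>auto simp: contract_edge_eq\<close>)
  qed
qed

lemma contraction_class_self:
  assumes "simple_graph (V, E)" shows "(V, E) \<in> contraction_class V E"
  unfolding contraction_class_def mem_Collect_eq
proof (intro conjI exI[of _ id])
  show "\<forall>w\<in>verts (V, E). conn E {x \<in> V. id x = w}"
  proof
    fix w assume "w \<in> verts (V, E)"
    then have "{x \<in> V. id x = w} = {w}" by auto
    then show "conn E {x \<in> V. id x = w}" by simp
  qed
  show "edges (V, E) \<subseteq> qedges E id" using assms by (auto simp: qedges_def simple_graph_def)
qed (use assms in auto)

section \<open>The value 23/10\<close>

text \<open>A triangle on \<open>0, 1, 2\<close> with four copies of \<open>K\<^sub>4\<close> glued along its edges: two along \<open>{0, 1}\<close>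
  and one along each of \<open>{1, 2}\<close> and \<open>{0, 2}\<close>.\<close>

definition gadget :: "nat \<Rightarrow> nat \<Rightarrow> nat \<Rightarrow> nat \<Rightarrow> nat set set" where
  "gadget x y a b = {{x, y}, {x, a}, {x, b}, {y, a}, {y, b}}"

definition K4_triangle_edges :: "nat set set" where
  "K4_triangle_edges = {{0, 1}, {1, 2}, {0, 2}} \<union> gadget 3 4 0 1 \<union> gadget 5 6 0 1 \<union> gadget 7 8 1 2 \<union> gadget 9 10 0 2"

definition K4_triangle :: "nat graph" where
  "K4_triangle = ({0, 1, 2, 3, 4, 5, 6, 7, 8, 9, 10}, K4_triangle_edges)"

lemma K4_triangle_simple: "simple_graph K4_triangle"
  by (simp add: simple_graph_def K4_triangle_def K4_triangle_edges_def gadget_def)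

lemma K4_triangle_card: "card (verts K4_triangle) = 11" "card (edges K4_triangle) = 23"
  by (simp_all add: K4_triangle_def K4_triangle_edges_def gadget_def doubleton_eq_iff)

lemma K4_triangle_connected: "conn K4_triangle_edges {0, 1, 2, 3, 4, 5, 6, 7, 8, 9, 10}"
proof -
  have ins: "conn K4_triangle_edges (insert y S)"
    if "x \<in> S" "{x, y} \<in> K4_triangle_edges" "conn K4_triangle_edges S" for x y S
    using conn_insert_edge[OF that(3,1,2)] .
  \<comment> \<open>The set is listed backwards, so that each use of \<open>ins\<close> strips its
    first element; the vertex named is a neighbour that is already present.\<close>
  have "conn K4_triangle_edges {10, 9, 8, 7, 6, 5, 4, 3, 2, 1, 0}"
    by (rule ins[of 2], simp, simp add: K4_triangle_edges_def gadget_def doubleton_eq_iff,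
        rule ins[of 2], simp, simp add: K4_triangle_edges_def gadget_def doubleton_eq_iff,
        rule ins[of 1], simp, simp add: K4_triangle_edges_def gadget_def doubleton_eq_iff,
        rule ins[of 1], simp, simp add: K4_triangle_edges_def gadget_def doubleton_eq_iff,
        rule ins[of 0], simp, simp add: K4_triangle_edges_def gadget_def doubleton_eq_iff,
        rule ins[of 0], simp, simp add: K4_triangle_edges_def gadget_def doubleton_eq_iff,
        rule ins[of 0], simp, simp add: K4_triangle_edges_def gadget_def doubleton_eq_iff,
        rule ins[of 0], simp, simp add: K4_triangle_edges_def gadget_def doubleton_eq_iff,
        rule ins[of 0], simp, simp add: K4_triangle_edges_def gadget_def doubleton_eq_iff,
        rule ins[of 0], simp, simp add: K4_triangle_edges_def gadget_def doubleton_eq_iff, simp)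
  moreover have "{10, 9, 8, 7, 6, 5, 4, 3, 2, 1, 0} = {0, 1, 2, 3, 4, 5, 6, 7, 8, 9, 10 :: nat}" by auto
  ultimately show ?thesis by simp
qed

text \<open>W and Q are the vertices and edges that the gadget adds to the image of its base edge
  ab. Each vertex of W accounts for two edges; d stands for a fifth edge, which needs x and y to
  survive separately and a, b to keep distinct images.\<close>

lemma gadget_quotient_edges:
  fixes \<phi> :: "nat \<Rightarrow> nat" and x y a b :: nat
  defines "W \<equiv> \<phi> ` {x, y} - \<phi> ` {a, b}" and "Q \<equiv> qedges (gadget x y a b) \<phi> - {\<phi> ` {a, b}}"
  shows "\<exists>d\<le>1. card Q \<le> 2 * card W + d \<and> 2 * d \<le> card W \<and> (\<phi> a = \<phi> b \<longrightarrow> d = 0)"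
proof -
  let ?p = "\<phi> x" and ?q = "\<phi> y" and ?r = "\<phi> a" and ?s = "\<phi> b"
  have Q: "Q = {e \<in> {{?p, ?q}, {?p, ?r}, {?p, ?s}, {?q, ?r}, {?q, ?s}}. card e = 2} - {{?r, ?s}}"
    by (auto simp: Q_def qedges_def gadget_def)
  have W: "W = {?p, ?q} - {?r, ?s}" by (auto simp: W_def)
  have le: "card Q \<le> card B" if "Q \<subseteq> B" "finite B" for B using card_mono that by blast
  have c2: "card {u, v} \<le> 2" for u v :: "nat set" by (simp add: card_insert_if)
  consider "?p \<in> {?r, ?s}" "?q \<in> {?r, ?s}"
    | "?p \<notin> {?r, ?s}" "?q \<in> {?r, ?s} \<or> ?q = ?p"
    | "?q \<notin> {?r, ?s}" "?p \<in> {?r, ?s}"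
    | "?p \<notin> {?r, ?s}" "?q \<notin> {?r, ?s}" "?p \<noteq> ?q" "?r = ?s"
    | "?p \<notin> {?r, ?s}" "?q \<notin> {?r, ?s}" "?p \<noteq> ?q" "?r \<noteq> ?s"
    by metis
  then show ?thesis
  proof cases
    case 1
    then have "Q \<subseteq> {}" unfolding Q by (auto simp: card_insert_if insert_commute split: if_splits)
    then show ?thesis using le[of "{}"] by (intro exI[of _ 0]) auto
  next
    case 2
    then have "Q \<subseteq> {{?p, ?r}, {?p, ?s}}" unfolding Q by (auto simp: card_insert_if insert_commute split: if_splits)
    moreover have "W = {?p}" unfolding W using 2 by auto
    ultimately show ?thesis using le[of "{{?p, ?r}, {?p, ?s}}"] c2[of "{?p, ?r}" "{?p, ?s}"]
      by (intro exI[of _ 0]) simp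
  next
    case 3
    then have "Q \<subseteq> {{?q, ?r}, {?q, ?s}}" unfolding Q by (auto simp: card_insert_if insert_commute split: if_splits)
    moreover have "W = {?q}" unfolding W using 3 by auto
    ultimately show ?thesis using le[of "{{?q, ?r}, {?q, ?s}}"] c2[of "{?q, ?r}" "{?q, ?s}"]
      by (intro exI[of _ 0]) simp
  next
    case 4
    then have "Q \<subseteq> {{?p, ?q}, {?p, ?r}, {?q, ?r}}" unfolding Q by auto
    moreover have "W = {?p, ?q}" unfolding W using 4 by auto
    moreover have "card {{?p, ?q}, {?p, ?r}, {?q, ?r}} \<le> 3" by (simp add: card_insert_if)
    ultimately show ?thesis using le[of "{{?p, ?q}, {?p, ?r}, {?q, ?r}}"] 4
      by (intro exI[of _ 0]) simp
  next
    case 5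
    let ?B = "{{?p, ?q}, {?p, ?r}, {?p, ?s}, {?q, ?r}, {?q, ?s}}"
    have "Q \<subseteq> ?B" unfolding Q by auto
    moreover have "W = {?p, ?q}" unfolding W using 5 by auto
    moreover have "card ?B \<le> 5" by (simp add: card_insert_if)
    ultimately show ?thesis using le[of ?B] 5 by (intro exI[of _ 1]) simp
  qed
qed

lemma K4_triangle_minor_edges:
  assumes "H \<in> contraction_class (verts K4_triangle) (edges K4_triangle)"
  shows "10 * card (edges H) + 23 \<le> 23 * card (verts H)"
proof -
  let ?V = "verts K4_triangle" and ?E = K4_triangle_edges
  obtain \<phi> where sH: "simple_graph H" and \<phi>: "\<phi> ` ?V = verts H"
    "\<And>w. w \<in> verts H \<Longrightarrow> conn ?E {x \<in> ?V. \<phi> x = w}" "edges H \<subseteq> qedges ?E \<phi>"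
    using assms by (auto simp: contraction_class_def K4_triangle_def)
  define W where "W = (\<lambda>x y a b. \<phi> ` {x, y} - \<phi> ` {a, b :: nat})"
  define Q where "Q = (\<lambda>x y a b. qedges (gadget x y a b) \<phi> - {\<phi> ` {a, b}})"
  \<comment> \<open>A branch set of a vertex in W cannot leave {x, y}: it could do so only through a
    or b, whose images are not in W. Hence the four sets W and the image of the triangle are
    pairwise disjoint.\<close>
  have fib: "z \<in> {x, y}"
    if nb: "\<And>u v. u \<in> {x, y} \<Longrightarrow> {u, v} \<in> ?E \<Longrightarrow> v \<in> {x, y, a, b}" and xy: "{x, y, a, b} \<subseteq> ?V"
      and w: "w \<in> W x y a b" and z: "z \<in> ?V" "\<phi> z = w" for x y a b z w
  proof (rule ccontr)
    assume nz: "z \<notin> {x, y}"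
    let ?F = "{u \<in> ?V. \<phi> u = w}"
    have "w \<in> verts H" using z \<phi>(1) by blast
    moreover have "?F \<inter> {x, y} \<noteq> {}" using w xy by (auto simp: W_def)
    moreover have "?F \<inter> {x, y} \<subset> ?F" using z nz by blast
    ultimately obtain u v where uv: "u \<in> {x, y}" "v \<in> ?F - (?F \<inter> {x, y})" "{u, v} \<in> ?E"
      using conn_ex[OF \<phi>(2), of w "?F \<inter> {x, y}"] by auto
    then have "v \<in> {a, b}" using nb by blast
    then show False using uv(2) w by (auto simp: W_def)
  qed
  have nb1: "v \<in> {3, 4, 0, 1}" if "u \<in> {3, 4}" "{u, v} \<in> ?E" for u v
    using that by (auto simp: K4_triangle_edges_def gadget_def doubleton_eq_iff)
  have nb2: "v \<in> {5, 6, 0, 1}" if "u \<in> {5, 6}" "{u, v} \<in> ?E" for u v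
    using that by (auto simp: K4_triangle_edges_def gadget_def doubleton_eq_iff)
  have nb3: "v \<in> {7, 8, 1, 2}" if "u \<in> {7, 8}" "{u, v} \<in> ?E" for u v
    using that by (auto simp: K4_triangle_edges_def gadget_def doubleton_eq_iff)
  have nb4: "v \<in> {9, 10, 0, 2}" if "u \<in> {9, 10}" "{u, v} \<in> ?E" for u v
    using that by (auto simp: K4_triangle_edges_def gadget_def doubleton_eq_iff)
  define W1 W2 W3 W4 where Ws: "W1 = W 3 4 0 1" "W2 = W 5 6 0 1" "W3 = W 7 8 1 2" "W4 = W 9 10 0 2"
  define Q1 Q2 Q3 Q4 where Qs: "Q1 = Q 3 4 0 1" "Q2 = Q 5 6 0 1" "Q3 = Q 7 8 1 2" "Q4 = Q 9 10 0 2"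
  have f1: "z \<in> {3, 4}" if "w \<in> W1" "z \<in> ?V" "\<phi> z = w" for z w
    using fib[OF nb1, where w = w and z = z] that by (simp add: Ws K4_triangle_def)
  have f2: "z \<in> {5, 6}" if "w \<in> W2" "z \<in> ?V" "\<phi> z = w" for z w
    using fib[OF nb2, where w = w and z = z] that by (simp add: Ws K4_triangle_def)
  have f3: "z \<in> {7, 8}" if "w \<in> W3" "z \<in> ?V" "\<phi> z = w" for z w
    using fib[OF nb3, where w = w and z = z] that by (simp add: Ws K4_triangle_def)
  have f4: "z \<in> {9, 10}" if "w \<in> W4" "z \<in> ?V" "\<phi> z = w" for z w
    using fib[OF nb4, where w = w and z = z] that by (simp add: Ws K4_triangle_def)
  define S where "S = \<phi> ` {0, 1, 2}"
  have sub: "S \<union> W1 \<union> W2 \<union> W3 \<union> W4 \<subseteq> verts H"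
    unfolding \<phi>(1)[symmetric] S_def Ws W_def K4_triangle_def by auto
  have wit: "\<exists>z\<in>?V. \<phi> z = w" if "w \<in> S \<union> W1 \<union> W2 \<union> W3 \<union> W4" for w
  proof -
    have "w \<in> verts H" using sub that by (rule subsetD)
    then have "w \<in> \<phi> ` ?V" by (simp only: \<phi>(1))
    then show ?thesis by (auto simp: image_iff)
  qed
  have Swit: "\<exists>z\<in>{0, 1, 2}. \<phi> z = w" if "w \<in> S" for w using that by (auto simp: S_def)
  have inV: "{0, 1, 2} \<subseteq> ?V" by (simp add: K4_triangle_def)
  have dS: "w \<notin> W1 \<and> w \<notin> W2 \<and> w \<notin> W3 \<and> w \<notin> W4" if "w \<in> S" for w
  proof -
    obtain z where z: "z \<in> {0, 1, 2}" "\<phi> z = w" using Swit[OF \<open>w \<in> S\<close>] by blast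
    then have "z \<in> ?V" using inV by blast
    then show ?thesis using f1[of w z] f2[of w z] f3[of w z] f4[of w z] z by auto
  qed
  have dW: "\<not> (w \<in> W1 \<and> w \<in> W2)" "\<not> (w \<in> W1 \<and> w \<in> W3)" "\<not> (w \<in> W1 \<and> w \<in> W4)"
    "\<not> (w \<in> W2 \<and> w \<in> W3)" "\<not> (w \<in> W2 \<and> w \<in> W4)" "\<not> (w \<in> W3 \<and> w \<in> W4)" for w
    using f1[of w] f2[of w] f3[of w] f4[of w] wit[of w] by fastforce+
  have fin: "finite S" "finite W1" "finite W2" "finite W3" "finite W4"
    by (simp_all add: S_def Ws W_def)
  have "card (S \<union> W1 \<union> W2 \<union> W3 \<union> W4) = card S + card W1 + card W2 + card W3 + card W4"
  proof -
    have "S \<inter> W1 = {}" "(S \<union> W1) \<inter> W2 = {}" "(S \<union> W1 \<union> W2) \<inter> W3 = {}"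
      "(S \<union> W1 \<union> W2 \<union> W3) \<inter> W4 = {}"
      using dS dW by blast+
    then show ?thesis using fin by (simp add: card_Un_disjoint)
  qed
  then have vH: "card S + card W1 + card W2 + card W3 + card W4 \<le> card (verts H)"
    using card_mono[OF _ sub] sH by (simp add: simple_graph_def)
  define K where "K = qedges {{0, 1}, {1, 2}, {0, 2}} \<phi>"
  \<comment> \<open>The image of a base edge is counted once, in K, and not in the gadgets.\<close>
  have part: "qedges (gadget x y a b) \<phi> \<subseteq> Q x y a b \<union> K" if "{a, b} \<in> {{0, 1}, {1, 2}, {0, 2}}" for x y a b
  proof
    fix e assume e: "e \<in> qedges (gadget x y a b) \<phi>"
    show "e \<in> Q x y a b \<union> K"
    proof (cases "e = \<phi> ` {a, b}")
      case True
      then have "e \<in> K"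
        unfolding K_def qedges_def mem_Collect_eq 
        by (intro conjI image_eqI[of e "\<lambda>e. \<phi> ` e" "{a, b}"] True that card_qedges[OF e])
      then show ?thesis by simp
    next
      case False
      then show ?thesis using e by (simp add: Q_def)
    qed
  qed
  have "qedges ?E \<phi> \<subseteq> K \<union> Q1 \<union> Q2 \<union> Q3 \<union> Q4"
    using part[of 0 1 3 4] part[of 0 1 5 6] part[of 1 2 7 8] part[of 0 2 9 10]
    unfolding K4_triangle_edges_def qedges_Un Qs K_def[symmetric] by blast
  moreover have "finite K" "finite Q1" "finite Q2" "finite Q3" "finite Q4"
    by (simp_all add: K_def Qs Q_def finite_qedges gadget_def)
  ultimately have "card (edges H) \<le> card (K \<union> Q1 \<union> Q2 \<union> Q3 \<union> Q4)"
    using \<phi>(3) by (intro card_mono) auto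
  also have "\<dots> \<le> card K + card Q1 + card Q2 + card Q3 + card Q4"
    by (intro order_trans[OF card_Un_le] add_mono order_refl)
  finally have eH: "card (edges H) \<le> card K + card Q1 + card Q2 + card Q3 + card Q4" .
  obtain d1 where d1: "d1 \<le> 1" "card Q1 \<le> 2 * card W1 + d1" "2 * d1 \<le> card W1" "\<phi> 0 = \<phi> 1 \<longrightarrow> d1 = 0"
    using gadget_quotient_edges[where \<phi> = \<phi> and x = 3 and y = 4 and a = 0 and b = 1] unfolding Qs Q_def Ws W_def by blast
  obtain d2 where d2: "d2 \<le> 1" "card Q2 \<le> 2 * card W2 + d2" "2 * d2 \<le> card W2" "\<phi> 0 = \<phi> 1 \<longrightarrow> d2 = 0"
    using gadget_quotient_edges[where \<phi> = \<phi> and x = 5 and y = 6 and a = 0 and b = 1] unfolding Qs Q_def Ws W_def by blast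
  obtain d3 where d3: "d3 \<le> 1" "card Q3 \<le> 2 * card W3 + d3" "2 * d3 \<le> card W3" "\<phi> 1 = \<phi> 2 \<longrightarrow> d3 = 0"
    using gadget_quotient_edges[where \<phi> = \<phi> and x = 7 and y = 8 and a = 1 and b = 2] unfolding Qs Q_def Ws W_def by blast
  obtain d4 where d4: "d4 \<le> 1" "card Q4 \<le> 2 * card W4 + d4" "2 * d4 \<le> card W4" "\<phi> 0 = \<phi> 2 \<longrightarrow> d4 = 0"
    using gadget_quotient_edges[where \<phi> = \<phi> and x = 9 and y = 10 and a = 0 and b = 2] unfolding Qs Q_def Ws W_def by blast
  have K: "K = {e \<in> {{\<phi> 0, \<phi> 1}, {\<phi> 1, \<phi> 2}, {\<phi> 0, \<phi> 2}}. card e = 2}"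
    by (auto simp: K_def qedges_def)
  consider "\<phi> 0 \<noteq> \<phi> 1" "\<phi> 1 \<noteq> \<phi> 2" "\<phi> 0 \<noteq> \<phi> 2" | "\<phi> 0 = \<phi> 1" "\<phi> 1 = \<phi> 2"
    | "\<phi> 0 = \<phi> 1" "\<phi> 1 \<noteq> \<phi> 2" | "\<phi> 0 \<noteq> \<phi> 1" "\<phi> 1 = \<phi> 2" | "\<phi> 0 = \<phi> 2" "\<phi> 1 \<noteq> \<phi> 2" by metis
  then show ?thesis
  proof cases
    case 1
    have "K \<subseteq> {{\<phi> 0, \<phi> 1}, {\<phi> 1, \<phi> 2}, {\<phi> 0, \<phi> 2}}" unfolding K by blast
    then have "card K \<le> card {{\<phi> 0, \<phi> 1}, {\<phi> 1, \<phi> 2}, {\<phi> 0, \<phi> 2}}" by (intro card_mono) auto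
    also have "\<dots> \<le> 3" by (simp add: card_insert_if)
    finally have "card K \<le> 3" .
    moreover have "card S = 3" using 1 by (simp add: S_def)
    \<comment> \<open>With w the total size of the four sets W and D the sum of the four d, the
      claim reduces to 10 D \<le> 16 + 3 w. By w \<ge> 2 D it follows from D \<le> 4, with equality
      at D = 4 and w = 8: this is why four copies of K4 are glued on.\<close>
    ultimately show ?thesis using vH eH d1 d2 d3 d4 by linarith
  next
    case 2
    then have "K = {}" by (auto simp: K)
    moreover have "card S = 1" using 2 by (simp add: S_def)
    ultimately show ?thesis using vH eH d1 d2 d3 d4 2 by simp
  next
    case 3
    then have "K \<subseteq> {{\<phi> 1, \<phi> 2}}" by (auto simp: K)
    then have "card K \<le> 1" using card_mono[of "{{\<phi> 1, \<phi> 2}}" K] by simp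
    moreover have "card S = 2" using 3 by (simp add: S_def)
    ultimately show ?thesis using vH eH d1 d2 d3 d4 3 by simp
  next
    case 4
    then have "K \<subseteq> {{\<phi> 0, \<phi> 1}}" by (auto simp: K)
    then have "card K \<le> 1" using card_mono[of "{{\<phi> 0, \<phi> 1}}" K] by simp
    moreover have "card S = 2" using 4 by (simp add: S_def)
    ultimately show ?thesis using vH eH d1 d2 d3 d4 4 by simp
  next
    case 5
    then have "K \<subseteq> {{\<phi> 1, \<phi> 2}}" by (auto simp: K insert_commute)
    then have "card K \<le> 1" using card_mono[of "{{\<phi> 1, \<phi> 2}}" K] by simp
    moreover have "card S = 2" using 5 by (simp add: S_def insert_commute)
    ultimately show ?thesis using vH eH d1 d2 d3 d4 5 by simp
  qed
qed

text \<open>\<open>K4_triangle\<close> itself has e = 23 and v - 1 = 10, and no minor has a larger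
  ratio e / (v - 1).\<close>

lemma twenty_three_tenths_critical2: "23 / 10 \<in> critical_densities2"
proof (rule critical_densities2I)
  let ?C = "contraction_class (verts K4_triangle) (edges K4_triangle)"
  have s: "simple_graph (verts K4_triangle, edges K4_triangle)" using K4_triangle_simple by simp
  have self: "K4_triangle \<in> ?C" using contraction_class_self[OF s] by simp
  show mc: "minor_closed ?C"
    by (rule contraction_class_minor_closed[OF s]) (use K4_triangle_connected in \<open>simp add: K4_triangle_def\<close>)
  show "G \<in> ?C" if "simple_graph G" "card (verts G) \<le> 2" for G
    by (rule small_graphs_of_edge[OF mc self _ that]) (use K4_triangle_card in force)
  show "real (card (edges G)) \<le> 23 / 10 * (real (card (verts G)) - 1)" if "G \<in> ?C" for G
  proof -
    have "real (10 * card (edges G) + 23) \<le> real (23 * card (verts G))"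
      using K4_triangle_minor_edges[OF that] by (simp only: of_nat_le_iff)
    then show ?thesis by simp
  qed
  show "\<exists>G\<in>?C. y * (real (card (verts G)) - 1) < real (card (edges G))" if "y < 23 / 10" for y
    using that self K4_triangle_card by (intro bexI[of _ K4_triangle]) auto
qed simp

section \<open>Rich sets\<close>

text \<open>\<open>S\<close> has a connected quotient with \<open>v > m\<close> vertices and at least \<open>c (v - 1)\<close> edges. Rich sets can be
  amalgamated at single vertices, which adds their quotients up.\<close>

definition rich :: "'a set set \<Rightarrow> real \<Rightarrow> 'a set \<Rightarrow> nat \<Rightarrow> bool" where
  "rich E c S m \<longleftrightarrow> (\<exists>\<phi>. qmap E S \<phi> \<and> card (\<phi> ` S) > m \<and>
     real (card (qe E S \<phi>)) \<ge> c * (real (card (\<phi> ` S)) - 1))"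

lemma finite_qe: "finite S \<Longrightarrow> finite (qe E S \<phi>)"
  by (simp add: finite_qedges finite_ind)

text \<open>The default value 0: one part and no edge, so both sides of the bound vanish.\<close>

lemma rich_sing: "rich E c {x} 0"
  unfolding rich_def by (intro exI[of _ id]) (auto simp: qmap_def)

text \<open>A quotient extends to a connected superset without new quotient vertices, and edges can
  only be gained.\<close>

lemma rich_mono:
  assumes "rich E c S m" "finite T" "conn E T" "S \<subseteq> T" "S \<noteq> {}"
  shows "rich E c T m"
proof -
  obtain \<phi> where \<phi>: "qmap E S \<phi>" "card (\<phi> ` S) > m" "real (card (qe E S \<phi>)) \<ge> c * (real (card (\<phi> ` S)) - 1)"
    using assms(1) by (auto simp: rich_def)
  obtain \<psi> where \<psi>: "qmap E T \<psi>" "\<And>x. x \<in> S \<Longrightarrow> \<psi> x = \<phi> x" "\<psi> ` T = \<phi> ` S"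
    using qmap_extend[OF assms(2-5) \<phi>(1)] by blast
  have "card (qe E S \<phi>) \<le> card (qe E T \<psi>)"
    by (rule card_mono[OF finite_qe[OF assms(2)] qe_mono[OF assms(4) \<psi>(2)]])
  then show ?thesis using \<phi> \<psi> unfolding rich_def by (intro exI[of _ \<psi>]) auto
qed

lemma rich_zero: "finite S \<Longrightarrow> conn E S \<Longrightarrow> rich E c S 0"
  using rich_mono[OF rich_sing] conn_nonempty by (metis empty_subsetI ex_in_conv insert_not_empty insert_subset)

text \<open>The two quotients are glued along the part of r. They share this single vertex, so their
  edges add up, and so do their values of v - 1.\<close>

lemma rich_overlap:
  assumes fin: "finite S" "finite T" and r: "S \<inter> T = {r}"
    and S: "rich E c S m" and T: "rich E c T n"
  shows "rich E c (S \<union> T) (m + n)"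
proof -
  obtain \<phi> where \<phi>: "qmap E S \<phi>" "card (\<phi> ` S) > m" "real (card (qe E S \<phi>)) \<ge> c * (real (card (\<phi> ` S)) - 1)"
    using S by (auto simp: rich_def)
  obtain \<psi> where \<psi>: "qmap E T \<psi>" "card (\<psi> ` T) > n" "real (card (qe E T \<psi>)) \<ge> c * (real (card (\<psi> ` T)) - 1)"
    using T by (auto simp: rich_def)
  have rS: "r \<in> S" "r \<in> T" using r by auto
  have p: "\<phi> x \<in> S" "\<phi> (\<phi> x) = \<phi> x" "conn E {y \<in> S. \<phi> y = \<phi> x}" if "x \<in> S" for x
    using \<phi>(1) that by (auto simp: qmap_def)
  have q: "\<psi> x \<in> T" "\<psi> (\<psi> x) = \<psi> x" "conn E {y \<in> T. \<psi> y = \<psi> x}" if "x \<in> T" for x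
    using \<psi>(1) that by (auto simp: qmap_def)
  \<comment> \<open>The part of r may have different representatives under \<phi> and \<psi>;
    \<sigma> renames the one of \<psi>, so that both maps agree at r.\<close>
  define \<sigma> where "\<sigma> = (\<lambda>w. if w = \<psi> r then \<phi> r else w)"
  define \<theta> where "\<theta> = (\<lambda>x. if x \<in> S then \<phi> x else \<sigma> (\<psi> x))"
  have \<theta>S: "\<theta> x = \<phi> x" if "x \<in> S" for x using that by (simp add: \<theta>_def)
  have \<theta>T: "\<theta> x = \<sigma> (\<psi> x)" if "x \<in> T" for x
    using that r by (cases "x \<in> S") (auto simp: \<theta>_def \<sigma>_def)
  \<comment> \<open>A representative of \<psi> lying in S would be r itself, and idempotence then
    puts x into the part of r.\<close>
  have out: "\<psi> x \<notin> S" if "x \<in> T" "\<psi> x \<noteq> \<psi> r" for x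
    using q[OF that(1)] that(2) r by (metis IntI singletonD)
  have inj: "inj_on \<sigma> (\<psi> ` T)"
  proof -
    have "\<psi> x \<noteq> \<phi> r" if "x \<in> T" "\<psi> x \<noteq> \<psi> r" for x using out[OF that] p(1)[OF rS(1)] by auto
    then show ?thesis unfolding inj_on_def \<sigma>_def by (auto simp: eq_commute[of "\<phi> r"])
  qed
  have im: "\<sigma> ` \<psi> ` T \<inter> S \<subseteq> {\<phi> r}" using out by (auto simp: \<sigma>_def)
  have qmS: "\<theta> x \<in> S \<union> T \<and> \<theta> (\<theta> x) = \<theta> x \<and> conn E {y \<in> S \<union> T. \<theta> y = \<theta> x}" if x: "x \<in> S" for x
  proof -
    have "conn E {y \<in> S \<union> T. \<theta> y = \<theta> x}"
    proof (cases "\<phi> x = \<phi> r")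
      case True
      have "conn E ({y \<in> S. \<phi> y = \<phi> r} \<union> {y \<in> T. \<psi> y = \<psi> r})"
        by (rule conn_Un_edge[OF p(3)[OF rS(1)] q(3)[OF rS(2)], of r r]) (use rS in auto)
      moreover have "\<theta> y = \<phi> r \<longleftrightarrow> \<psi> y = \<psi> r" if "y \<in> T" for y
        using \<theta>T[OF that] out[OF that] p(1)[OF rS(1)] by (auto simp: \<sigma>_def)
      then have "{y \<in> S \<union> T. \<theta> y = \<phi> r} = {y \<in> S. \<phi> y = \<phi> r} \<union> {y \<in> T. \<psi> y = \<psi> r}"
        using \<theta>S by auto
      ultimately show ?thesis using True x by (simp add: \<theta>S)
    next
      case False
      have "\<theta> y \<noteq> \<phi> x" if "y \<in> T" "y \<notin> S" for y
      proof
        assume "\<theta> y = \<phi> x"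
        then have "\<phi> x \<in> \<sigma> ` \<psi> ` T \<inter> S" using \<theta>T[OF that(1)] that(1) p(1)[OF x] by (metis IntI imageI)
        then show False using im False by blast
      qed
      then have "{y \<in> S \<union> T. \<theta> y = \<theta> x} = {y \<in> S. \<phi> y = \<phi> x}"
        using x \<theta>S by (metis (lifting) Un_iff)
      then show ?thesis using p(3)[OF x] by simp
    qed
    then show ?thesis using x p[OF x] by (simp add: \<theta>S)
  qed
  have qm: "qmap E (S \<union> T) \<theta>"
    unfolding qmap_def
  proof
    fix x assume x: "x \<in> S \<union> T"
    show "\<theta> x \<in> S \<union> T \<and> \<theta> (\<theta> x) = \<theta> x \<and> conn E {y \<in> S \<union> T. \<theta> y = \<theta> x}"
    proof (cases "x \<in> S \<or> \<psi> x = \<psi> r")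
      case True
      then obtain x' where "x' \<in> S" "\<theta> x' = \<theta> x" using rS by (metis \<theta>S \<theta>_def \<sigma>_def)
      then show ?thesis using qmS by metis
    next
      case False
      then have xT: "x \<in> T" "x \<notin> S" and ne: "\<psi> x \<noteq> \<psi> r" using x by auto
      have \<theta>x: "\<theta> x = \<psi> x" using xT ne by (simp add: \<theta>_def \<sigma>_def)
      have "\<theta> (\<psi> x) = \<psi> x" using \<theta>T[OF q(1)[OF xT(1)]] q(2)[OF xT(1)] ne by (simp add: \<sigma>_def)
      moreover have "{y \<in> S \<union> T. \<theta> y = \<psi> x} = {y \<in> T. \<psi> y = \<psi> x}"
      proof -
        have "\<theta> y \<noteq> \<psi> x" if "y \<in> S" for y using that p(1) out[OF xT(1) ne] by (metis \<theta>S)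
        moreover have "\<theta> y = \<psi> x \<longleftrightarrow> \<psi> y = \<psi> x" if "y \<in> T" for y
          using \<theta>T[OF that] ne inj that xT(1) out[OF xT(1) ne] p(1)[OF rS(1)] by (auto simp: \<sigma>_def)
        ultimately show ?thesis by auto
      qed
      ultimately show ?thesis using q[OF xT(1)] \<theta>x by simp
    qed
  qed
  have img: "\<theta> ` (S \<union> T) = \<phi> ` S \<union> \<sigma> ` \<psi> ` T"
    using \<theta>S \<theta>T by (auto simp: image_Un image_image)
  have "\<phi> ` S \<inter> \<sigma> ` \<psi> ` T = {\<phi> r}"
  proof
    show "\<phi> ` S \<inter> \<sigma> ` \<psi> ` T \<subseteq> {\<phi> r}" using im p(1) by blast
    have "\<phi> r = \<sigma> (\<psi> r)" by (simp add: \<sigma>_def)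
    then show "{\<phi> r} \<subseteq> \<phi> ` S \<inter> \<sigma> ` \<psi> ` T" using rS by blast
  qed
  then have cv: "card (\<theta> ` (S \<union> T)) + 1 = card (\<phi> ` S) + card (\<psi> ` T)"
    using card_Un_Int[of "\<phi> ` S" "\<sigma> ` \<psi> ` T"] fin card_image[OF inj] by (simp add: img)
  have sub2: "(\<lambda>e. \<sigma> ` e) ` qe E T \<psi> \<subseteq> qe E (S \<union> T) \<theta>"
  proof
    fix e assume "e \<in> (\<lambda>e. \<sigma> ` e) ` qe E T \<psi>"
    then obtain d where d: "d \<in> ind E T" "card (\<psi> ` d) = 2" "e = \<sigma> ` \<psi> ` d" by (auto simp: qedges_def)
    have dT: "d \<subseteq> T" using d(1) by (simp add: ind_def)
    have "card e = 2" using d(2,3) card_image[OF inj_on_subset[OF inj image_mono[OF dT]]] by simp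
    moreover have "e = \<theta> ` d" unfolding d(3) image_image using dT \<theta>T by (intro image_cong) auto
    moreover have "d \<in> ind E (S \<union> T)" using d(1) by (auto simp: ind_def)
    ultimately show "e \<in> qe E (S \<union> T) \<theta>" by (auto simp: qedges_def)
  qed
  have sub1: "qe E S \<phi> \<subseteq> qe E (S \<union> T) \<theta>" by (rule qe_mono) (auto simp: \<theta>S)
  have eS: "e \<subseteq> S" if "e \<in> qe E S \<phi>" for e
    using qedges_sub[of "ind E S" S e \<phi>] that p(1) by (auto simp: ind_def)
  have eT: "e \<subseteq> \<psi> ` T" if "e \<in> qe E T \<psi>" for e
    using qedges_sub[of "ind E T" T e \<psi>] that by (auto simp: ind_def)
  have disj: "qe E S \<phi> \<inter> (\<lambda>e. \<sigma> ` e) ` qe E T \<psi> = {}"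
  proof -
    have False if e: "e \<in> qe E S \<phi>" "e = \<sigma> ` d" "d \<in> qe E T \<psi>" for e d
    proof -
      have "e \<subseteq> {\<phi> r}" using eS[OF e(1)] eT[OF e(3)] e(2) im by blast
      then have "card e \<le> 1" using card_mono[of "{\<phi> r}" e] by simp
      then show False using card_qedges[OF e(1)] by simp
    qed
    then show ?thesis by blast
  qed
  have "inj_on (\<lambda>e. \<sigma> ` e) (qe E T \<psi>)"
    by (rule inj_on_subset[OF inj_on_image_Pow[OF inj]]) (use eT in blast)
  then have "card (qe E S \<phi>) + card (qe E T \<psi>) = card (qe E S \<phi> \<union> (\<lambda>e. \<sigma> ` e) ` qe E T \<psi>)"
    using fin disj by (subst card_Un_disjoint) (auto simp: finite_qe card_image)
  also have "\<dots> \<le> card (qe E (S \<union> T) \<theta>)" using fin sub1 sub2 by (intro card_mono finite_qe) auto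
  finally have ce: "card (qe E S \<phi>) + card (qe E T \<psi>) \<le> card (qe E (S \<union> T) \<theta>)" .
  have "real (card (\<theta> ` (S \<union> T))) - 1 = (real (card (\<phi> ` S)) - 1) + (real (card (\<psi> ` T)) - 1)"
    using cv by linarith
  then have "c * (real (card (\<theta> ` (S \<union> T))) - 1) = c * (real (card (\<phi> ` S)) - 1) + c * (real (card (\<psi> ` T)) - 1)"
    by (simp only: distrib_left)
  then have "c * (real (card (\<theta> ` (S \<union> T))) - 1) \<le> real (card (qe E (S \<union> T) \<theta>))"
    using \<phi>(3) \<psi>(3) ce by linarith
  \<comment> \<open>The two strict inequalities make up for the vertex lost by gluing.\<close>
  moreover have "card (\<theta> ` (S \<union> T)) > m + n" using cv \<phi>(2) \<psi>(2) by linarith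
  ultimately show ?thesis using qm unfolding rich_def by blast
qed

text \<open>The vertex a is absorbed into a part of T, after which the two sets overlap exactly in
  a.\<close>

lemma rich_adjacent:
  assumes "finite S" "finite T" "S \<inter> T = {}" "a \<in> S" "b \<in> T" "{a, b} \<in> E" "conn E T"
    and "rich E c S m" "rich E c T n"
  shows "rich E c (S \<union> T) (m + n)"
proof -
  have "conn E (insert a T)"
    by (rule conn_insert_edge[OF assms(7,5)]) (use assms(6) in \<open>simp add: insert_commute\<close>)
  then have "rich E c (insert a T) n"
    using rich_mono[OF assms(9)] assms(2,5) by blast
  then have "rich E c (S \<union> insert a T) (m + n)"
    using assms by (intro rich_overlap[of _ _ a]) auto
  moreover have "S \<union> insert a T = S \<union> T" using assms(4) by auto
  ultimately show ?thesis by simp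
qed

text \<open>Parts are added one at a time along edges of the connected set V; a maximal subfamily
  with connected and suitably rich union is the whole family.\<close>

lemma rich_partition:
  assumes fin: "finite V" and V: "conn E V" and un: "\<Union>\<P> = V"
    and dis: "\<And>P Q. P \<in> \<P> \<Longrightarrow> Q \<in> \<P> \<Longrightarrow> P \<noteq> Q \<Longrightarrow> P \<inter> Q = {}"
    and conn: "\<And>P. P \<in> \<P> \<Longrightarrow> conn E P" and rich: "\<And>P. P \<in> \<P> \<Longrightarrow> rich E c P (m P)"
  shows "rich E c V (\<Sum>P\<in>\<P>. m P)"
proof -
  have finP: "finite \<P>" using fin un finite_UnionD by blast
  define \<F> where "\<F> = {\<Q>. \<Q> \<subseteq> \<P> \<and> \<Q> \<noteq> {} \<and> conn E (\<Union>\<Q>) \<and> rich E c (\<Union>\<Q>) (\<Sum>P\<in>\<Q>. m P)}"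
  have "finite \<F>" unfolding \<F>_def using finP by (auto intro: finite_subset[of _ "Pow \<P>"])
  moreover obtain P0 where P0: "P0 \<in> \<P>" using un conn_nonempty[OF V] by blast
  then have "{P0} \<in> \<F>" using conn rich by (simp add: \<F>_def)
  ultimately obtain \<Q> where \<Q>: "\<Q> \<in> \<F>" and mx: "\<And>\<R>. \<R> \<in> \<F> \<Longrightarrow> \<Q> \<subseteq> \<R> \<Longrightarrow> \<R> = \<Q>"
    using finite_has_maximal[of \<F>] by (metis empty_iff)
  have \<Q>': "\<Q> \<subseteq> \<P>" "\<Q> \<noteq> {}" "conn E (\<Union>\<Q>)" "rich E c (\<Union>\<Q>) (\<Sum>P\<in>\<Q>. m P)"
    using \<Q> by (auto simp: \<F>_def)
  have "\<Union>\<Q> = V"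
  proof (rule ccontr)
    assume "\<Union>\<Q> \<noteq> V"
    then have "\<Union>\<Q> \<subset> V" using \<Q>'(1) un by blast
    from conn_ex[OF V conn_nonempty[OF \<Q>'(3)] this] obtain x y where
      xy: "x \<in> \<Union>\<Q>" "y \<in> V - \<Union>\<Q>" "{x, y} \<in> E" by blast
    then obtain P where P: "P \<in> \<P>" "y \<in> P" "P \<notin> \<Q>" using un by blast
    have d: "\<Union>\<Q> \<inter> P = {}" using dis P \<Q>'(1) by blast
    have "conn E (\<Union>\<Q> \<union> P)" using conn_Un_edge[OF \<Q>'(3) conn[OF P(1)] xy(1) P(2)] xy(3) by blast
    moreover have "rich E c (\<Union>\<Q> \<union> P) ((\<Sum>P\<in>\<Q>. m P) + m P)"
    proof (rule rich_adjacent[OF _ _ d xy(1) P(2) xy(3) conn[OF P(1)] \<Q>'(4) rich[OF P(1)]])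
      show "finite (\<Union>\<Q>)" by (rule finite_subset[OF _ fin]) (use un \<Q>'(1) in blast)
      show "finite P" by (rule finite_subset[OF _ fin]) (use un P(1) in blast)
    qed
    moreover have "(\<Sum>P\<in>insert P \<Q>. m P) = (\<Sum>P\<in>\<Q>. m P) + m P"
      using P(3) finite_subset[OF \<Q>'(1) finP] by simp
    ultimately have "insert P \<Q> \<in> \<F>" using P \<Q>' by (simp add: \<F>_def Un_commute)
    from mx[OF this] P(3) show False by blast
  qed
  moreover have "\<Q> = \<P>"
  proof -
    have "P \<in> \<Q>" if P: "P \<in> \<P>" for P
    proof -
      obtain x where "x \<in> P" using conn_nonempty[OF conn[OF P]] by blast
      moreover from this obtain Q where "Q \<in> \<Q>" "x \<in> Q" using \<open>\<Union>\<Q> = V\<close> un P by blast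
      ultimately show ?thesis using dis[of P Q] P \<Q>'(1) by blast
    qed
    then show ?thesis using \<Q>'(1) by blast
  qed
  ultimately show ?thesis using \<Q>'(4) by simp
qed

text \<open>The part of a and b is cut into two connected halves, one containing a and one b. The
  halves are joined by an edge, and if a and b have neighbours in a common further part, the
  quotient edge towards that part is doubled too.\<close>

lemma qmap_split:
  assumes fin: "finite S" and \<phi>: "qmap E S \<phi>" and E: "\<And>e. e \<in> E \<Longrightarrow> card e = 2"
    and ab: "a \<in> S" "b \<in> S" "a \<noteq> b" "\<phi> a = \<phi> b"
  obtains \<psi> where "qmap E S \<psi>" "card (\<psi> ` S) = card (\<phi> ` S) + 1" "card (qe E S \<psi>) \<ge> card (qe E S \<phi>) + 1"
    "\<And>y z. y \<in> S \<Longrightarrow> z \<in> S \<Longrightarrow> \<phi> y = \<phi> z \<Longrightarrow> \<phi> y \<noteq> \<phi> a \<Longrightarrow> {a, y} \<in> E \<Longrightarrow> {b, z} \<in> E \<Longrightarrow>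
       card (qe E S \<psi>) \<ge> card (qe E S \<phi>) + 2"
proof -
  have p: "\<phi> x \<in> S" "\<phi> (\<phi> x) = \<phi> x" "conn E {y \<in> S. \<phi> y = \<phi> x}" if "x \<in> S" for x
    using \<phi> that by (auto simp: qmap_def)
  define w where "w = \<phi> a"
  let ?F = "{y \<in> S. \<phi> y = w}"
  have abF: "a \<in> ?F" "b \<in> ?F" using ab by (auto simp: w_def)
  have F: "conn E ?F" using p(3)[OF ab(1)] by (simp add: w_def)
  obtain A B where AB: "conn E A" "conn E B" "a \<in> A" "b \<in> B" "A \<inter> B = {}" "A \<union> B = ?F"
    using conn_split[OF _ F abF ab(3)] fin by auto
  define \<psi> where "\<psi> = (\<lambda>x. if x \<in> A then a else if x \<in> B then b else \<phi> x)"
  \<comment> \<open>\<kappa> undoes the split, so the old quotient is the quotient of the new one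
    along \<kappa>.\<close>
  define \<kappa> where "\<kappa> = (\<lambda>z. if z = a \<or> z = b then w else z)"
  have memF: "x \<in> A \<or> x \<in> B \<longleftrightarrow> x \<in> S \<and> \<phi> x = w" for x using AB(6) by blast
  have nab: "\<phi> x \<noteq> a" "\<phi> x \<noteq> b" if "x \<in> S" "\<phi> x \<noteq> w" for x
    using p(2)[OF that(1)] that(2) ab(4) by (metis w_def)+
  have bA: "b \<notin> A" "a \<notin> B" using AB by auto
  have \<psi>A: "\<psi> x = a" if "x \<in> A" for x using that by (simp add: \<psi>_def)
  have \<psi>B: "\<psi> x = b" if "x \<in> B" for x using that AB(5) by (auto simp: \<psi>_def)
  have \<psi>o: "\<psi> x = \<phi> x" if "x \<in> S" "\<phi> x \<noteq> w" for x using that memF by (auto simp: \<psi>_def)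
  have \<kappa>\<psi>: "\<kappa> (\<psi> x) = \<phi> x" if "x \<in> S" for x
  proof (cases "\<phi> x = w")
    case True
    then have "x \<in> A \<or> x \<in> B" using memF that by blast
    then show ?thesis using True \<psi>A \<psi>B by (auto simp: \<kappa>_def)
  next
    case False
    then show ?thesis using \<psi>o nab that by (simp add: \<kappa>_def)
  qed
  have qm: "qmap E S \<psi>"
    unfolding qmap_def
  proof
    fix x assume x: "x \<in> S"
    consider "x \<in> A" | "x \<in> B" | "\<phi> x \<noteq> w" using memF x by blast
    then show "\<psi> x \<in> S \<and> \<psi> (\<psi> x) = \<psi> x \<and> conn E {y \<in> S. \<psi> y = \<psi> x}"
    proof cases
      case 1
      have "y \<in> A" if "y \<in> S" "\<psi> y = a" for y
        using that memF[of y] \<psi>B[of y] \<psi>o[of y] nab[of y] ab(3) by metis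
      then have "{y \<in> S. \<psi> y = a} = A" using \<psi>A memF by blast
      then show ?thesis using 1 \<psi>A AB ab by simp
    next
      case 2
      have "y \<in> B" if "y \<in> S" "\<psi> y = b" for y
        using that memF[of y] \<psi>A[of y] \<psi>o[of y] nab[of y] ab(3) by metis
      then have "{y \<in> S. \<psi> y = b} = B" using \<psi>B memF by blast
      then show ?thesis using 2 \<psi>B AB ab by simp
    next
      case 3
      have "\<psi> y = \<phi> x \<longleftrightarrow> \<phi> y = \<phi> x" if "y \<in> S" for y
        using that memF[of y] \<psi>A[of y] \<psi>B[of y] \<psi>o[of y] nab[OF x 3] 3 by metis
      then have "{y \<in> S. \<psi> y = \<phi> x} = {y \<in> S. \<phi> y = \<phi> x}" by blast
      moreover have "\<psi> (\<phi> x) = \<phi> x" using \<psi>o[of "\<phi> x"] p[OF x] 3 by simp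
      ultimately show ?thesis using \<psi>o[OF x 3] p[OF x] by simp
    qed
  qed
  have "\<psi> ` S = insert a (insert b (\<phi> ` S - {w}))"
  proof
    show "\<psi> ` S \<subseteq> insert a (insert b (\<phi> ` S - {w}))"
    proof
      fix z assume "z \<in> \<psi> ` S"
      then obtain x where x: "x \<in> S" "z = \<psi> x" by blast
      consider "x \<in> A" | "x \<in> B" | "\<phi> x \<noteq> w" using memF x(1) by blast
      then show "z \<in> insert a (insert b (\<phi> ` S - {w}))"
        by cases (use x \<psi>A \<psi>B \<psi>o in simp_all)
    qed
    have "a \<in> \<psi> ` S" "b \<in> \<psi> ` S" using \<psi>A[OF AB(3)] \<psi>B[OF AB(4)] ab by (metis imageI)+
    moreover have "\<phi> ` S - {w} \<subseteq> \<psi> ` S" using \<psi>o by (auto simp: image_iff) metis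
    ultimately show "insert a (insert b (\<phi> ` S - {w})) \<subseteq> \<psi> ` S" by blast
  qed
  moreover have "a \<notin> \<phi> ` S - {w}" "b \<notin> \<phi> ` S - {w}" using nab by fastforce+
  moreover have "w \<in> \<phi> ` S" using ab by (simp add: w_def)
  then have "card (\<phi> ` S - {w}) + 1 = card (\<phi> ` S)"
    using fin card_Suc_Diff1[of "\<phi> ` S" w] by simp
  ultimately have cv: "card (\<psi> ` S) = card (\<phi> ` S) + 1" using fin ab(3) by simp
  have "qe E S \<phi> = qedges (qe E S \<psi>) \<kappa>"
  proof -
    have "qedges (qe E S \<psi>) \<kappa> = qe E S (\<kappa> \<circ> \<psi>)" using E by (intro qedges_qedges) (simp add: ind_def)
    also have "\<dots> = qe E S \<phi>" using \<kappa>\<psi> by (intro qedges_cong) (auto simp: ind_def)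
    finally show ?thesis by simp
  qed
  then have im: "qe E S \<phi> = {e \<in> (\<lambda>e. \<kappa> ` e) ` qe E S \<psi>. card e = 2}" by (simp only: qedges_def[of _ \<kappa>])
  have red: "card (qe E S \<phi>) + card X \<le> card (qe E S \<psi>)"
    if X: "X \<subseteq> qe E S \<psi>" "\<And>e. e \<in> X \<Longrightarrow> card (\<kappa> ` e) = 2 \<Longrightarrow> \<kappa> ` e \<in> (\<lambda>e. \<kappa> ` e) ` (qe E S \<psi> - X)" for X
  proof -
    have f: "finite (qe E S \<psi>)" by (rule finite_qe[OF fin])
    have "qe E S \<phi> \<subseteq> (\<lambda>e. \<kappa> ` e) ` (qe E S \<psi> - X)"
      unfolding im using X(2) by blast
    then have "card (qe E S \<phi>) \<le> card (qe E S \<psi> - X)"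
      using f by (meson card_image_le card_mono finite_Diff finite_imageI le_trans)
    then show ?thesis using X(1) f card_mono[OF f X(1)] by (simp add: card_Diff_subset finite_subset)
  qed
  have ab_edge: "{a, b} \<in> qe E S \<psi>"
  proof -
    have "A \<noteq> {}" "A \<subset> ?F" using AB by auto
    from conn_ex[OF F this] obtain s t where st: "s \<in> A" "t \<in> ?F - A" "{s, t} \<in> E" by blast
    then have "t \<in> B" using AB(6) by blast
    have "{s, t} \<in> ind E S" using st memF[of s] by (auto simp: ind_def)
    from qedgesI[OF this, of \<psi>] show ?thesis using \<psi>A[OF st(1)] \<psi>B[OF \<open>t \<in> B\<close>] ab(3) by simp
  qed
  have one: "card (\<kappa> ` {a, b}) \<noteq> 2" by (simp add: \<kappa>_def)
  have ce: "card (qe E S \<psi>) \<ge> card (qe E S \<phi>) + 1"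
    using red[of "{{a, b}}"] ab_edge one by simp
  have ce2: "card (qe E S \<psi>) \<ge> card (qe E S \<phi>) + 2"
    if yz: "y \<in> S" "z \<in> S" "\<phi> y = \<phi> z" "\<phi> y \<noteq> \<phi> a" "{a, y} \<in> E" "{b, z} \<in> E" for y z
  proof -
    have n: "\<phi> y \<noteq> a" "\<phi> y \<noteq> b" using nab[OF yz(1)] yz(4) by (auto simp: w_def)
    have \<psi>y: "\<psi> y = \<phi> y" "\<psi> z = \<phi> y" using \<psi>o[OF yz(1)] \<psi>o[OF yz(2)] yz(3,4) by (auto simp: w_def)
    have "{a, y} \<in> ind E S" "{b, z} \<in> ind E S" using yz ab by (auto simp: ind_def)
    from qedgesI[OF this(1), of \<psi>] qedgesI[OF this(2), of \<psi>]
    have e: "{a, \<phi> y} \<in> qe E S \<psi>" "{b, \<phi> y} \<in> qe E S \<psi>"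
      using \<psi>A[OF AB(3)] \<psi>B[OF AB(4)] \<psi>y n by auto
    have d: "{a, b} \<noteq> {b, \<phi> y}" "{a, \<phi> y} \<noteq> {a, b}" "{a, \<phi> y} \<noteq> {b, \<phi> y}"
      using n ab(3) by (auto simp: doubleton_eq_iff)
    have "\<kappa> ` {b, \<phi> y} = \<kappa> ` {a, \<phi> y}" by (simp add: \<kappa>_def)
    moreover have "{a, \<phi> y} \<in> qe E S \<psi> - {{a, b}, {b, \<phi> y}}" using e d by blast
    ultimately have "\<kappa> ` {b, \<phi> y} \<in> (\<lambda>e. \<kappa> ` e) ` (qe E S \<psi> - {{a, b}, {b, \<phi> y}})" by (metis imageI)
    then have "card (qe E S \<phi>) + card {{a, b}, {b, \<phi> y}} \<le> card (qe E S \<psi>)"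
      using ab_edge e(2) one by (intro red) blast+
    then show ?thesis using d by simp
  qed
  show ?thesis by (rule that[OF qm cv ce ce2])
qed

text \<open>Take a quotient with \<open>v\<close> vertices, at least \<open>2 v - 3\<close> edges and \<open>v\<close> maximal. By maximality
  (see \<open>qmap_split\<close>) no two parts are joined by two edges, and \<open>v - 1 \<le> k\<close>; induct on the parts.\<close>

lemma not_rich_sparse:
  assumes k: "k \<ge> 1" and E: "\<And>e. e \<in> E \<Longrightarrow> card e = 2"
    and "finite S" "conn E S" "\<not> rich E (2 - 1 / (real k + 1)) S 1"
  shows "real (card (ind E S)) \<le> (2 - 1 / real k) * (real (card S) - 1)"
  using assms(3-5)
proof (induction "card S" arbitrary: S rule: less_induct)
  case less
  let ?a = "2 - 1 / real k" and ?c = "2 - 1 / (real k + 1)"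
  have fin: "finite S" and S: "conn E S" using less.prems by auto
  obtain s where s: "s \<in> S" using conn_nonempty[OF S] by blast
  define P where "P = (\<lambda>\<phi>. qmap E S \<phi> \<and> 2 * card (\<phi> ` S) \<le> card (qe E S \<phi>) + 3)"
  have "(\<lambda>_. s) ` S = {s}" using s by auto
  \<comment> \<open>The one-part quotient qualifies, as 2 \<le> 0 + 3.\<close>
  then have "P (\<lambda>_. s)" using s S by (auto simp: P_def qmap_def)
  then have "\<exists>\<phi>. P \<phi> \<and> (\<forall>\<psi>. P \<psi> \<longrightarrow> card (\<psi> ` S) \<le> card (\<phi> ` S))"
    by (rule ex_has_greatest_nat[where f = "\<lambda>\<phi>. card (\<phi> ` S)" and b = "Suc (card S)"])
      (simp add: card_image_le[OF fin] less_Suc_eq_le)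
  then obtain \<phi> where \<phi>: "P \<phi>" and mx: "\<And>\<psi>. P \<psi> \<Longrightarrow> card (\<psi> ` S) \<le> card (\<phi> ` S)"
    by blast
  have qm: "qmap E S \<phi>" and e3: "2 * card (\<phi> ` S) \<le> card (qe E S \<phi>) + 3" using \<phi> by (auto simp: P_def)
  let ?v = "card (\<phi> ` S)" and ?e = "card (qe E S \<phi>)"
  have v1: "?v \<ge> 1" using s fin card_gt_0_iff[of "\<phi> ` S"] by (auto simp: Suc_le_eq)
  show ?case
  proof (cases "card S = 1")
    case True
    then obtain x where x: "S = {x}" by (auto simp: card_1_singleton_iff)
    have "ind E S = {}"
    proof -
      have "card e \<le> 1" if "e \<in> ind E S" for e using that x card_mono[of "{x}" e] by (auto simp: ind_def)
      then show ?thesis using E by (force simp: ind_def)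
    qed
    then show ?thesis using True by simp
  next
    case False
    \<comment> \<open>Splitting a single part gives two vertices and at least one edge, where 2 * 2
      \<le> 1 + 3 still holds, against maximality.\<close>
    have v2: "?v \<ge> 2"
    proof (rule ccontr)
      assume "\<not> ?v \<ge> 2"
      then have v: "?v = 1" using v1 by simp
      then obtain w where w: "\<phi> ` S = {w}" by (auto simp: card_1_singleton_iff)
      have "card S \<noteq> 0" using s fin by auto
      then obtain a b where ab: "a \<in> S" "b \<in> S" "a \<noteq> b"
        using False card_le_Suc0_iff_eq[OF fin] by (metis One_nat_def le_SucE le_zero_eq)
      moreover have "\<phi> a = \<phi> b" using w ab by (metis imageI singletonD)
      ultimately obtain \<psi> where "qmap E S \<psi>" "card (\<psi> ` S) = ?v + 1" "card (qe E S \<psi>) \<ge> ?e + 1"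
        using qmap_split[OF fin qm E] by metis
      then have "P \<psi>" "card (\<psi> ` S) > ?v" using v by (auto simp: P_def)
      then show False using mx by fastforce
    qed
    have nr: "real ?e < ?c * (real ?v - 1)"
    proof (rule ccontr)
      assume "\<not> ?thesis"
      then have "rich E ?c S 1" unfolding rich_def using qm v2 by (intro exI[of _ \<phi>]) auto
      then show False using less.prems by blast
    qed
    have "real (2 * ?v) \<le> real (?e + 3)" using e3 by (simp only: of_nat_le_iff)
    then have e3': "2 * (real ?v - 1) - 1 \<le> real ?e" by simp
    \<comment> \<open>For v - 1 \<ge> k + 1 one has (2 - 1/(k + 1)) (v - 1) \<le> 2 (v - 1) - 1
      \<le> e, so S would be rich.\<close>
    have vk: "real ?v - 1 \<le> real k"
    proof (rule ccontr)
      assume "\<not> ?thesis"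
      then have "real (k + 1) < real ?v" by simp
      then have "k + 2 \<le> ?v" by (simp only: of_nat_less_iff)
      then have "real (k + 2) \<le> real ?v" by (simp only: of_nat_le_iff)
      then have "real ?v - 1 \<ge> real k + 1" by simp
      then have "(real ?v - 1) / (real k + 1) \<ge> 1" by (simp add: le_divide_eq)
      then have "?c * (real ?v - 1) \<le> 2 * (real ?v - 1) - 1" by (simp add: left_diff_distrib)
      then show False using nr e3' by linarith
    qed
    \<comment> \<open>Not being rich gives e < 2 (v - 1), so integrality leaves e = 2 v - 3, and v -
      1 \<le> k turns this into the wanted ratio.\<close>
    have "?c * (real ?v - 1) \<le> 2 * (real ?v - 1)" using v1 by (intro mult_right_mono) auto
    then have "real ?e < 2 * (real ?v - 1)" using nr by linarith
    then have "real (?e + 2) < real (2 * ?v)" by simp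
    then have "?e + 3 \<le> 2 * ?v" by (simp only: of_nat_less_iff)
    then have "real (?e + 3) \<le> real (2 * ?v)" by (simp only: of_nat_le_iff)
    then have "real ?e \<le> 2 * (real ?v - 1) - 1" by simp
    moreover have "(real ?v - 1) / real k \<le> 1" using vk k by (simp add: divide_le_eq)
    ultimately have eq: "real ?e \<le> ?a * (real ?v - 1)" by (simp add: left_diff_distrib)
    \<comment> \<open>The edges between parts. Two of them with the same image would allow a split
      that keeps 2 v \<le> e + 3 while raising v; so there are no more of them than quotient
      edges.\<close>
    define C where "C = {d \<in> ind E S. card (\<phi> ` d) = 2}"
    have no_double: False
      if d: "a \<in> S" "b \<in> S" "y \<in> S" "z \<in> S" "a \<noteq> b" "\<phi> a = \<phi> b" "\<phi> y = \<phi> z" "\<phi> y \<noteq> \<phi> a" "{a, y} \<in> E" "{b, z} \<in> E"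
      for a b y z
    proof -
      obtain \<psi> where "qmap E S \<psi>" "card (\<psi> ` S) = ?v + 1" "card (qe E S \<psi>) \<ge> ?e + 2"
        using qmap_split[OF fin qm E d(1,2,5,6)] d(3,4,7-10) by metis
      then have "P \<psi>" "card (\<psi> ` S) > ?v" using e3 by (auto simp: P_def)
      then show False using mx by fastforce
    qed
    have "inj_on (\<lambda>d. \<phi> ` d) C"
    proof (rule inj_onI)
      fix d d' assume dd: "d \<in> C" "d' \<in> C" "\<phi> ` d = \<phi> ` d'"
      have dE: "d \<in> E" "d' \<in> E" "d \<subseteq> S" "d' \<subseteq> S" using dd by (auto simp: C_def ind_def)
      obtain a y where ay: "d = {a, y}" using E[OF dE(1)] by (auto simp: card_2_iff)
      obtain b0 z0 where bz0: "d' = {b0, z0}" using E[OF dE(2)] by (auto simp: card_2_iff)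
      have ne: "\<phi> a \<noteq> \<phi> y" using dd(1) ay by (auto simp: C_def)
      obtain b z where bz: "d' = {b, z}" "\<phi> a = \<phi> b" "\<phi> y = \<phi> z"
        using dd(3) ay bz0 by (auto simp: doubleton_eq_iff insert_commute)
      have "a = b" using no_double[of a b y z] ay bz dE ne by auto
      moreover have "y = z" using no_double[of y z a b] ay bz dE ne by (auto simp: insert_commute)
      ultimately show "d = d'" using ay bz by simp
    qed
    moreover have "(\<lambda>d. \<phi> ` d) ` C \<subseteq> qe E S \<phi>" by (auto simp: C_def qedges_def)
    ultimately have cC: "card C \<le> ?e" by (rule card_inj_on_le[OF _ _ finite_qe[OF fin]])
    let ?F = "\<lambda>w. {x \<in> S. \<phi> x = w}"
    have "ind E S \<subseteq> C \<union> (\<Union>w\<in>\<phi> ` S. ind E (?F w))"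
    proof
      fix d assume d: "d \<in> ind E S"
      then obtain x y where xy: "d = {x, y}" "x \<in> S" "y \<in> S" using E[of d] by (auto simp: ind_def card_2_iff)
      show "d \<in> C \<union> (\<Union>w\<in>\<phi> ` S. ind E (?F w))"
      proof (cases "\<phi> x = \<phi> y")
        case True
        then have "d \<in> ind E (?F (\<phi> x))" using d xy by (auto simp: ind_def)
        then show ?thesis using xy by blast
      next
        case False
        then show ?thesis using d xy by (simp add: C_def)
      qed
    qed
    then have "card (ind E S) \<le> card (C \<union> (\<Union>w\<in>\<phi> ` S. ind E (?F w)))"
      using fin finite_ind[OF fin, of E] by (intro card_mono) (auto simp: C_def intro!: finite_ind)
    also have "\<dots> \<le> card C + card (\<Union>w\<in>\<phi> ` S. ind E (?F w))" by (rule card_Un_le)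
    also have "\<dots> \<le> ?e + (\<Sum>w\<in>\<phi> ` S. card (ind E (?F w)))"
      using cC card_UN_le[of "\<phi> ` S" "\<lambda>w. ind E (?F w)"] fin by (intro add_mono) auto
    finally have "real (card (ind E S)) \<le> real ?e + (\<Sum>w\<in>\<phi> ` S. real (card (ind E (?F w))))"
      by (simp flip: of_nat_sum of_nat_add)
    moreover have "(\<Sum>w\<in>\<phi> ` S. real (card (ind E (?F w)))) \<le> (\<Sum>w\<in>\<phi> ` S. ?a * (real (card (?F w)) - 1))"
    proof (rule sum_mono)
      fix w assume w: "w \<in> \<phi> ` S"
      have F: "conn E (?F w)" using w qm by (auto simp: qmap_def)
      obtain w' where "w' \<in> \<phi> ` S" "w' \<noteq> w"
        using v2 w card_le_Suc0_iff_eq[of "\<phi> ` S"] fin by (metis finite_imageI not_less_eq_eq numeral_2_eq_2)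
      then have "?F w \<subset> S" by auto
      then have "card (?F w) < card S" by (rule psubset_card_mono[OF fin])
      moreover have "\<not> rich E ?c (?F w) 1"
        using rich_mono[of E ?c "?F w" 1 S] fin S conn_nonempty[OF F] less.prems(3) by blast
      ultimately show "real (card (ind E (?F w))) \<le> ?a * (real (card (?F w)) - 1)"
        using less.hyps[of "?F w"] fin F by simp
    qed
    moreover have "(\<Sum>w\<in>\<phi> ` S. ?a * (real (card (?F w)) - 1)) = ?a * (real (card S) - real ?v)"
    proof -
      have "card S = (\<Sum>w\<in>\<phi> ` S. card (?F w))"
        using sum.image_gen[OF fin, of "\<lambda>_. 1::nat" \<phi>] by simp
      then have "(\<Sum>w\<in>\<phi> ` S. real (card (?F w)) - 1) = real (card S) - real ?v"
        by (simp add: sum_subtractf)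
      then show ?thesis by (simp only: sum_distrib_left[symmetric])
    qed
    ultimately have "real (card (ind E S)) \<le> ?a * (real ?v - 1) + ?a * (real (card S) - real ?v)"
      using eq by linarith
    also have "\<dots> = ?a * (real (card S) - 1)" by (simp only: distrib_left[symmetric]) simp
    finally show ?thesis .
  qed
qed

section \<open>Isolated critical densities\<close>

text \<open>A smallest connected A with at least s vertices and connected complement is small: for a
  vertex a of A adjacent to the complement, a component of A - a with s or more vertices could
  replace A, and there are at most \<Delta> components. Such sets are split off while more than
  (\<Delta> + 1) s vertices remain.\<close>

lemma conn_bounded_partition:
  assumes "finite P" "conn E P" "s \<ge> 1" "\<Delta> \<ge> 1" "card P \<ge> s"
    and "\<And>a. a \<in> P \<Longrightarrow> card {y \<in> P. {a, y} \<in> E} \<le> \<Delta>"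
  shows "\<exists>\<P>. \<Union>\<P> = P \<and> (\<forall>Q\<in>\<P>. \<forall>R\<in>\<P>. Q \<noteq> R \<longrightarrow> Q \<inter> R = {}) \<and>
    (\<forall>Q\<in>\<P>. conn E Q \<and> s \<le> card Q \<and> card Q \<le> (\<Delta> + 1) * s)"
  using assms
proof (induction "card P" arbitrary: P rule: less_induct)
  case less
  note fin = less.prems(1) and P = less.prems(2) and deg = less.prems(6)
  show ?case
  proof (cases "card P \<le> (\<Delta> + 1) * s")
    case True
    then show ?thesis using less.prems by (intro exI[of _ "{P}"]) auto
  next
    case False
    define good where "good = (\<lambda>A. A \<subseteq> P \<and> conn E A \<and> (A = P \<or> conn E (P - A)) \<and> s \<le> card A)"
    have "good P" using less.prems by (simp add: good_def)
    then obtain A where A: "good A" and mn: "\<And>B. good B \<Longrightarrow> card A \<le> card B"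
      using ex_has_least_nat[of good P card] by blast
    have AP: "A \<subseteq> P" "conn E A" "A = P \<or> conn E (P - A)" "s \<le> card A" using A by (auto simp: good_def)
    have fA: "finite A" using finite_subset[OF AP(1) fin] .
    \<comment> \<open>A neighbour of a outside A ensures that the complement in P of a component of
      A - a is connected again.\<close>
    obtain a where a: "a \<in> A" and ab: "A \<noteq> P \<Longrightarrow> \<exists>b\<in>P - A. {a, b} \<in> E"
    proof (cases "A = P")
      case True
      then show ?thesis using that conn_nonempty[OF P] by blast
    next
      case False
      then have "A \<subset> P" using AP by blast
      from conn_ex[OF P conn_nonempty[OF AP(2)] this] show ?thesis using that by blast
    qed
    \<comment> \<open>S runs over unions of components of A - a; each component contains a neighbour
      of a, so counting neighbours counts components.\<close>
    have bound: "card S \<le> (s - 1) * card {y \<in> S. {a, y} \<in> E}"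
      if "S \<subseteq> A - {a}" "\<And>x y. x \<in> S \<Longrightarrow> y \<in> A - S - {a} \<Longrightarrow> {x, y} \<notin> E" for S
      using that
    proof (induction "card S" arbitrary: S rule: less_induct)
      case (less S)
      have fS: "finite S" using finite_subset[OF less.prems(1)] fA by blast
      have SA: "S \<subseteq> A" "a \<notin> S" "S \<subset> A" using less.prems(1) a by auto
      consider "S = {}" | "conn E S" | "S \<noteq> {}" "\<not> conn E S" by blast
      then show ?case
      proof cases
        case 1
        then show ?thesis by simp
      next
        case 2
        from conn_ex[OF AP(2) conn_nonempty[OF 2] SA(3)] obtain x y where
          xy: "x \<in> S" "y \<in> A - S" "{x, y} \<in> E" by blast
        then have "y = a" using less.prems(2)[of x y] by blast
        then have "x \<in> {y \<in> S. {a, y} \<in> E}" using xy by (simp add: insert_commute)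
        then have N: "card {y \<in> S. {a, y} \<in> E} \<ge> 1" using fS card_gt_0_iff[of "{y \<in> S. {a, y} \<in> E}"] by auto
        have "card S < card A" by (rule psubset_card_mono[OF fA SA(3)])
        then have "\<not> good S" using mn[of S] by auto
        moreover have "conn E (P - S)"
        proof -
          have AS: "conn E (A - S)" by (rule conn_diff_closed[OF AP(2) a SA(2,1) less.prems(2)])
          show ?thesis
          proof (cases "A = P")
            case True
            then show ?thesis using AS by simp
          next
            case False
            then obtain b where b: "b \<in> P - A" "{a, b} \<in> E" using ab by blast
            have "conn E ((A - S) \<union> (P - A))"
              by (rule conn_Un_edge[OF AS _ _ b(1)]) (use AP(3) False a SA b in auto)
            moreover have "(A - S) \<union> (P - A) = P - S" using SA AP(1) by auto
            ultimately show ?thesis by simp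
          qed
        qed
        ultimately have "card S \<le> s - 1" using 2 SA AP(1) by (auto simp: good_def)
        also have "s - 1 \<le> (s - 1) * card {y \<in> S. {a, y} \<in> E}" using mult_le_mono2[OF N, of "s - 1"] by (simp only: mult_1_right)
        finally show ?thesis .
      next
        case 3
        then obtain X where X: "X \<noteq> {}" "X \<subset> S" "\<And>x y. x \<in> X \<Longrightarrow> y \<in> S - X \<Longrightarrow> {x, y} \<notin> E"
          unfolding conn_def by blast
        have "card X \<le> (s - 1) * card {y \<in> X. {a, y} \<in> E}"
        proof (rule less.hyps)
          show "card X < card S" by (rule psubset_card_mono[OF fS X(2)])
          show "X \<subseteq> A - {a}" using X(2) less.prems(1) by blast
          show "{x, y} \<notin> E" if "x \<in> X" "y \<in> A - X - {a}" for x y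
            using that X(2) X(3)[of x y] less.prems(2)[of x y] by (cases "y \<in> S") auto
        qed
        moreover have "card (S - X) \<le> (s - 1) * card {y \<in> S - X. {a, y} \<in> E}"
        proof (rule less.hyps)
          show "card (S - X) < card S" using X by (intro psubset_card_mono[OF fS]) auto
          show "S - X \<subseteq> A - {a}" using less.prems(1) by blast
          show "{x, y} \<notin> E" if "x \<in> S - X" "y \<in> A - (S - X) - {a}" for x y
            using that X(3)[of y x] less.prems(2)[of x y] by (cases "y \<in> X") (auto simp: insert_commute)
        qed
        moreover have "card S = card X + card (S - X)"
          using X(2) fS card_mono[OF fS, of X] finite_subset[OF _ fS, of X] by (simp add: card_Diff_subset psubset_imp_subset)
        moreover have "card {y \<in> S. {a, y} \<in> E} = card {y \<in> X. {a, y} \<in> E} + card {y \<in> S - X. {a, y} \<in> E}"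
        proof -
          have "{y \<in> S. {a, y} \<in> E} = {y \<in> X. {a, y} \<in> E} \<union> {y \<in> S - X. {a, y} \<in> E}" using X(2) by blast
          moreover have "finite X" using X fS by (auto intro: finite_subset)
          ultimately show ?thesis using fS by (simp add: card_Un_disjoint disjoint_iff)
        qed
        ultimately show ?thesis by (simp add: distrib_left)
      qed
    qed
    have "card (A - {a}) \<le> (s - 1) * card {y \<in> A - {a}. {a, y} \<in> E}" by (rule bound) auto
    also have "\<dots> \<le> (s - 1) * \<Delta>"
    proof (rule mult_le_mono2)
      have "card {y \<in> A - {a}. {a, y} \<in> E} \<le> card {y \<in> P. {a, y} \<in> E}"
        using fin AP(1) by (intro card_mono) auto
      also have "\<dots> \<le> \<Delta>" using deg a AP(1) by blast
      finally show "card {y \<in> A - {a}. {a, y} \<in> E} \<le> \<Delta>" .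
    qed
    finally have "card A \<le> (s - 1) * \<Delta> + 1" using a fA by simp
    moreover obtain s' where s': "s = Suc s'" using less.prems(3) by (cases s) auto
    ultimately have cA: "card A \<le> s' * \<Delta> + 1" by simp
    \<comment> \<open>The right side is (\<Delta> + 1) s expanded with s = s' + 1; it leaves at
      least s vertices in P - A.\<close>
    have cP: "card P > \<Delta> * s' + s' + \<Delta> + 1" using False s' by (simp add: algebra_simps)
    have ne: "A \<noteq> P" using cA cP by (auto simp: mult.commute)
    have PA: "conn E (P - A)" using AP(3) ne by blast
    have cPA: "card (P - A) = card P - card A" using AP(1) fA by (simp add: card_Diff_subset)
    have "card (P - A) < card P" using AP(1) ne fin by (intro psubset_card_mono) (use conn_nonempty[OF AP(2)] in auto)
    moreover have "s \<le> card (P - A)" using cPA cA cP s' by (simp add: mult.commute)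
    moreover have "card {y \<in> P - A. {x, y} \<in> E} \<le> \<Delta>" if "x \<in> P - A" for x
    proof -
      have "card {y \<in> P - A. {x, y} \<in> E} \<le> card {y \<in> P. {x, y} \<in> E}" using fin by (intro card_mono) auto
      then show ?thesis using deg[of x] that by auto
    qed
    ultimately obtain \<P> where \<P>: "\<Union>\<P> = P - A" "\<forall>Q\<in>\<P>. \<forall>R\<in>\<P>. Q \<noteq> R \<longrightarrow> Q \<inter> R = {}"
      "\<forall>Q\<in>\<P>. conn E Q \<and> s \<le> card Q \<and> card Q \<le> (\<Delta> + 1) * s"
      using less.hyps[of "P - A"] fin PA less.prems(3,4) by auto
    have "card A \<le> (\<Delta> + 1) * s" using cA s' by (simp add: algebra_simps)
    moreover have "A \<inter> Q = {}" if "Q \<in> \<P>" for Q using \<P>(1) that by blast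
    ultimately show ?thesis
      using \<P> AP by (intro exI[of _ "insert A \<P>"]) (auto simp: Int_commute)
  qed
qed

text \<open>P is contracted to one vertex p and C onto N, each vertex of N in a part of its own.
  With n the size of N, the quotient has n + 1 vertices, n edges at p and, by connectivity, at least
  n - 1 edges within N.\<close>

lemma conn_pair_neighbours:
  assumes A: "minor_closed \<A>" "(V, E) \<in> \<A>"
    and hi: "\<And>G. G \<in> \<A> \<Longrightarrow> real (card (edges G)) \<le> hi * real (card (verts G))"
    and PC: "P \<subseteq> V" "C \<subseteq> V" "P \<inter> C = {}" "conn E P" "conn E C"
    and N: "N = {y \<in> C. \<exists>x\<in>P. {x, y} \<in> E}" "N \<noteq> {}"
  shows "2 * real (card N) - 1 \<le> hi * (real (card N) + 1)"
proof -
  have sG: "simple_graph (V, E)" using class_simple[OF minor_closed_class[OF A(1)] A(2)] .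
  have fV: "finite V" using sG by (simp add: simple_graph_def)
  have fin: "finite P" "finite C" "finite N" using PC N(1) fV by (auto intro: finite_subset)
  have NC: "N \<subseteq> C" using N(1) by auto
  have "qmap E N id"
    unfolding qmap_def
  proof
    fix x assume "x \<in> N"
    moreover from this have "{y \<in> N. id y = id x} = {x}" by auto
    ultimately show "id x \<in> N \<and> id (id x) = id x \<and> conn E {y \<in> N. id y = id x}" by simp
  qed
  from qmap_extend[OF fin(2) PC(5) NC N(2) this] obtain \<psi> where
    \<psi>: "qmap E C \<psi>" "\<And>x. x \<in> N \<Longrightarrow> \<psi> x = x" "\<psi> ` C = N" by auto
  obtain p where p: "p \<in> P" using conn_nonempty[OF PC(4)] by blast
  have pC: "p \<notin> C" using p PC(3) by blast
  define \<phi> where "\<phi> = (\<lambda>x. if x \<in> P then p else \<psi> x)"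
  have \<phi>C: "\<phi> x = \<psi> x" if "x \<in> C" for x using that PC(3) by (auto simp: \<phi>_def)
  have \<psi>C: "\<psi> x \<in> N" if "x \<in> C" for x using \<psi>(3) that by blast
  have qm: "qmap E (P \<union> C) \<phi>"
    unfolding qmap_def
  proof
    fix x assume x: "x \<in> P \<union> C"
    show "\<phi> x \<in> P \<union> C \<and> \<phi> (\<phi> x) = \<phi> x \<and> conn E {y \<in> P \<union> C. \<phi> y = \<phi> x}"
    proof (cases "x \<in> P")
      case True
      have "\<phi> y \<noteq> p" if "y \<in> C" for y using \<phi>C[OF that] \<psi>C[OF that] NC pC by auto
      moreover have "\<phi> y = p" if "y \<in> P" for y using that by (simp add: \<phi>_def)
      ultimately have "{y \<in> P \<union> C. \<phi> y = p} = P" by blast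
      then show ?thesis using True p PC(4) by (simp add: \<phi>_def)
    next
      case False
      then have xC: "x \<in> C" using x by blast
      have "\<phi> y \<noteq> \<psi> x" if "y \<in> P" for y using that \<psi>C[OF xC] NC pC by (auto simp: \<phi>_def)
      then have "{y \<in> P \<union> C. \<phi> y = \<psi> x} = {y \<in> C. \<psi> y = \<psi> x}" using \<phi>C by auto
      moreover have "\<psi> x \<in> C" using \<psi>C[OF xC] NC by blast
      ultimately show ?thesis using \<psi>(1) xC \<phi>C by (simp add: qmap_def)
    qed
  qed
  have "\<phi> ` C = N" using \<phi>C \<psi>(3) by (metis image_cong)
  moreover have "\<phi> ` P = {p}" using p by (auto simp: \<phi>_def)
  ultimately have im: "\<phi> ` (P \<union> C) = insert p N" by (simp add: image_Un)
  have pN: "p \<notin> N" using NC pC by blast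
  have "(\<phi> ` (P \<union> C), qe E (P \<union> C) \<phi>) \<in> \<A>"
    by (rule minor_closed_qmap[OF A _ _ qm]) (use PC p in auto)
  from hi[OF this] have up: "real (card (qe E (P \<union> C) \<phi>)) \<le> hi * (real (card N) + 1)"
    using im pN fin by (simp add: add.commute)
  have "qe E C \<psi> \<subseteq> qe E (P \<union> C) \<phi>" by (rule qe_mono) (use \<phi>C in auto)
  moreover have "(\<lambda>y. {p, y}) ` N \<subseteq> qe E (P \<union> C) \<phi>"
  proof clarify
    fix y assume y: "y \<in> N"
    then obtain x where x: "x \<in> P" "{x, y} \<in> E" using N(1) by blast
    have "{x, y} \<in> ind E (P \<union> C)" using x y NC by (auto simp: ind_def)
    moreover have "\<phi> x = p" using x(1) by (simp add: \<phi>_def)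
    moreover have "\<phi> y = y" using \<phi>C[of y] \<psi>(2)[OF y] NC y by auto
    moreover have "p \<noteq> y" using y pN by blast
    ultimately show "{p, y} \<in> qe E (P \<union> C) \<phi>" using qedgesI[of x y "ind E (P \<union> C)" \<phi>] by simp
  qed
  ultimately have "card (qe E C \<psi> \<union> (\<lambda>y. {p, y}) ` N) \<le> card (qe E (P \<union> C) \<phi>)"
    using fin by (intro card_mono finite_qe) auto
  moreover have sub: "e \<subseteq> N" if "e \<in> qe E C \<psi>" for e
    using qedges_sub[of "ind E C" C e \<psi>] that \<psi>(3) by (auto simp: ind_def)
  then have "qe E C \<psi> \<inter> (\<lambda>y. {p, y}) ` N = {}" using pN by fastforce
  then have "card (qe E C \<psi> \<union> (\<lambda>y. {p, y}) ` N) = card (qe E C \<psi>) + card ((\<lambda>y. {p, y}) ` N)"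
    using fin by (intro card_Un_disjoint) (auto simp: finite_qe)
  moreover have "card ((\<lambda>y. {p, y}) ` N) = card N"
    by (rule card_image) (auto simp: inj_on_def doubleton_eq_iff)
  moreover have "card N \<le> card (qe E C \<psi>) + 1"
  proof -
    have "conn (qe E C \<psi>) (\<psi> ` C)" by (rule conn_image) (use PC(5) conn_ind[of C C E] in simp)
    then have "card N \<le> card (ind (qe E C \<psi>) N) + 1" using conn_card_edges[OF fin(3)] \<psi>(3) by simp
    then show ?thesis using card_mono[OF finite_qe[OF fin(2)] ind_subset, of E \<psi> N] by linarith
  qed
  ultimately have "2 * real (card N) - 1 \<le> real (card (qe E (P \<union> C) \<phi>))" by linarith
  then show ?thesis using up by linarith
qed

text \<open>The class bound \<open>hi\<close> and the margin \<open>lo\<close> are kept apart from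
  c, the density that (V, E) exceeds: the bounds derived here depend only on \<open>hi\<close>,
  \<open>lo\<close> and k, so they are uniform in c.\<close>

locale minimal_dense =
  fixes \<A> :: "nat graph set" and V E and k :: nat and a lo c hi c' :: real
  assumes minor_closed: "minor_closed \<A>" and G: "(V, E) \<in> \<A>"
    and hi: "\<And>G. G \<in> \<A> \<Longrightarrow> real (card (edges G)) \<le> hi * real (card (verts G))"
    and dense: "real (card E) > c * real (card V)"
    and minimal: "\<And>G. G \<in> \<A> \<Longrightarrow> card (verts G) < card V \<Longrightarrow> real (card (edges G)) \<le> c * real (card (verts G))"
    and k: "k \<ge> 1" and a: "a = 2 - 1 / real k" and c': "c' = 2 - 1 / (real k + 1)"
    and lo: "a < lo" "lo \<le> c" and hi_c': "hi < c'"
begin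

section \<open>Consequences of minimality: bounds on richness, degrees and order\<close>

lemma simple: "simple_graph (V, E)"
  using class_simple[OF minor_closed_class[OF minor_closed] G] .

lemma finite_V: "finite V" and card_edge: "e \<in> E \<Longrightarrow> card e = 2" and edge_sub: "e \<in> E \<Longrightarrow> e \<subseteq> V"
  using simple by (auto simp: simple_graph_def)

lemma finite_E: "finite E"
  using simple_finite_edges[OF simple] by simp

lemma card_V: "card V > 0"
  using simple_card_verts[OF simple] by simp

lemma bounds: "1 \<le> a" "c < hi" "c' < 2" "hi < 2" "0 < hi"
proof -
  show 1: "1 \<le> a" using k by (simp add: a divide_le_eq)
  have "c * real (card V) < hi * real (card V)" using hi[OF G] dense by simp
  then show 2: "c < hi" using card_V by simp
  show "c' < 2" by (simp add: c')
  then show "hi < 2" using hi_c' by simp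
  show "0 < hi" using 1 2 lo by simp
qed

lemma induced: "S \<subseteq> V \<Longrightarrow> S \<noteq> {} \<Longrightarrow> (S, ind E S) \<in> \<A>"
  using minor_closed_subgraph[OF minor_closed G] by simp

lemma connected: "conn E V"
proof -
  have "real (card (ind E V)) > c * real (card V)" using dense ind_verts[OF simple] by simp
  from conn_component_density[OF finite_V _ this card_edge] card_V obtain T where
    T: "T \<subseteq> V" "conn E T" "real (card (ind E T)) > c * real (card T)"
    by (metis card.empty less_irrefl)
  have "T = V"
  proof (rule ccontr)
    assume "T \<noteq> V"
    then have "card T < card V" using T(1) finite_V by (intro psubset_card_mono) auto
    then show False using minimal[OF induced[OF T(1) conn_nonempty[OF T(2)]]] T(3) by simp
  qed
  then show ?thesis using T(2) by simp
qed

text \<open>A quotient in the class with at least c' (v - 1) edges has v - 1 \<le> M, by comparison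
  with \<open>hi\<close> times v.\<close>

definition M :: real where "M = hi / (c' - hi)"

lemma M_pos: "M > 0"
  using bounds hi_c' by (simp add: M_def)

lemma rich_le:
  assumes "rich E c' V m" shows "real m \<le> M"
proof -
  obtain \<phi> where \<phi>: "qmap E V \<phi>" "card (\<phi> ` V) > m" "real (card (qe E V \<phi>)) \<ge> c' * (real (card (\<phi> ` V)) - 1)"
    using assms by (auto simp: rich_def)
  have "(\<phi> ` V, qe E V \<phi>) \<in> \<A>"
    using minor_closed_qmap[OF minor_closed G _ _ \<phi>(1)] conn_nonempty[OF connected] by simp
  then have "c' * (real (card (\<phi> ` V)) - 1) \<le> hi * real (card (\<phi> ` V))" using hi \<phi>(3) by force
  then have "(real (card (\<phi> ` V)) - 1) * (c' - hi) \<le> hi" by (simp add: algebra_simps)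
  then have "real (card (\<phi> ` V)) - 1 \<le> M" using hi_c' by (simp add: M_def le_divide_eq)
  then show ?thesis using \<phi>(2) by linarith
qed

text \<open>The inequality 2 n - 1 \<le> \<open>hi\<close> (n + 1) for n attachment vertices, solved
  for n.\<close>

definition D :: real where "D = (hi + 1) / (2 - hi)"

lemma D_pos: "D > 0"
  using bounds by (simp add: D_def)

lemma neighbours_le:
  assumes "P \<subseteq> V" "C \<subseteq> V" "P \<inter> C = {}" "conn E P" "conn E C"
  shows "real (card {y \<in> C. \<exists>x\<in>P. {x, y} \<in> E}) \<le> D"
proof (cases "{y \<in> C. \<exists>x\<in>P. {x, y} \<in> E} = {}")
  case True
  then show ?thesis using D_pos by (simp only: card.empty)
next
  case False
  from conn_pair_neighbours[OF minor_closed G hi assms refl this]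
  show ?thesis using bounds by (simp add: D_def le_divide_eq algebra_simps)
qed

lemma sparse_or_rich:
  assumes "S \<subseteq> V" "conn E S" shows "real (card (ind E S)) \<le> a * (real (card S) - 1) \<or> rich E c' S 1"
  using not_rich_sparse[OF k card_edge finite_subset[OF assms(1) finite_V] assms(2)] by (auto simp: a c')

text \<open>The components of \<open>G - r\<close> together with \<open>r\<close> are rich, and they amalgamate at \<open>r\<close>.\<close>

lemma star_rich:
  assumes r: "r \<in> V" and "S \<subseteq> V - {r}" "S \<noteq> {}" "\<And>x y. x \<in> S \<Longrightarrow> y \<in> V - S - {r} \<Longrightarrow> {x, y} \<notin> E"
  shows "\<exists>m. rich E c' (insert r S) m \<and> real (card {y \<in> S. {r, y} \<in> E}) \<le> D * real m"
  using assms(2-4)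
proof (induction "card S" arbitrary: S rule: less_induct)
  case less
  have fS: "finite S" using finite_subset[OF less.prems(1)] finite_V by blast
  have SV: "S \<subseteq> V" "r \<notin> S" using less.prems(1) by auto
  show ?case
  proof (cases "conn E S")
    case True
    have conn: "conn E (insert r S)" by (rule conn_insert_closed[OF connected r SV(2,1) less.prems(3)])
    have "E \<subseteq> ind E (V - S) \<union> ind E (insert r S)"
    proof
      fix e assume e: "e \<in> E"
      then obtain x y where xy: "e = {x, y}" using card_edge[OF e] by (auto simp: card_2_iff)
      then show "e \<in> ind E (V - S) \<union> ind E (insert r S)"
        using e edge_sub[OF e] less.prems(3)[of x y] less.prems(3)[of y x] by (auto simp: ind_def insert_commute)
    qed
    then have "card E \<le> card (ind E (V - S) \<union> ind E (insert r S))"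
      using fS finite_V by (intro card_mono) (auto intro!: finite_ind)
    then have "card E \<le> card (ind E (V - S)) + card (ind E (insert r S))"
      using card_Un_le le_trans by blast
    \<comment> \<open>By minimality the rest has density at most c, so S together with r spans more
      than c times |S| edges. As |S| is the order minus one, this exceeds the bound for sets that
      are not rich.\<close>
    moreover have "real (card (ind E (V - S))) \<le> c * real (card (V - S))"
    proof -
      have "card (V - S) < card V" using SV less.prems(2) finite_V by (intro psubset_card_mono) auto
      then show ?thesis using minimal[OF induced[of "V - S"]] r SV by auto
    qed
    moreover have "card V = card (V - S) + card S"
      using SV fS finite_V card_mono[OF finite_V SV(1)] by (simp add: card_Diff_subset)
    ultimately have "real (card (ind E (insert r S))) > c * real (card S)"
      using dense by (simp add: distrib_left)
    moreover have "a * real (card S) \<le> c * real (card S)" using lo by (intro mult_right_mono) auto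
    moreover have "real (card (insert r S)) - 1 = real (card S)" using SV fS by simp
    ultimately have "rich E c' (insert r S) 1"
      using sparse_or_rich[of "insert r S"] SV r conn by fastforce
    moreover have "real (card {y \<in> S. \<exists>x\<in>{r}. {x, y} \<in> E}) \<le> D"
      by (rule neighbours_le) (use r SV True in auto)
    ultimately show ?thesis by (intro exI[of _ 1]) simp
  next
    case False
    then obtain X where X: "X \<noteq> {}" "X \<subset> S" "\<And>x y. x \<in> X \<Longrightarrow> y \<in> S - X \<Longrightarrow> {x, y} \<notin> E"
      using less.prems(2) unfolding conn_def by blast
    have fX: "finite X" using X fS by (auto intro: finite_subset)
    have "\<exists>m. rich E c' (insert r X) m \<and> real (card {y \<in> X. {r, y} \<in> E}) \<le> D * real m"
    proof (rule less.hyps)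
      show "card X < card S" by (rule psubset_card_mono[OF fS X(2)])
      show "X \<subseteq> V - {r}" "X \<noteq> {}" using X(1,2) less.prems(1) by auto
      show "{x, y} \<notin> E" if "x \<in> X" "y \<in> V - X - {r}" for x y
        using that X(2) X(3)[of x y] less.prems(3)[of x y] by (cases "y \<in> S") auto
    qed
    then obtain m where m: "rich E c' (insert r X) m" "real (card {y \<in> X. {r, y} \<in> E}) \<le> D * real m" by blast
    have "\<exists>m. rich E c' (insert r (S - X)) m \<and> real (card {y \<in> S - X. {r, y} \<in> E}) \<le> D * real m"
    proof (rule less.hyps)
      show "card (S - X) < card S" using X by (intro psubset_card_mono[OF fS]) auto
      show "S - X \<subseteq> V - {r}" "S - X \<noteq> {}" using X(1,2) less.prems(1) by auto
      show "{x, y} \<notin> E" if "x \<in> S - X" "y \<in> V - (S - X) - {r}" for x y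
        using that X(3)[of y x] less.prems(3)[of x y] by (cases "y \<in> X") (auto simp: insert_commute)
    qed
    then obtain n where n: "rich E c' (insert r (S - X)) n" "real (card {y \<in> S - X. {r, y} \<in> E}) \<le> D * real n" by blast
    have "rich E c' (insert r X \<union> insert r (S - X)) (m + n)"
      by (rule rich_overlap[OF _ _ _ m(1) n(1)]) (use fX fS in auto)
    moreover have "insert r X \<union> insert r (S - X) = insert r S" using X(2) by auto
    moreover have "card {y \<in> S. {r, y} \<in> E} = card {y \<in> X. {r, y} \<in> E} + card {y \<in> S - X. {r, y} \<in> E}"
    proof -
      have "{y \<in> S. {r, y} \<in> E} = {y \<in> X. {r, y} \<in> E} \<union> {y \<in> S - X. {r, y} \<in> E}" using X(2) by blast
      then show ?thesis using fX fS by (simp add: card_Un_disjoint disjoint_iff)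
    qed
    ultimately show ?thesis using m(2) n(2) by (intro exI[of _ "m + n"]) (simp add: distrib_left)
  qed
qed

text \<open>Each component of V - r adds 1 to m and contains at most D neighbours of r; the total m
  is bounded by M.\<close>

lemma degree_le:
  assumes r: "r \<in> V" shows "real (card {y \<in> V. {r, y} \<in> E}) \<le> D * M"
proof (cases "V = {r}")
  case True
  have "{y \<in> V. {r, y} \<in> E} = {}" using card_edge[of "{r}"] True by auto
  then show ?thesis using D_pos M_pos by (simp only: card.empty) simp
next
  case False
  have "\<exists>m. rich E c' (insert r (V - {r})) m \<and> real (card {y \<in> V - {r}. {r, y} \<in> E}) \<le> D * real m"
    by (rule star_rich[OF r]) (use r False in auto)
  then obtain m where m: "rich E c' V m" "real (card {y \<in> V - {r}. {r, y} \<in> E}) \<le> D * real m"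
    using r by (auto simp: insert_absorb)
  moreover have "{y \<in> V. {r, y} \<in> E} = {y \<in> V - {r}. {r, y} \<in> E}" using card_edge[of "{r}"] by auto
  moreover have "D * real m \<le> D * M" using rich_le[OF m(1)] D_pos by (intro mult_left_mono) auto
  ultimately show ?thesis by simp
qed

text \<open>Cut \<open>V\<close> into connected parts of bounded size. At most \<open>M\<close> of them are rich and the others have density
  below \<open>a\<close>; two parts are joined by at most \<open>D\<^sup>2\<close> edges, and few pairs of parts are adjacent. If the parts
  are large, the edges between them do not make up for the gap \<open>lo - a\<close>.\<close>

lemma size_le:
  fixes s :: nat
  assumes s: "s \<ge> 1" "real s \<ge> 4 * D\<^sup>2 / (lo - a)"
  shows "real (card V) \<le> max (real s) (4 * (real (nat \<lceil>D * M\<rceil> + 2) * real s) * M / (lo - a))"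
proof (cases "card V \<ge> s")
  case True
  \<comment> \<open>The added 1 ensures \<Delta> \<ge> 1, as the partition into bounded parts
    requires.\<close>
  define \<Delta> where "\<Delta> = nat \<lceil>D * M\<rceil> + 1"
  define K where "K = (\<Delta> + 1) * s"
  have "card {y \<in> V. {r, y} \<in> E} \<le> \<Delta>" if "r \<in> V" for r
    using degree_le[OF that] by (simp add: \<Delta>_def) linarith
  from conn_bounded_partition[OF finite_V connected s(1) _ True this] obtain \<P> where
    \<P>: "\<Union>\<P> = V" "\<And>Q R. Q \<in> \<P> \<Longrightarrow> R \<in> \<P> \<Longrightarrow> Q \<noteq> R \<Longrightarrow> Q \<inter> R = {}"
    "\<And>Q. Q \<in> \<P> \<Longrightarrow> conn E Q" "\<And>Q. Q \<in> \<P> \<Longrightarrow> s \<le> card Q" "\<And>Q. Q \<in> \<P> \<Longrightarrow> card Q \<le> K"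
    by (auto simp: \<Delta>_def K_def)
  have finP: "finite \<P>" using finite_V \<P>(1) finite_UnionD by blast
  have QV: "Q \<subseteq> V" "finite Q" if "Q \<in> \<P>" for Q using \<P>(1) that finite_V by (auto intro: finite_subset)
  define q where "q = card \<P>"
  have cV: "card V = (\<Sum>Q\<in>\<P>. card Q)"
    using card_Union_disjoint[of \<P>] \<P>(1,2) QV(2) by (auto simp: pairwise_def disjnt_def)
  have "q * s \<le> card V" using sum_bounded_below[of \<P> s card] \<P>(4) by (simp add: cV q_def)
  then have qs: "real q * real s \<le> real (card V)" by (metis of_nat_le_iff of_nat_mult)

  \<comment> \<open>Connected parts always have the default value 0, so values can be summed over
    the whole partition; the sum is the number of properly rich parts.\<close>
  define m where "m = (\<lambda>Q. if rich E c' Q 1 then 1 else 0 :: nat)"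
  have "rich E c' V (\<Sum>Q\<in>\<P>. m Q)"
  proof (rule rich_partition[OF finite_V connected \<P>(1,2,3)])
    show "rich E c' Q (m Q)" if "Q \<in> \<P>" for Q
      using rich_zero[OF QV(2)[OF that] \<P>(3)[OF that]] by (simp add: m_def)
  qed
  then have mM: "(\<Sum>Q\<in>\<P>. real (m Q)) \<le> M" using rich_le by (metis of_nat_sum)
  \<comment> \<open>A rich part Q has at most \<open>hi\<close> |Q| \<le> 2 K edges; this error is
    paid at most M times.\<close>
  have part: "real (card (ind E Q)) \<le> a * real (card Q) + 2 * real K * real (m Q)" if Q: "Q \<in> \<P>" for Q
  proof (cases "rich E c' Q 1")
    case True
    have "real (card (ind E Q)) \<le> hi * real (card Q)"
      using hi[OF induced[OF QV(1)[OF Q] conn_nonempty[OF \<P>(3)[OF Q]]]] by simp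
    also have "\<dots> \<le> 2 * real K" using bounds \<P>(5)[OF Q] by (intro mult_mono) auto
    also have "\<dots> \<le> a * real (card Q) + 2 * real K" using bounds by simp
    finally show ?thesis using True by (simp add: m_def)
  next
    case False
    then have "real (card (ind E Q)) \<le> a * (real (card Q) - 1)"
      using sparse_or_rich[OF QV(1)[OF Q] \<P>(3)[OF Q]] by blast
    also have "\<dots> \<le> a * real (card Q)" using bounds by (intro mult_left_mono) auto
    finally show ?thesis using False by (simp add: m_def)
  qed

  have "\<forall>Q\<in>\<P>. \<exists>x. x \<in> Q" using conn_nonempty[OF \<P>(3)] by blast
  then obtain f where f: "\<And>Q. Q \<in> \<P> \<Longrightarrow> f Q \<in> Q" by metis
  have "\<forall>x\<in>V. \<exists>Q. Q \<in> \<P> \<and> x \<in> Q" using \<P>(1) by blast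
  then obtain g where g: "\<And>x. x \<in> V \<Longrightarrow> g x \<in> \<P> \<and> x \<in> g x" by metis
  have guniq: "g x = Q" if "Q \<in> \<P>" "x \<in> Q" for x Q
    using that \<P>(2)[of Q "g x"] g[of x] QV(1)[OF that(1)] by blast
  have gf: "g (f Q) = Q" if "Q \<in> \<P>" for Q using guniq[OF that f[OF that]] .
  define \<phi> where "\<phi> = f \<circ> g"
  have \<phi>eq: "\<phi> x = \<phi> y \<longleftrightarrow> g x = g y" if "x \<in> V" "y \<in> V" for x y
    unfolding \<phi>_def comp_def using gf g that by metis
  have qm: "qmap E V \<phi>"
    unfolding qmap_def
  proof
    fix x assume x: "x \<in> V"
    have 1: "g x \<in> \<P>" using g x by blast
    have 2: "\<phi> x \<in> g x" using f[OF 1] by (simp add: \<phi>_def)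
    have "{y \<in> V. \<phi> y = \<phi> x} = g x"
      using \<phi>eq[OF _ x] g guniq[OF 1] QV(1)[OF 1] by blast
    moreover have "\<phi> (\<phi> x) = \<phi> x" using gf[OF 1] by (simp add: \<phi>_def)
    ultimately show "\<phi> x \<in> V \<and> \<phi> (\<phi> x) = \<phi> x \<and> conn E {y \<in> V. \<phi> y = \<phi> x}"
      using 2 QV(1)[OF 1] \<P>(3)[OF 1] by auto
  qed
  have "\<phi> ` V = f ` \<P>"
  proof
    show "\<phi> ` V \<subseteq> f ` \<P>" using g by (auto simp: \<phi>_def)
    have "f Q = \<phi> (f Q)" if "Q \<in> \<P>" for Q using gf[OF that] by (simp add: \<phi>_def)
    moreover have "f Q \<in> V" if "Q \<in> \<P>" for Q using f[OF that] QV(1)[OF that] by blast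
    ultimately show "f ` \<P> \<subseteq> \<phi> ` V" by (metis image_eqI image_subsetI)
  qed
  moreover have "inj_on f \<P>" using gf by (metis inj_onI)
  ultimately have "card (\<phi> ` V) = q" by (simp add: card_image q_def)
  moreover have "(\<phi> ` V, qe E V \<phi>) \<in> \<A>"
    using minor_closed_qmap[OF minor_closed G _ _ qm] conn_nonempty[OF connected] by simp
  ultimately have "real (card (qe E V \<phi>)) \<le> hi * real q" using hi by force
  \<comment> \<open>Adjacent pairs of parts are the edges of a quotient in the class, whose density
    is below 2.\<close>
  then have qe: "real (card (qe E V \<phi>)) \<le> 2 * real q"
    using bounds mult_right_mono[of hi 2 "real q"] by simp

  define X where "X = (\<lambda>h. {d \<in> E. \<phi> ` d = h})"
  \<comment> \<open>Both ends of an edge between two parts are attachment vertices, at most D on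
    each side.\<close>
  have cross: "real (card (X h)) \<le> D\<^sup>2" if h: "h \<in> qe E V \<phi>" for h
  proof -
    obtain u w where uw: "{u, w} \<in> ind E V" "h = {\<phi> u, \<phi> w}" "\<phi> u \<noteq> \<phi> w"
      using qedgesE[OF h] card_edge by (auto simp: ind_def)
    then have uwV: "u \<in> V" "w \<in> V" by (auto simp: ind_def)
    define P Q where "P = g u" and "Q = g w"
    have PQ: "P \<in> \<P>" "Q \<in> \<P>" "P \<noteq> Q" using g uwV uw(3) \<phi>eq by (auto simp: P_def Q_def)
    note dPQ = \<P>(2)[OF PQ]
    define N1 N2 where "N1 = {y \<in> P. \<exists>x\<in>Q. {x, y} \<in> E}" and "N2 = {y \<in> Q. \<exists>x\<in>P. {x, y} \<in> E}"
    have N: "real (card N1) \<le> D" "real (card N2) \<le> D"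
      unfolding N1_def N2_def using PQ dPQ QV(1) \<P>(3)
      by (auto intro!: neighbours_le simp: Int_commute)
    have fN: "finite N1" "finite N2" using PQ QV(2) by (auto simp: N1_def N2_def)
    have "X h \<subseteq> (\<lambda>(x, y). {x, y}) ` (N1 \<times> N2)"
    proof
      fix d assume "d \<in> X h"
      then have d: "d \<in> E" "\<phi> ` d = h" by (auto simp: X_def)
      obtain x0 y0 where xy0: "d = {x0, y0}" using card_edge[OF d(1)] by (auto simp: card_2_iff)
      then obtain x y where xy: "d = {x, y}" "\<phi> x = \<phi> u" "\<phi> y = \<phi> w"
        using d(2) uw(2,3) by (auto simp: doubleton_eq_iff insert_commute)
      have xyV: "x \<in> V" "y \<in> V" using edge_sub[OF d(1)] xy by auto
      have "x \<in> P" "y \<in> Q" using xy(2,3) \<phi>eq[OF xyV(1) uwV(1)] \<phi>eq[OF xyV(2) uwV(2)] g[OF xyV(1)] g[OF xyV(2)]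
        by (auto simp: P_def Q_def)
      moreover have "{y, x} \<in> E" "{x, y} \<in> E" using d(1) xy(1) by (auto simp: insert_commute)
      ultimately have "x \<in> N1" "y \<in> N2" unfolding N1_def N2_def by blast+
      then show "d \<in> (\<lambda>(x, y). {x, y}) ` (N1 \<times> N2)" using xy(1) by force
    qed
    then have "card (X h) \<le> card ((\<lambda>(x, y). {x, y}) ` (N1 \<times> N2))" using fN by (intro card_mono) auto
    also have "\<dots> \<le> card N1 * card N2"
      using card_image_le[of "N1 \<times> N2" "\<lambda>(x, y). {x, y}"] fN by (simp add: card_cartesian_product)
    finally have "real (card (X h)) \<le> real (card N1) * real (card N2)" by (metis of_nat_le_iff of_nat_mult)
    also have "\<dots> \<le> D\<^sup>2" unfolding power2_eq_square using N D_pos by (intro mult_mono) auto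
    finally show ?thesis .
  qed

  have "E \<subseteq> (\<Union>Q\<in>\<P>. ind E Q) \<union> (\<Union>h\<in>qe E V \<phi>. X h)"
  proof
    fix d assume d: "d \<in> E"
    then obtain x y where xy: "d = {x, y}" "x \<in> V" "y \<in> V" using card_edge[OF d] edge_sub[OF d] by (auto simp: card_2_iff)
    show "d \<in> (\<Union>Q\<in>\<P>. ind E Q) \<union> (\<Union>h\<in>qe E V \<phi>. X h)"
    proof (cases "\<phi> x = \<phi> y")
      case True
      then have "d \<in> ind E (g x)" using d xy g \<phi>eq by (auto simp: ind_def)
      then show ?thesis using g xy(2) by blast
    next
      case False
      then have "\<phi> ` d \<in> qe E V \<phi>" using d xy qedgesI[of x y "ind E V" \<phi>] by (auto simp: ind_def)
      moreover have "d \<in> X (\<phi> ` d)" using d by (simp add: X_def)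
      ultimately show ?thesis by blast
    qed
  qed
  moreover have "finite (\<Union>Q\<in>\<P>. ind E Q)" "finite (\<Union>h\<in>qe E V \<phi>. X h)"
    using finP finite_E finite_qe[OF finite_V, of E \<phi>] QV(2) by (auto simp: X_def intro!: finite_ind)
  ultimately have "card E \<le> card ((\<Union>Q\<in>\<P>. ind E Q) \<union> (\<Union>h\<in>qe E V \<phi>. X h))"
    by (intro card_mono) auto
  also have "\<dots> \<le> (\<Sum>Q\<in>\<P>. card (ind E Q)) + (\<Sum>h\<in>qe E V \<phi>. card (X h))"
    by (intro order_trans[OF card_Un_le] add_mono card_UN_le finP finite_qe finite_V)
  finally have "real (card E) \<le> (\<Sum>Q\<in>\<P>. real (card (ind E Q))) + (\<Sum>h\<in>qe E V \<phi>. real (card (X h)))"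
    by (simp flip: of_nat_sum of_nat_add)
  also have "\<dots> \<le> (\<Sum>Q\<in>\<P>. a * real (card Q) + 2 * real K * real (m Q)) + (\<Sum>h\<in>qe E V \<phi>. D\<^sup>2)"
    using part cross by (intro add_mono sum_mono)
  also have "\<dots> = a * real (card V) + 2 * real K * (\<Sum>Q\<in>\<P>. real (m Q)) + real (card (qe E V \<phi>)) * D\<^sup>2"
    by (simp add: sum.distrib sum_distrib_left[symmetric] cV)
  also have "\<dots> \<le> a * real (card V) + 2 * real K * M + 2 * real q * D\<^sup>2"
    using mM qe by (intro add_mono mult_left_mono mult_right_mono) auto
  finally have "c * real (card V) < a * real (card V) + 2 * real K * M + 2 * real q * D\<^sup>2"
    using dense by simp
  moreover have "lo * real (card V) \<le> c * real (card V)" using lo by (intro mult_right_mono) auto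
  \<comment> \<open>The lower bound on s enters here: the q \<le> v / s parts contribute at most
    half of the gap (lo - a) v.\<close>
  moreover have "2 * real q * D\<^sup>2 \<le> (lo - a) / 2 * real (card V)"
  proof -
    have "4 * D\<^sup>2 \<le> (lo - a) * real s" using s(2) lo by (simp add: divide_le_eq mult.commute)
    then have "real q * (4 * D\<^sup>2) \<le> real q * ((lo - a) * real s)" by (intro mult_left_mono) auto
    also have "\<dots> = (lo - a) * (real q * real s)" by simp
    also have "\<dots> \<le> (lo - a) * real (card V)" using qs lo by (intro mult_left_mono) auto
    finally show ?thesis by simp
  qed
  ultimately have "(lo - a) * real (card V) \<le> 4 * real K * M" by (simp add: algebra_simps)
  then have "real (card V) \<le> 4 * real K * M / (lo - a)" using lo by (simp add: le_divide_eq mult.commute)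
  moreover have "real K = real (nat \<lceil>D * M\<rceil> + 2) * real s" by (simp add: K_def \<Delta>_def algebra_simps)
  ultimately show ?thesis by simp
qed simp

end

text \<open>The bound n on the order of a minimal graph is uniform in c. For a hypothetical \<beta>
  outside the finite set R of densities of graphs of order at most n, c is chosen so that R has no
  element strictly between c and \<beta>. A minimal graph of density above c then has order at most
  n and density below \<beta>, a contradiction.\<close>

lemma finite_critical_densities_between:
  assumes k: "k \<ge> 1" and lo: "2 - 1 / real k < lo" and hi: "hi < 2 - 1 / (real k + 1)"
  shows "finite (critical_densities \<inter> {lo..hi})"
proof -
  define a where "a = 2 - 1 / real k"
  define c' where "c' = 2 - 1 / (real k + 1)"
  \<comment> \<open>The midpoint leaves room on both sides: a < lo' keeps the gap positive, and lo'
    < lo \<le> \<beta> is needed for c < \<beta>.\<close>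
  define lo' where "lo' = (a + lo) / 2"
  have lo': "a < lo'" "lo' < lo" using lo by (auto simp: lo'_def a_def)
  let ?D = "minimal_dense.D hi" and ?M = "minimal_dense.M hi c'"
  define s where "s = nat \<lceil>4 * ?D\<^sup>2 / (lo' - a)\<rceil> + 1"
  define n where "n = nat \<lceil>max (real s) (4 * (real (nat \<lceil>?D * ?M\<rceil> + 2) * real s) * ?M / (lo' - a))\<rceil>"
  define R where "R = density ` {G :: nat graph. simple_graph G \<and> card (verts G) \<le> n}"
  have finR: "finite R" unfolding R_def by (rule finite_densities)
  have "\<beta> \<in> R" if \<beta>: "\<beta> \<in> critical_densities \<inter> {lo..hi}" for \<beta>
  proof (rule ccontr)
    assume nR: "\<beta> \<notin> R"
    obtain \<A> where A: "minor_closed \<A>" "proper_class \<A>" "critical_density \<A> = \<beta>"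
      using \<beta> by (auto simp: critical_densities_def)
    have gc: "graph_class \<A>" by (rule minor_closed_class[OF A(1)])
    \<comment> \<open>The inserted lo' is a floor for c and the default when no element of R lies
      below \<beta>.\<close>
    define c where "c = Max (insert lo' {x \<in> R. x < \<beta>})"
    have c: "lo' \<le> c" "\<And>x. x \<in> R \<Longrightarrow> x < \<beta> \<Longrightarrow> x \<le> c" using finR by (auto simp: c_def)
    have "c \<in> insert lo' {x \<in> R. x < \<beta>}" unfolding c_def using finR by (intro Max_in) auto
    then have "c < \<beta>" using lo' \<beta> by auto
    then obtain G0 where G0: "G0 \<in> \<A>" "c < density G0" using critical_density_less[OF A(1,2)] A(3) by metis
    define P where "P = (\<lambda>G. G \<in> \<A> \<and> c < density G)"
    obtain G where G: "P G" and mn: "\<And>H. P H \<Longrightarrow> card (verts G) \<le> card (verts H)"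
    proof -
      have "P G0" using G0 by (simp add: P_def)
      from ex_has_least_nat[of P, OF this, of "\<lambda>G. card (verts G)"] show ?thesis using that by blast
    qed
    obtain V E where VE: "G = (V, E)" by (cases G)
    have GA: "(V, E) \<in> \<A>" "c < density (V, E)" using G by (auto simp: P_def VE)
    interpret minimal_dense \<A> V E k a lo' c hi c'
    proof
      show "minor_closed \<A>" "(V, E) \<in> \<A>" by (fact A(1), fact GA(1))
      show "real (card (edges H)) \<le> hi * real (card (verts H))" if "H \<in> \<A>" for H
        using critical_density_upper[OF A(1,2) that] \<beta> A(3) density_le_iff[OF class_simple[OF gc that], of hi] by simp
      show "c * real (card V) < real (card E)"
        using GA(2) density_le_iff[OF class_simple[OF gc GA(1)], of c] by simp
      show "real (card (edges H)) \<le> c * real (card (verts H))" if "H \<in> \<A>" "card (verts H) < card V" for H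
      proof -
        have "\<not> P H" using mn[of H] that(2) by (auto simp: VE)
        then have "density H \<le> c" using that(1) by (simp add: P_def)
        then show ?thesis using density_le_iff[OF class_simple[OF gc that(1)]] by blast
      qed
      show "k \<ge> 1" "a < lo'" "lo' \<le> c" by (fact k, fact lo'(1), fact c(1))
      show "hi < c'" using hi by (simp add: c'_def)
    qed (fact a_def, fact c'_def)
    have s1: "1 \<le> s" by (simp add: s_def)
    have "real s \<ge> 4 * ?D\<^sup>2 / (lo' - a)" unfolding s_def by linarith
    from size_le[OF s1 this] have "card V \<le> n"
      unfolding n_def by linarith
    then have "density (V, E) \<in> R" using class_simple[OF gc GA(1)] by (auto simp: R_def)
    moreover have "density (V, E) < \<beta>"
      using critical_density_upper[OF A(1,2) GA(1)] A(3) nR \<open>density (V, E) \<in> R\<close> by (metis order.not_eq_order_implies_strict)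
    ultimately show False using c(2) GA(2) by force
  qed
  then show ?thesis using finR by (meson finite_subset subsetI)
qed

section \<open>Accumulation points and the comparison of the three sets\<close>

lemma not_islimpt_if_finite_interval:
  fixes x :: real
  assumes "finite (S \<inter> {lo..hi})" "lo < x" "x < hi"
  shows "\<not> x islimpt S"
proof
  assume "x islimpt S"
  then have "infinite (S \<inter> {lo<..<hi})"
    using assms(2,3) unfolding islimpt_eq_acc_point by (metis Int_commute greaterThanLessThan_iff open_greaterThanLessThan)
  moreover have "S \<inter> {lo<..<hi} \<subseteq> S \<inter> {lo..hi}" by auto
  ultimately show False using assms(1) finite_subset by blast
qed

theorem theorem5:
  shows "{1 + \<beta> | \<beta>. \<beta> \<in> critical_densities} \<subset> critical_densities2 \<and>
    critical_densities2 \<subseteq> critical_densities' \<and>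
    critical_densities2 \<inter> {0..<1} = {} \<and>
    critical_densities' \<inter> {0..<1} = {} \<and>
    {1 + \<beta> | \<beta>. \<beta> \<in> critical_densities} \<inter> {1..2} = {2 - 1 / real k | k. k \<ge> 1} \<union> {2} \<and>
    critical_densities2 \<inter> {1..2} = {2 - 1 / real k | k. k \<ge> 1} \<union> {2} \<and>
    critical_densities' \<inter> {1..2} = {2 - 1 / real k | k. k \<ge> 1} \<union> {2}"
proof -
  let ?B1 = "{1 + \<beta> | \<beta>. \<beta> \<in> critical_densities}"
  let ?L = "{2 - 1 / real k | k. k \<ge> 1} \<union> {2 :: real}"
  have B1_B2: "?B1 \<subseteq> critical_densities2"
    using one_plus_critical_density by (auto simp: critical_densities_def)
  have "23 / 10 \<notin> ?B1"
  proof
    assume "23 / 10 \<in> ?B1"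
    then obtain \<beta> where "\<beta> \<in> critical_densities" "23 / 10 = 1 + \<beta>" by blast
    moreover from this have "\<beta> = 13 / 10" by simp
    ultimately have "13 / 10 \<in> critical_densities" by simp
    then show False using thirteen_tenths_not_critical by blast
  qed
  then have strict: "?B1 \<subset> critical_densities2" using B1_B2 twenty_three_tenths_critical2 by blast
  have B2: "x islimpt critical_densities" "x \<ge> 1" if x: "x \<in> critical_densities2" for x
  proof -
    obtain \<A> where \<A>: "x = critical_density \<A>" "two_connected_obstructions \<A>"
      using x by (auto simp: critical_densities2_def two_connected_obstructions_def)
    show "x islimpt critical_densities" "x \<ge> 1"
      using two_connected_obstructions.islimpt_critical_density[OF \<A>(2)]
        two_connected_obstructions.critical_density_ge_1[OF \<A>(2)] \<A>(1) by auto
  qed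
  have B2_B': "critical_densities2 \<subseteq> critical_densities'" using B2 by (auto simp: critical_densities'_def)
  have nonneg: "\<beta> \<ge> 0" if "\<beta> \<in> critical_densities" for \<beta>
    using that critical_density_nonneg by (auto simp: critical_densities_def)
  have below1: "\<exists>k\<ge>1. \<beta> = 1 - 1 / real k" if "\<beta> \<in> critical_densities" "\<beta> < 1" for \<beta>
    using that critical_density_below_1 by (auto simp: critical_densities_def)
  have L_B1: "?L \<subseteq> ?B1 \<inter> {1..2}"
  proof -
    have "2 - 1 / real k \<in> ?B1 \<inter> {1..2}" if "k \<ge> 1" for k
      using one_minus_inverse_critical[OF that] that by (auto simp: divide_le_eq intro!: exI[of _ "1 - 1 / real k"])
    moreover have "2 \<in> ?B1 \<inter> {1..2}" using one_critical by (auto intro!: exI[of _ 1])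
    ultimately show ?thesis by blast
  qed
  have B'_ge1: "x \<ge> 1" if x: "x \<in> critical_densities'" for x
  proof (rule ccontr)
    assume x1: "\<not> x \<ge> 1"
    define y where "y = (x + 1) / 2"
    have y: "x < y" "y < 1" using x1 by (auto simp: y_def)
    \<comment> \<open>Up to y < 1 only the values 1 - 1/k with k \<le> 1 / (1 - y) occur.\<close>
    have "critical_densities \<inter> {x - 1..y} \<subseteq> (\<lambda>k. 1 - 1 / real k) ` {..nat \<lceil>1 / (1 - y)\<rceil>}"
    proof
      fix \<beta> assume "\<beta> \<in> critical_densities \<inter> {x - 1..y}"
      then obtain k where k: "k \<ge> 1" "\<beta> = 1 - 1 / real k" "\<beta> \<le> y" using below1[of \<beta>] y by auto
      have "1 - y \<le> 1 / real k" using k by simp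
      then have "real k \<le> 1 / (1 - y)" using k y by (simp add: field_simps)
      then have "k \<le> nat \<lceil>1 / (1 - y)\<rceil>" by linarith
      then show "\<beta> \<in> (\<lambda>k. 1 - 1 / real k) ` {..nat \<lceil>1 / (1 - y)\<rceil>}" using k by auto
    qed
    then have "finite (critical_densities \<inter> {x - 1..y})" by (rule finite_subset) simp
    then have "\<not> x islimpt critical_densities" using y by (intro not_islimpt_if_finite_interval[of _ "x - 1" y]) auto
    then show False using x by (simp add: critical_densities'_def)
  qed
  have B'_L: "critical_densities' \<inter> {1..2} \<subseteq> ?L"
  proof
    fix x assume x: "x \<in> critical_densities' \<inter> {1..2}"
    show "x \<in> ?L"
    proof (rule ccontr)
      assume nL: "x \<notin> ?L"
      then have x2: "1 \<le> x" "x < 2" using x by auto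
      \<comment> \<open>Solving 2 - 1/t = x gives t = 1 / (2 - x); its integer part is the k with 2
        - 1/k \<le> x < 2 - 1/(k + 1).\<close>
      define k where "k = nat \<lfloor>1 / (2 - x)\<rfloor>"
      have ge1: "1 / (2 - x) \<ge> 1" using x2 by (simp add: le_divide_eq)
      then have "1 \<le> \<lfloor>1 / (2 - x)\<rfloor>" by (simp only: one_le_floor)
      then have k1: "k \<ge> 1" unfolding k_def by linarith
      have kx: "real k \<le> 1 / (2 - x)" "1 / (2 - x) < real k + 1"
        using ge1 unfolding k_def by linarith+
      have "2 - 1 / real k \<le> x" using kx(1) k1 x2 by (simp add: field_simps)
      moreover have "2 - 1 / real k \<noteq> x" using nL k1 by blast
      ultimately have lo: "2 - 1 / real k < x" by simp
      have hi: "x < 2 - 1 / (real k + 1)" using kx(2) x2 by (simp add: field_simps)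
      define l h where "l = (2 - 1 / real k + x) / 2" and "h = (x + (2 - 1 / (real k + 1))) / 2"
      have "finite (critical_densities \<inter> {l..h})"
        by (rule finite_critical_densities_between[OF k1]) (use lo hi in \<open>auto simp: l_def h_def\<close>)
      moreover have "l < x" "x < h" using lo hi by (auto simp: l_def h_def)
      ultimately have "\<not> x islimpt critical_densities" by (rule not_islimpt_if_finite_interval)
      then show False using x by (simp add: critical_densities'_def)
    qed
  qed
  \<comment> \<open>On [1, 2] the inclusions close up to a cycle: the list lies in 1 + B, which lies
    in B2, which lies in B', which lies in the list.\<close>
  have "?B1 \<inter> {1..2} = ?L" "critical_densities2 \<inter> {1..2} = ?L" "critical_densities' \<inter> {1..2} = ?L"
    using L_B1 B1_B2 B2_B' B'_L by blast+
  moreover have "critical_densities2 \<inter> {0..<1} = {}" using B2(2) by fastforce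
  moreover have "critical_densities' \<inter> {0..<1} = {}" using B'_ge1 by fastforce
  ultimately show ?thesis using strict B2_B' by blast
qed

end
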